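(* Let $N\ge 3$, let $\Omega\subseteq\mathbb{R}^N$ be a domain with $0\in\Omega$, and let $h$ and $f$ satisfy assumptions (H) and (F) stated in the context. Let $u\in\mathcal H_{\rm loc}(\Omega)$ be an $\mathcal H$-solution of $-\Delta u-\left(\frac{N-2}{2}\right)^2\frac{u}{|x|^2}=h(x)u+f(x,u)$ in $\Omega$. If $u(x)=O(|x|^k)$ as $|x|\to0^+$ for every $k\in\mathbb{N}$, then $u\equiv0$ in $\Omega$.
   Context: All functions are real-valued; a domain is a connected open set. (H): $h\in L^\infty_{\rm loc}(\Omega\setminus\{0\})$ and $|h(x)|\le C_h|x|^{-2+\varepsilon}$ in $\Omega\setminus\{0\}$ for some $C_h>0$ and $\varepsilon\in(0,2)$. (F): $f\in C^0(\Omega\times\mathbb{R})$, $F(x,s):=\int_0^sf(x,t)\,dt$ belongs to $C^1(\Omega\times\mathbb{R})$, $s\mapsto f(x,s)\in C^1(\mathbb{R})$ for a.e. $x\in\Omega$, and $|f(x,s)s|+|f'_s(x,s)s^2|+|\nabla_xF(x,s)\cdot x|\le C_f(|s|^2+|s|^p)$ for a.e. $x\in\Omega$ and all $s\in\mathbb{R}$, where $2<p<2^*=\frac{2N}{N-2}$, $f'_s=\partial f/\partial s$, and $C_f>0$ is a constant independent of $x,s$. For a bounded domain $\omega\subset\mathbb{R}^N$ with $0\in\omega$ and $\partial\omega\in C^1$ (outer unit normal $\nu$), $\mathcal H(\omega)$ is the completion of $C^\infty_c(\overline\omega\setminus\{0\})$ with respect to the scalar product $$(u,v)_{\mathcal H(\omega)}=\int_\omega\nabla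 u\cdot\nabla v\,dx-\left(\tfrac{N-2}{2}\right)^2\int_\omega\frac{uv}{|x|^2}dx+\int_\omega uv\,dx+\frac{N-2}{2}\int_{\partial\omega}\frac{uv}{|x|^2}(x\cdot\nu)\,dS ;$$ its elements are identified with functions in $L^2(\omega)$. $\mathcal H_{\rm loc}(\Omega)$ is the space of $u\in H^1_{\rm loc}(\Omega\setminus\{0\})$ such that $u|_\omega\in\mathcal H(\omega)$ for every such $\omega\Subset\Omega$. An $\mathcal H$-solution of the equation is a function $u\in\mathcal H_{\rm loc}(\Omega)$ such that $\int_\Omega\nabla u\cdot\nabla\varphi\,dx-(\frac{N-2}{2})^2\int_\Omega\frac{u\varphi}{|x|^2}dx=\int_\Omega(hu+f(x,u))\varphi\,dx$ for all $\varphi\in C^\infty_c(\Omega\setminus\{0\})$. By elliptic regularity such $u$ has a representative in $C^{1,\alpha}_{\rm loc}(\Omega\setminus\{0\})$ for all $\alpha\in(0,1)$, which is the one used for pointwise values. *)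

theory Defs
  imports "HOL-Analysis.Analysis" "HOL-Library.Landau_Symbols"
begin

section \<open>Classical differentiability\<close>

text \<open>\<open>Ck_on k S f\<close> is meant for open \<open>S\<close>: all partial derivatives of order at most \<open>k\<close> exist
  and are continuous on \<open>S\<close>.\<close>

primrec Ck_on :: "nat \<Rightarrow> 'a::euclidean_space set \<Rightarrow> ('a \<Rightarrow> real) \<Rightarrow> bool" where
  "Ck_on 0 S f \<longleftrightarrow> continuous_on S f"
| "Ck_on (Suc k) S f \<longleftrightarrow> (\<forall>x\<in>S. f differentiable (at x)) \<and>
     (\<forall>b\<in>Basis. Ck_on k S (\<lambda>x. frechet_derivative f (at x) b))"

definition smooth_on :: "'a::euclidean_space set \<Rightarrow> ('a \<Rightarrow> real) \<Rightarrow> bool" where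
  "smooth_on S f \<longleftrightarrow> (\<forall>k. Ck_on k S f)"

definition grad :: "('a::euclidean_space \<Rightarrow> real) \<Rightarrow> 'a \<Rightarrow> 'a" where
  "grad f x = (\<Sum>b\<in>Basis. frechet_derivative f (at x) b *\<^sub>R b)"

text \<open>\<open>C\<^sub>c\<^sup>\<infinity>(U)\<close> for open \<open>U\<close>; its elements are extended by zero to the whole space.\<close>

definition test_functions :: "'a::euclidean_space set \<Rightarrow> ('a \<Rightarrow> real) set" where
  "test_functions U = {\<phi>. smooth_on UNIV \<phi> \<and> compact (closure {x. \<phi> x \<noteq> 0}) \<and>
     closure {x. \<phi> x \<noteq> 0} \<subseteq> U}"


section \<open>Local Lebesgue and Sobolev spaces\<close>

definition Linf_loc :: "'a::euclidean_space set \<Rightarrow> ('a \<Rightarrow> real) \<Rightarrow> bool" where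
  "Linf_loc U h \<longleftrightarrow> h \<in> borel_measurable (lebesgue_on U) \<and>
     (\<forall>K. compact K \<and> K \<subseteq> U \<longrightarrow> (\<exists>M. AE x in lebesgue_on K. \<bar>h x\<bar> \<le> M))"

definition L2_loc :: "'a::euclidean_space set \<Rightarrow> ('a \<Rightarrow> 'b::euclidean_space) \<Rightarrow> bool" where
  "L2_loc U u \<longleftrightarrow> u \<in> borel_measurable (lebesgue_on U) \<and>
     (\<forall>K. compact K \<and> K \<subseteq> U \<longrightarrow> integrable (lebesgue_on K) (\<lambda>x. (norm (u x))\<^sup>2))"

definition weak_gradient ::
    "'a::euclidean_space set \<Rightarrow> ('a \<Rightarrow> real) \<Rightarrow> ('a \<Rightarrow> 'a) \<Rightarrow> bool" where
  "weak_gradient U u g \<longleftrightarrow> (\<forall>\<phi>\<in>test_functions U. \<forall>b\<in>Basis.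
     (LINT x|lebesgue_on U. u x * (grad \<phi> x \<bullet> b)) =
     - (LINT x|lebesgue_on U. (g x \<bullet> b) * \<phi> x))"

definition H1_loc :: "'a::euclidean_space set \<Rightarrow> ('a \<Rightarrow> real) \<Rightarrow> bool" where
  "H1_loc U u \<longleftrightarrow> L2_loc U u \<and> (\<exists>g. L2_loc U g \<and> weak_gradient U u g)"


section \<open>Surface measure and outer unit normal\<close>

text \<open>The \<open>d\<close>-dimensional Hausdorff measure, normalised so that it is the usual surface measure on
  \<open>d\<close>-dimensional \<open>C\<^sup>1\<close> surfaces. Covering sets have to be bounded because \<^const>\<open>diameter\<close> carries no
  information about unbounded sets.\<close>

definition hausdorff_gauge :: "nat \<Rightarrow> 'a::euclidean_space set \<Rightarrow> ennreal" where
  "hausdorff_gauge d C =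
     (if C = {} then 0 else ennreal (unit_ball_vol (real d) * (diameter C / 2) ^ d))"

definition hausdorff_premeasure :: "nat \<Rightarrow> real \<Rightarrow> 'a::euclidean_space set \<Rightarrow> ennreal" where
  "hausdorff_premeasure d \<delta> A =
     (INF C\<in>{C :: nat \<Rightarrow> 'a set. A \<subseteq> (\<Union>i. C i) \<and> (\<forall>i. bounded (C i) \<and> diameter (C i) \<le> \<delta>)}.
        \<Sum>i. hausdorff_gauge d (C i))"

definition hausdorff_outer :: "nat \<Rightarrow> 'a::euclidean_space set \<Rightarrow> ennreal" where
  "hausdorff_outer d A = (SUP \<delta>\<in>{0<..}. hausdorff_premeasure d \<delta> A)"

definition hausdorff_measure :: "nat \<Rightarrow> 'a::euclidean_space measure" where
  "hausdorff_measure d = measure_of UNIV (sets borel) (hausdorff_outer d)"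

text \<open>The Hausdorff outer measure is a metric outer measure, so the definition above yields a genuine
  measure on the Borel sets.\<close>

lemma hausdorff_premeasure_mono:
  "A \<subseteq> B \<Longrightarrow> hausdorff_premeasure d \<delta> A \<le> hausdorff_premeasure d \<delta> B"
  unfolding hausdorff_premeasure_def by (rule INF_superset_mono) auto

lemma hausdorff_outer_mono: "A \<subseteq> B \<Longrightarrow> hausdorff_outer d A \<le> hausdorff_outer d B"
  unfolding hausdorff_outer_def by (intro SUP_mono) (auto intro: hausdorff_premeasure_mono)

lemma hausdorff_premeasure_le_outer:
  "\<delta> > 0 \<Longrightarrow> hausdorff_premeasure d \<delta> A \<le> hausdorff_outer d A"
  unfolding hausdorff_outer_def by (intro SUP_upper) auto

lemma hausdorff_premeasure_antimono:
  "\<delta> \<le> \<delta>' \<Longrightarrow> hausdorff_premeasure d \<delta>' A \<le> hausdorff_premeasure d \<delta> A"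
  unfolding hausdorff_premeasure_def by (rule INF_superset_mono) (auto intro: order_trans)

lemma hausdorff_outer_empty: "hausdorff_outer d {} = 0"
proof -
  have "hausdorff_premeasure d \<delta> ({}::'a set) = 0" if "\<delta> > 0" for \<delta>
  proof -
    have "hausdorff_premeasure d \<delta> ({}::'a set) \<le> (\<Sum>i::nat. hausdorff_gauge d ({}::'a set))"
      unfolding hausdorff_premeasure_def using that by (intro INF_lower) auto
    also have "\<dots> = 0" by (simp add: hausdorff_gauge_def)
    finally show ?thesis by simp
  qed
  then show ?thesis unfolding hausdorff_outer_def by (intro SUP_eqI) (auto intro: exI[of _ 1])
qed

lemma hausdorff_premeasure_UN:
  fixes A :: "nat \<Rightarrow> 'a::euclidean_space set"
  shows "hausdorff_premeasure d \<delta> (\<Union>i. A i) \<le> (\<Sum>i. hausdorff_premeasure d \<delta> (A i))"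
proof (rule ennreal_le_epsilon)
  fix e :: real assume fin: "(\<Sum>i. hausdorff_premeasure d \<delta> (A i)) < top" and e: "0 < e"
  have fin': "hausdorff_premeasure d \<delta> (A i) < top" for i
    using fin ennreal_suminf_lessD by blast
  have "\<exists>C. A i \<subseteq> (\<Union>j. C j) \<and> (\<forall>j::nat. bounded (C j) \<and> diameter (C j) \<le> \<delta>) \<and>
     (\<Sum>j. hausdorff_gauge d (C j)) \<le> hausdorff_premeasure d \<delta> (A i) + ennreal (e * (1/2)^Suc i)" for i
  proof -
    have "hausdorff_premeasure d \<delta> (A i) < hausdorff_premeasure d \<delta> (A i) + ennreal (e * (1/2)^Suc i)"
      using fin'[of i] e by (simp add: ennreal_add_left_cancel_less less_top[symmetric]) 
    then show ?thesis
      unfolding hausdorff_premeasure_def[of d \<delta> "A i"] INF_less_iff by (auto intro!: less_imp_le)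
  qed
  then obtain C where C: "\<And>i. A i \<subseteq> (\<Union>j. C i j)"
    "\<And>i j::nat. bounded (C i j) \<and> diameter (C i j) \<le> \<delta>"
    "\<And>i. (\<Sum>j. hausdorff_gauge d (C i j)) \<le> hausdorff_premeasure d \<delta> (A i) + ennreal (e * (1/2)^Suc i)"
    by metis
  define D where "D n = (case prod_decode n of (i, j) \<Rightarrow> C i j)" for n
  have cov: "(\<Union>i. A i) \<subseteq> (\<Union>n. D n)"
  proof
    fix x assume "x \<in> (\<Union>i. A i)"
    then obtain i j where "x \<in> C i j" using C(1) by blast
    then have "x \<in> D (prod_encode (i, j))" by (simp add: D_def)
    then show "x \<in> (\<Union>n. D n)" by blast
  qed
  have "hausdorff_premeasure d \<delta> (\<Union>i. A i) \<le> (\<Sum>n. hausdorff_gauge d (D n))"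
    unfolding hausdorff_premeasure_def using cov C(2) by (intro INF_lower) (auto simp: D_def split: prod.split)
  also have "\<dots> = (\<Sum>n. (\<lambda>(i,j). hausdorff_gauge d (C i j)) (prod_decode n))"
    by (simp add: D_def split_beta)
  also have "\<dots> = (\<Sum>i. \<Sum>j. hausdorff_gauge d (C i j))"
    by (rule suminf_ennreal_2dimen) simp
  also have "\<dots> \<le> (\<Sum>i. hausdorff_premeasure d \<delta> (A i) + ennreal (e * (1/2)^Suc i))"
    by (intro suminf_le C(3)) auto
  also have "\<dots> = (\<Sum>i. hausdorff_premeasure d \<delta> (A i)) + (\<Sum>i. ennreal (e * (1/2)^Suc i))"
    by (simp add: suminf_add)
  also have "(\<Sum>i. ennreal (e * (1/2)^Suc i)) = ennreal e"
    using e sums_mult[OF power_half_series, of e] by (intro suminf_ennreal_eq) auto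
  finally show "hausdorff_premeasure d \<delta> (\<Union>i. A i) \<le> (\<Sum>i. hausdorff_premeasure d \<delta> (A i)) + ennreal e" .
qed

lemma hausdorff_outer_UN:
  fixes A :: "nat \<Rightarrow> 'a::euclidean_space set"
  shows "hausdorff_outer d (\<Union>i. A i) \<le> (\<Sum>i. hausdorff_outer d (A i))"
  unfolding hausdorff_outer_def[of d "\<Union>i. A i"]
proof (rule SUP_least)
  fix \<delta> :: real assume "\<delta> \<in> {0<..}"
  then show "hausdorff_premeasure d \<delta> (\<Union>i. A i) \<le> (\<Sum>i. hausdorff_outer d (A i))"
    by (intro order_trans[OF hausdorff_premeasure_UN] suminf_le hausdorff_premeasure_le_outer) auto
qed

lemma hausdorff_outer_Un:
  fixes A :: "'a::euclidean_space set"
  shows "hausdorff_outer d (A \<union> B) \<le> hausdorff_outer d A + hausdorff_outer d B"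
proof -
  let ?A = "\<lambda>i::nat. if i = 0 then A else if i = 1 then B else {}"
  have "hausdorff_outer d (A \<union> B) \<le> hausdorff_outer d (\<Union>i. ?A i)"
    by (intro hausdorff_outer_mono) (auto intro: exI[of _ 0] exI[of _ 1])
  also have "\<dots> \<le> (\<Sum>i. hausdorff_outer d (?A i))" by (rule hausdorff_outer_UN)
  also have "\<dots> = (\<Sum>i\<in>{0,1}. hausdorff_outer d (?A i))"
    by (intro suminf_finite) (auto simp: hausdorff_outer_empty)
  also have "\<dots> = hausdorff_outer d A + hausdorff_outer d B" by simp
  finally show ?thesis .
qed

lemma hausdorff_outer_separated:
  fixes A B :: "'a::euclidean_space set"
  assumes "\<eta> > 0" and sep: "\<And>x y. x \<in> A \<Longrightarrow> y \<in> B \<Longrightarrow> dist x y \<ge> \<eta>"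
  shows "hausdorff_outer d A + hausdorff_outer d B \<le> hausdorff_outer d (A \<union> B)"
proof -
  have small: "hausdorff_premeasure d \<delta> A + hausdorff_premeasure d \<delta> B \<le> hausdorff_premeasure d \<delta> (A \<union> B)"
    if \<delta>: "0 < \<delta>" "\<delta> < \<eta>" for \<delta>
    unfolding hausdorff_premeasure_def[of d \<delta> "A \<union> B"]
  proof (rule INF_greatest, clarify)
    fix C :: "nat \<Rightarrow> 'a set"
    assume cov: "A \<union> B \<subseteq> (\<Union>i. C i)" and C: "\<forall>i. bounded (C i) \<and> diameter (C i) \<le> \<delta>"
    let ?C = "\<lambda>S i. if C i \<inter> S = {} then {} else C i"
    have le: "hausdorff_premeasure d \<delta> S \<le> (\<Sum>i. hausdorff_gauge d (?C S i))" if S: "S \<subseteq> (\<Union>i. C i)" for S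
      unfolding hausdorff_premeasure_def
    proof (intro INF_lower CollectI conjI allI)
      show "S \<subseteq> (\<Union>i. ?C S i)"
      proof
        fix x assume x: "x \<in> S"
        then obtain i where "x \<in> C i" using S by blast
        with x have "x \<in> ?C S i" by auto
        then show "x \<in> (\<Union>i. ?C S i)" by blast
      qed
    qed (use C \<delta> in auto)
    have "hausdorff_premeasure d \<delta> A + hausdorff_premeasure d \<delta> B
        \<le> (\<Sum>i. hausdorff_gauge d (?C A i)) + (\<Sum>i. hausdorff_gauge d (?C B i))"
      using cov by (intro add_mono le) auto
    also have "\<dots> = (\<Sum>i. hausdorff_gauge d (?C A i) + hausdorff_gauge d (?C B i))"
      by (simp add: suminf_add)
    also have "\<dots> \<le> (\<Sum>i. hausdorff_gauge d (C i))"
    proof (intro suminf_le)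
      fix i
      have "C i \<inter> A = {} \<or> C i \<inter> B = {}"
      proof (rule ccontr)
        assume "\<not> ?thesis"
        then obtain x y where xy: "x \<in> C i" "x \<in> A" "y \<in> C i" "y \<in> B" by blast
        then have "dist x y \<le> diameter (C i)" using C by (intro diameter_bounded_bound) auto
        also have "\<dots> \<le> \<delta>" using C by auto
        finally show False using sep[of x y] xy \<delta> by auto
      qed
      then show "hausdorff_gauge d (?C A i) + hausdorff_gauge d (?C B i) \<le> hausdorff_gauge d (C i)"
        by (auto simp: hausdorff_gauge_def)
    qed auto
    finally show "hausdorff_premeasure d \<delta> A + hausdorff_premeasure d \<delta> B \<le> (\<Sum>i. hausdorff_gauge d (C i))" .
  qed
  have "(SUP \<delta>\<in>{0<..}. hausdorff_premeasure d \<delta> A) + (SUP \<delta>\<in>{0<..}. hausdorff_premeasure d \<delta> B)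
      \<le> hausdorff_outer d (A \<union> B)"
  proof (subst ennreal_SUP_add_left[symmetric], simp, rule SUP_least)
    fix \<delta>1 :: real assume 1: "\<delta>1 \<in> {0<..}"
    show "hausdorff_premeasure d \<delta>1 A + (SUP \<delta>\<in>{0<..}. hausdorff_premeasure d \<delta> B) \<le> hausdorff_outer d (A \<union> B)"
    proof (subst ennreal_SUP_add_right, simp, rule SUP_least)
      fix \<delta>2 :: real assume 2: "\<delta>2 \<in> {0<..}"
      define \<delta> where "\<delta> = min (\<eta>/2) (min \<delta>1 \<delta>2)"
      have \<delta>: "0 < \<delta>" "\<delta> < \<eta>" "\<delta> \<le> \<delta>1" "\<delta> \<le> \<delta>2" using 1 2 assms(1) by (auto simp: \<delta>_def)
      have "hausdorff_premeasure d \<delta>1 A + hausdorff_premeasure d \<delta>2 B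
          \<le> hausdorff_premeasure d \<delta> A + hausdorff_premeasure d \<delta> B"
        by (intro add_mono hausdorff_premeasure_antimono \<delta>)
      also have "\<dots> \<le> hausdorff_premeasure d \<delta> (A \<union> B)" using small \<delta> by blast
      also have "\<dots> \<le> hausdorff_outer d (A \<union> B)" using \<delta> by (intro hausdorff_premeasure_le_outer)
      finally show "hausdorff_premeasure d \<delta>1 A + hausdorff_premeasure d \<delta>2 B \<le> hausdorff_outer d (A \<union> B)" .
    qed
  qed
  then show ?thesis by (simp add: hausdorff_outer_def)
qed

lemma hausdorff_outer_rings:
  fixes R :: "nat \<Rightarrow> 'a::euclidean_space set"
  assumes sep: "\<And>i j. i + 2 \<le> j \<Longrightarrow> \<exists>\<eta>>0. \<forall>x\<in>R i. \<forall>y\<in>(\<Union>k\<in>{j..}. R k). \<eta> \<le> dist x y"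
    and sub: "\<And>i. R i \<subseteq> X"
  shows "(\<Sum>i. hausdorff_outer d (R i)) \<le> 2 * hausdorff_outer d X"
proof -
  have tail: "(\<Sum>i<n. hausdorff_outer d (R (m + 2 * i))) \<le> hausdorff_outer d (\<Union>k\<in>{m..}. R k)" for n m
  proof (induction n arbitrary: m)
    case (Suc n)
    obtain \<eta> where \<eta>: "\<eta> > 0" "\<forall>x\<in>R m. \<forall>y\<in>(\<Union>k\<in>{m+2..}. R k). \<eta> \<le> dist x y" using sep[of m "m+2"] by auto
    have "(\<Sum>i<Suc n. hausdorff_outer d (R (m + 2 * i)))
        = hausdorff_outer d (R m) + (\<Sum>i<n. hausdorff_outer d (R ((m + 2) + 2 * i)))"
      by (subst sum.lessThan_Suc_shift) (simp add: algebra_simps)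
    also have "\<dots> \<le> hausdorff_outer d (R m) + hausdorff_outer d (\<Union>k\<in>{m+2..}. R k)"
      by (intro add_left_mono Suc.IH)
    also have "\<dots> \<le> hausdorff_outer d (R m \<union> (\<Union>k\<in>{m+2..}. R k))"
      using \<eta> by (intro hausdorff_outer_separated[of \<eta>]) auto
    also have "\<dots> \<le> hausdorff_outer d (\<Union>k\<in>{m..}. R k)"
      by (intro hausdorff_outer_mono Un_least UN_mono UN_upper) auto
    finally show ?case .
  qed auto
  have "(\<Sum>i<n. hausdorff_outer d (R i)) \<le> 2 * hausdorff_outer d X" for n
  proof -
    have "(\<Sum>i<n. hausdorff_outer d (R i)) \<le> (\<Sum>i<2*n. hausdorff_outer d (R i))"
      by (intro sum_mono2) auto
    also have "\<dots> = (\<Sum>i<n. hausdorff_outer d (R (0 + 2*i))) + (\<Sum>i<n. hausdorff_outer d (R (1 + 2*i)))"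
      by (induction n) (auto simp: algebra_simps)
    also have "\<dots> \<le> hausdorff_outer d X + hausdorff_outer d X"
      using sub by (intro add_mono order_trans[OF tail] hausdorff_outer_mono) auto
    finally show ?thesis by (simp add: mult_2)
  qed
  then show ?thesis by (intro suminf_le_const) auto
qed

lemma hausdorff_outer_closed:
  fixes C X :: "'a::euclidean_space set"
  assumes C: "closed C"
  shows "hausdorff_outer d (X \<inter> C) + hausdorff_outer d (X - C) \<le> hausdorff_outer d X"
proof (cases "C = {} \<or> hausdorff_outer d X = \<infinity>")
  case True then show ?thesis by (auto simp: hausdorff_outer_empty)
next
  case False
  then have ne: "C \<noteq> {}" and fin: "hausdorff_outer d X < \<infinity>" by (auto simp: less_top[symmetric])
  define D where "D x = infdist x C" for x
  have lip: "D x \<le> D y + dist x y" for x y unfolding D_def by (rule infdist_triangle)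
  define a where "a n = inverse (real (Suc n))" for n
  have a: "a n > 0" "m \<le> n \<Longrightarrow> a n \<le> a m" for m n by (auto simp: a_def)
  have a': "m < n \<Longrightarrow> a n < a m" for m n by (auto simp: a_def)
  have Dpos: "D x > 0" if "x \<notin> C" for x
    unfolding D_def using that C ne infdist_pos_not_in_closed by blast
  define X' where "X' n = {x\<in>X. D x \<ge> a n}" for n
  define R where "R n = {x\<in>X. a (Suc n) \<le> D x \<and> D x < a n}" for n
  have sum_R: "(\<Sum>i. hausdorff_outer d (R i)) \<le> 2 * hausdorff_outer d X"
  proof (rule hausdorff_outer_rings)
    fix i j :: nat assume ij: "i + 2 \<le> j"
    have "a (Suc i) - a j \<le> dist x y" if x: "x \<in> R i" and y: "y \<in> (\<Union>k\<in>{j..}. R k)" for x y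
    proof -
      obtain k where "k \<ge> j" "y \<in> R k" using y by auto
      then have "D y \<le> a j" using a(2)[of j k] by (auto simp: R_def)
      moreover have "D x \<ge> a (Suc i)" using x by (auto simp: R_def)
      ultimately show ?thesis using lip[of x y] by linarith
    qed
    then show "\<exists>\<eta>>0. \<forall>x\<in>R i. \<forall>y\<in>(\<Union>k\<in>{j..}. R k). \<eta> \<le> dist x y"
      using a'[of "Suc i" j] ij by (intro exI[of _ "a (Suc i) - a j"]) auto
  qed (auto simp: R_def)
  have step: "hausdorff_outer d (X \<inter> C) + hausdorff_outer d (X - C)
      \<le> hausdorff_outer d X + (\<Sum>i. hausdorff_outer d (R (i + n)))" for n
  proof -
    have "X - C \<subseteq> X' n \<union> (\<Union>i. R (i + n))"
    proof
      fix x assume x: "x \<in> X - C"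
      show "x \<in> X' n \<union> (\<Union>i. R (i + n))"
      proof (cases "D x \<ge> a n")
        case False
        obtain m where m: "a m < D x"
          using reals_Archimedean[OF Dpos] x unfolding a_def by blast
        define l where "l = (LEAST m. a m \<le> D x)"
        have l: "a l \<le> D x" unfolding l_def by (rule LeastI[of _ m]) (use m in auto)
        have ln: "l > n" using False l a(2)[of l n] by (meson linorder_not_le order_trans)
        then obtain k where k: "l = Suc k" by (cases l) auto
        have "D x < a k" using not_less_Least[of k "\<lambda>m. a m \<le> D x"] k unfolding l_def[symmetric] by auto
        then have "x \<in> R ((k - n) + n)" using x l k ln by (auto simp: R_def)
        then show ?thesis by blast
      qed (use x in \<open>auto simp: X'_def\<close>)
    qed
    then have "hausdorff_outer d (X - C) \<le> hausdorff_outer d (X' n \<union> (\<Union>i. R (i + n)))"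
      by (rule hausdorff_outer_mono)
    also have "\<dots> \<le> hausdorff_outer d (X' n) + (\<Sum>i. hausdorff_outer d (R (i + n)))"
      by (intro order_trans[OF hausdorff_outer_Un] add_left_mono hausdorff_outer_UN)
    finally have "hausdorff_outer d (X \<inter> C) + hausdorff_outer d (X - C)
        \<le> (hausdorff_outer d (X \<inter> C) + hausdorff_outer d (X' n)) + (\<Sum>i. hausdorff_outer d (R (i + n)))"
      by (simp add: add.assoc add_left_mono)
    also have "hausdorff_outer d (X \<inter> C) + hausdorff_outer d (X' n) \<le> hausdorff_outer d ((X \<inter> C) \<union> X' n)"
    proof (rule hausdorff_outer_separated[OF a(1)[of n]])
      fix x y assume "x \<in> X \<inter> C" "y \<in> X' n"
      then show "a n \<le> dist x y"
        using lip[of y x] by (auto simp: X'_def D_def dist_commute)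
    qed
    also have "\<dots> \<le> hausdorff_outer d X" by (intro hausdorff_outer_mono) (auto simp: X'_def)
    finally show ?thesis by (simp add: add_right_mono)
  qed
  have fin_sum: "(\<Sum>i. hausdorff_outer d (R i)) < \<infinity>"
    using sum_R fin by (auto simp: ennreal_mult_less_top intro: le_less_trans)
  have fin_R: "hausdorff_outer d (R i) < \<infinity>" for i
    using fin_sum ennreal_suminf_lessD by auto
  define r where "r i = enn2real (hausdorff_outer d (R i))" for i
  have r: "hausdorff_outer d (R i) = ennreal (r i)" "r i \<ge> 0" for i
    using fin_R[of i] by (auto simp: r_def)
  have summ: "summable r"
    using fin_sum r by (intro summable_suminf_not_top) (auto simp: less_top[symmetric])
  have tail: "(\<Sum>i. hausdorff_outer d (R (i + n))) = ennreal (\<Sum>i. r (i + n))" for n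
    unfolding r(1) using summ r(2) by (intro suminf_ennreal2) (auto simp: summable_iff_shift)
  have "(\<lambda>n. hausdorff_outer d X + ennreal (\<Sum>i. r (i + n))) \<longlonglongrightarrow> hausdorff_outer d X + ennreal 0"
    using suminf_exist_split2[OF summ] by (intro tendsto_intros) auto
  then show ?thesis
    using step unfolding tail by (intro LIMSEQ_le_const) auto
qed

lemma emeasure_hausdorff_measure:
  fixes A :: "'a::euclidean_space set"
  assumes "A \<in> sets borel"
  shows "emeasure (hausdorff_measure d) A = hausdorff_outer d A"
proof -
  let ?L = "lambda_system UNIV UNIV (hausdorff_outer d :: 'a set \<Rightarrow> _)"
  interpret P: sigma_algebra "UNIV :: 'a set" "UNIV" using sigma_algebra_Pow[of "UNIV::'a set"] by simp
  have "outer_measure_space UNIV (hausdorff_outer d :: 'a set \<Rightarrow> _)"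
    unfolding outer_measure_space_def positive_def increasing_def countably_subadditive_def
    by (auto simp: hausdorff_outer_empty hausdorff_outer_mono hausdorff_outer_UN)
  then have ms: "measure_space UNIV ?L (hausdorff_outer d)" by (rule P.caratheodory_lemma)
  then interpret L: sigma_algebra UNIV ?L by (simp add: measure_space_def)
  have closed: "C \<in> ?L" if "closed C" for C :: "'a set"
    unfolding P.lambda_system_eq
  proof (intro CollectI conjI ballI antisym)
    fix X :: "'a set"
    show "hausdorff_outer d X \<le> hausdorff_outer d (X \<inter> C) + hausdorff_outer d (X - C)"
      using hausdorff_outer_Un[of d "X \<inter> C" "X - C"] by (simp add: Int_Diff_Un)
  qed (use hausdorff_outer_closed[OF that] in auto)
  have sub: "sets borel \<subseteq> ?L"
    unfolding borel_eq_closed using closed by (auto intro!: L.sigma_sets_subset)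
  have "countably_additive (sets borel) (hausdorff_outer d :: 'a set \<Rightarrow> _)"
    using ms sub unfolding measure_space_def countably_additive_def by blast
  moreover have "positive (sets borel) (hausdorff_outer d :: 'a set \<Rightarrow> _)"
    by (simp add: positive_def hausdorff_outer_empty)
  ultimately show ?thesis
    using assms
    by (intro emeasure_measure_of[OF hausdorff_measure_def]) (auto simp: sets_measure_of_conv hausdorff_measure_def sets.sigma_sets_eq[of borel, simplified])
qed

text \<open>Near \<open>x\<close> the set \<open>\<omega>\<close> is the region below the graph of a \<open>C\<^sup>1\<close> function over the hyperplane
  orthogonal to \<open>e\<close>. The function \<open>\<gamma>\<close> is only evaluated at points of that hyperplane.\<close>

definition boundary_chart ::
    "'a::euclidean_space set \<Rightarrow> 'a \<Rightarrow> 'a \<Rightarrow> ('a \<Rightarrow> real) \<Rightarrow> real \<Rightarrow> bool" where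
  "boundary_chart \<omega> x e \<gamma> r \<longleftrightarrow> r > 0 \<and> norm e = 1 \<and> Ck_on 1 UNIV \<gamma> \<and>
     \<omega> \<inter> ball x r = {y \<in> ball x r. y \<bullet> e < \<gamma> (y - (y \<bullet> e) *\<^sub>R e)}"

definition C1_boundary :: "'a::euclidean_space set \<Rightarrow> bool" where
  "C1_boundary \<omega> \<longleftrightarrow> (\<forall>x\<in>frontier \<omega>. \<exists>e \<gamma> r. boundary_chart \<omega> x e \<gamma> r)"

definition outer_unit_normal :: "'a::euclidean_space set \<Rightarrow> 'a \<Rightarrow> 'a" where
  "outer_unit_normal \<omega> x = (THE n. \<exists>e \<gamma> r. boundary_chart \<omega> x e \<gamma> r \<and>
     n = sgn (grad (\<lambda>y. y \<bullet> e - \<gamma> (y - (y \<bullet> e) *\<^sub>R e)) x))"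

text \<open>The normal does not depend on the chart.\<close>

lemma outer_unit_normal_eq:
  fixes \<omega> :: "'a::euclidean_space set"
  assumes "open \<omega>" and x: "x \<in> frontier \<omega>" and ch: "boundary_chart \<omega> x e \<gamma> r"
  shows "outer_unit_normal \<omega> x = sgn (grad (\<lambda>y. y \<bullet> e - \<gamma> (y - (y \<bullet> e) *\<^sub>R e)) x)"
    and "norm (outer_unit_normal \<omega> x) = 1"
proof -
  let ?\<rho> = "\<lambda>e \<gamma> y. y \<bullet> e - \<gamma> (y - (y \<bullet> e) *\<^sub>R e) :: real"
  have xw: "x \<notin> \<omega>" using x assms(1) by (simp add: frontier_def interior_open)
  have mem: "y \<in> \<omega> \<longleftrightarrow> ?\<rho> e \<gamma> y < 0" if "boundary_chart \<omega> x e \<gamma> r" "y \<in> ball x r" for e \<gamma> r y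
  proof -
    have "y \<in> \<omega> \<inter> ball x r \<longleftrightarrow> y \<in> {y \<in> ball x r. y \<bullet> e < \<gamma> (y - (y \<bullet> e) *\<^sub>R e)}"
      using that(1) unfolding boundary_chart_def by metis
    then show ?thesis using that(2) by simp
  qed
  have deriv: "(?\<rho> e \<gamma> has_derivative (\<lambda>v. grad (?\<rho> e \<gamma>) x \<bullet> v)) (at x)"
    and ge: "grad (?\<rho> e \<gamma>) x \<bullet> e = 1"
    and zero: "?\<rho> e \<gamma> x = 0" if ch: "boundary_chart \<omega> x e \<gamma> r" for e \<gamma> r
  proof -
    have e: "e \<bullet> e = 1" and r: "r > 0" and g: "\<And>y. \<gamma> differentiable (at y)"
      using ch by (auto simp: boundary_chart_def norm_eq_1)
    define G where "G = frechet_derivative \<gamma> (at (x - (x \<bullet> e) *\<^sub>R e))"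
    have G: "(\<gamma> has_derivative G) (at (x - (x \<bullet> e) *\<^sub>R e))"
      using g by (simp add: G_def frechet_derivative_works[symmetric])
    have D: "(?\<rho> e \<gamma> has_derivative (\<lambda>v. v \<bullet> e - G (v - (v \<bullet> e) *\<^sub>R e))) (at x)"
    proof -
      have "((\<lambda>y. y - (y \<bullet> e) *\<^sub>R e) has_derivative (\<lambda>v. v - (v \<bullet> e) *\<^sub>R e)) (at x)"
        by (auto intro!: derivative_eq_intros)
      from has_derivative_compose[where g=\<gamma> and g'=G, OF this G]
      show ?thesis by (auto intro!: derivative_eq_intros)
    qed
    interpret F: bounded_linear "frechet_derivative (?\<rho> e \<gamma>) (at x)"
      unfolding frechet_derivative_at[OF D, symmetric] by (rule has_derivative_bounded_linear[OF D])
    have gr: "grad (?\<rho> e \<gamma>) x \<bullet> v = frechet_derivative (?\<rho> e \<gamma>) (at x) v" for v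
    proof -
      have "frechet_derivative (?\<rho> e \<gamma>) (at x) v
          = frechet_derivative (?\<rho> e \<gamma>) (at x) (\<Sum>b\<in>Basis. (v \<bullet> b) *\<^sub>R b)"
        by (simp add: euclidean_representation)
      also have "\<dots> = grad (?\<rho> e \<gamma>) x \<bullet> v"
        by (simp add: F.sum F.scale grad_def inner_sum_left inner_commute[of v] mult.commute)
      finally show ?thesis by simp
    qed
    have fd: "frechet_derivative (?\<rho> e \<gamma>) (at x) = (\<lambda>v. v \<bullet> e - G (v - (v \<bullet> e) *\<^sub>R e))"
      using frechet_derivative_at[OF D] by simp
    show "(?\<rho> e \<gamma> has_derivative (\<lambda>v. grad (?\<rho> e \<gamma>) x \<bullet> v)) (at x)"
      unfolding gr fd by (rule D)
    have "G 0 = 0" using G has_derivative_bounded_linear linear_0 bounded_linear.linear by blast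
    then show "grad (?\<rho> e \<gamma>) x \<bullet> e = 1" unfolding gr fd by (simp add: e)
    have "\<not> ?\<rho> e \<gamma> x < 0" using mem[OF ch, of x] xw r by simp
    moreover have "\<not> ?\<rho> e \<gamma> x > 0"
    proof
      assume pos: "?\<rho> e \<gamma> x > 0"
      have "isCont (?\<rho> e \<gamma>) x" using D by (rule has_derivative_continuous)
      then have "eventually (\<lambda>y. ?\<rho> e \<gamma> y > 0) (nhds x)"
        using order_tendstoD(1)[OF _ pos] tendsto_at_iff_tendsto_nhds[of "?\<rho> e \<gamma>" x]
        unfolding isCont_def by blast
      then obtain S where S: "open S" "x \<in> S" "\<And>y. y \<in> S \<Longrightarrow> ?\<rho> e \<gamma> y > 0"
        by (auto simp: eventually_nhds)
      have "x \<in> closure \<omega>" using x by (simp add: frontier_def)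
      then have "\<omega> \<inter> (S \<inter> ball x r) \<noteq> {}"
        using S(2) r open_Int_closure_eq_empty[OF open_Int[OF S(1) open_ball], of x r \<omega>]
        by (auto simp: Int_commute Int_left_commute)
      then obtain y where "y \<in> \<omega>" "y \<in> S" "y \<in> ball x r" by blast
      then have "?\<rho> e \<gamma> y < 0" using mem[OF ch] by blast
      with S(3)[OF \<open>y \<in> S\<close>] show False by simp
    qed
    ultimately show "?\<rho> e \<gamma> x = 0" by simp
  qed
  have le: "grad (?\<rho> e' \<gamma>') x \<bullet> v \<le> 0"
    if c: "boundary_chart \<omega> x e \<gamma> r" and c': "boundary_chart \<omega> x e' \<gamma>' r'" and v: "grad (?\<rho> e \<gamma>) x \<bullet> v < 0"
    for e \<gamma> r e' \<gamma>' r' v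
  proof (rule ccontr)
    assume "\<not> ?thesis"
    then have v': "grad (?\<rho> e' \<gamma>') x \<bullet> v > 0" by simp
    have dd: "((\<lambda>t. ?\<rho> e \<gamma> (x + t *\<^sub>R v)) has_real_derivative grad (?\<rho> e \<gamma>) x \<bullet> v) (at 0)"
      if c: "boundary_chart \<omega> x e \<gamma> r" for e \<gamma> r
    proof -
      have l: "((\<lambda>t. x + t *\<^sub>R v) has_derivative (\<lambda>t. t *\<^sub>R v)) (at (0::real))"
        by (auto intro!: derivative_eq_intros)
      have "(?\<rho> e \<gamma> has_derivative (\<lambda>v. grad (?\<rho> e \<gamma>) x \<bullet> v)) (at (x + 0 *\<^sub>R v))"
        using deriv[OF c] by simp
      note comp = has_derivative_compose[OF l this]
      have "(*) (G \<bullet> v) = (\<lambda>t. G \<bullet> (t *\<^sub>R v))" for G :: 'a by (rule ext) simp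
      then show ?thesis unfolding has_field_derivative_def by (simp only:) (rule comp)
    qed
    obtain d1 where d1: "d1 > 0" "\<And>t. 0 < t \<Longrightarrow> t < d1 \<Longrightarrow> ?\<rho> e \<gamma> (x + t *\<^sub>R v) < 0"
      using DERIV_neg_dec_right[OF dd[OF c] v] zero[OF c] by auto
    obtain d2 where d2: "d2 > 0" "\<And>t. 0 < t \<Longrightarrow> t < d2 \<Longrightarrow> ?\<rho> e' \<gamma>' (x + t *\<^sub>R v) > 0"
      using DERIV_pos_inc_right[OF dd[OF c'] v'] zero[OF c'] by auto
    have r: "r > 0" "r' > 0" using c c' by (auto simp: boundary_chart_def)
    define m where "m = min (min d1 d2) (min r r' / (1 + norm v))"
    define t where "t = m / 2"
    have m: "m > 0" using d1 d2 r by (auto simp: m_def add_pos_nonneg)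
    have t: "t > 0" "t < d1" "t < d2" "t < min r r' / (1 + norm v)"
    proof -
      have "t > 0" "t < m" using m by (auto simp: t_def)
      then show "t > 0" "t < d1" "t < d2" "t < min r r' / (1 + norm v)" unfolding m_def by linarith+
    qed
    have "t * norm v \<le> t * (1 + norm v)" using t by (intro mult_left_mono) auto
    also have "\<dots> < min r r'" using t(4) by (simp add: pos_less_divide_eq add_pos_nonneg)
    finally have "x + t *\<^sub>R v \<in> ball x r" "x + t *\<^sub>R v \<in> ball x r'"
      using t(1) by (auto simp: dist_norm)
    moreover have "?\<rho> e \<gamma> (x + t *\<^sub>R v) < 0" "?\<rho> e' \<gamma>' (x + t *\<^sub>R v) > 0" using d1 d2 t by auto
    ultimately show False using mem[OF c] mem[OF c'] by (metis less_asym)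
  qed
  have uniq: "sgn (grad (?\<rho> e \<gamma>) x) = sgn (grad (?\<rho> e' \<gamma>') x)"
    if c: "boundary_chart \<omega> x e \<gamma> r" and c': "boundary_chart \<omega> x e' \<gamma>' r'" for e \<gamma> r e' \<gamma>' r'
  proof -
    define a b where "a = sgn (grad (?\<rho> e \<gamma>) x)" and "b = sgn (grad (?\<rho> e' \<gamma>') x)"
    have ne: "grad (?\<rho> e \<gamma>) x \<noteq> 0" "grad (?\<rho> e' \<gamma>') x \<noteq> 0" using ge[OF c] ge[OF c'] by auto
    then have n: "a \<bullet> a = 1" "b \<bullet> b = 1" by (simp_all add: a_def b_def norm_eq_1[symmetric] norm_sgn)
    have impl: "b \<bullet> v \<le> 0" if "a \<bullet> v < 0" for v
    proof -
      have "grad (?\<rho> e \<gamma>) x \<bullet> v < 0"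
        using that ne by (simp add: a_def sgn_div_norm mult_less_0_iff)
      from le[OF c c' this] show ?thesis
        using ne by (simp add: b_def sgn_div_norm mult_le_0_iff)
    qed
    have "a \<bullet> b \<ge> 1"
    proof (rule ccontr)
      assume *: "\<not> ?thesis"
      have "a \<bullet> (b - a) < 0" using * n by (simp add: inner_diff_right)
      from impl[OF this] have "1 \<le> a \<bullet> b" using n by (simp add: inner_diff_right inner_commute)
      with * show False by simp
    qed
    then have "(norm (a - b))\<^sup>2 \<le> 0"
      using n by (simp add: power2_norm_eq_inner inner_diff_left inner_diff_right inner_commute)
    then show ?thesis by (simp add: a_def b_def)
  qed
  show eq: "outer_unit_normal \<omega> x = sgn (grad (?\<rho> e \<gamma>) x)"
    unfolding outer_unit_normal_def
    by (rule the_equality) (use ch uniq in blast)+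
  have "grad (?\<rho> e \<gamma>) x \<noteq> 0" using ge[OF ch] by auto
  then show "norm (outer_unit_normal \<omega> x) = 1" by (simp add: eq norm_sgn)
qed



section \<open>The space \<open>\<H>\<close> and \<open>\<H>\<close>-solutions\<close>

definition H_inner :: "'a::euclidean_space set \<Rightarrow> ('a \<Rightarrow> real) \<Rightarrow> ('a \<Rightarrow> real) \<Rightarrow> real" where
  "H_inner \<omega> u v =
     (LINT x|lebesgue_on \<omega>. grad u x \<bullet> grad v x)
     - ((real DIM('a) - 2) / 2)\<^sup>2 * (LINT x|lebesgue_on \<omega>. u x * v x / (norm x)\<^sup>2)
     + (LINT x|lebesgue_on \<omega>. u x * v x)
     + (real DIM('a) - 2) / 2 *
       (LINT x:frontier \<omega>|hausdorff_measure (DIM('a) - 1).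
          u x * v x / (norm x)\<^sup>2 * (x \<bullet> outer_unit_normal \<omega> x))"

text \<open>The completion, as a space of functions: an element of the abstract completion, given by an
  \<open>H_inner\<close>-Cauchy sequence, is identified with the \<open>L\<^sup>2(\<omega>)\<close>-limit of that sequence.
  Functions in \<open>C\<^sub>c\<^sup>\<infinity>(closure \<omega> - {0})\<close> are represented by extensions in \<open>C\<^sub>c\<^sup>\<infinity>(- {0})\<close>; only their
  values on \<open>closure \<omega>\<close> enter.\<close>

definition H_space :: "'a::euclidean_space set \<Rightarrow> ('a \<Rightarrow> real) \<Rightarrow> bool" where
  "H_space \<omega> u \<longleftrightarrow>
     u \<in> borel_measurable (lebesgue_on \<omega>) \<and> integrable (lebesgue_on \<omega>) (\<lambda>x. (u x)\<^sup>2) \<and>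
     (\<exists>\<phi>. (\<forall>n. \<phi> n \<in> test_functions (- {0})) \<and>
        (\<forall>e>0. \<exists>M. \<forall>m\<ge>M. \<forall>n\<ge>M.
           H_inner \<omega> (\<lambda>x. \<phi> m x - \<phi> n x) (\<lambda>x. \<phi> m x - \<phi> n x) < e\<^sup>2) \<and>
        (\<lambda>n. LINT x|lebesgue_on \<omega>. (\<phi> n x - u x)\<^sup>2) \<longlonglongrightarrow> 0)"

definition H_loc :: "'a::euclidean_space set \<Rightarrow> ('a \<Rightarrow> real) \<Rightarrow> bool" where
  "H_loc \<Omega> u \<longleftrightarrow> H1_loc (\<Omega> - {0}) u \<and>
     (\<forall>\<omega>. open \<omega> \<and> connected \<omega> \<and> bounded \<omega> \<and> 0 \<in> \<omega> \<and> C1_boundary \<omega> \<and> closure \<omega> \<subseteq> \<Omega>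
        \<longrightarrow> H_space \<omega> u)"

definition H_solution ::
    "'a::euclidean_space set \<Rightarrow> ('a \<Rightarrow> real) \<Rightarrow> ('a \<Rightarrow> real \<Rightarrow> real) \<Rightarrow> ('a \<Rightarrow> real) \<Rightarrow> bool" where
  "H_solution \<Omega> h f u \<longleftrightarrow> H_loc \<Omega> u \<and>
     (\<exists>g. L2_loc (\<Omega> - {0}) g \<and> weak_gradient (\<Omega> - {0}) u g \<and>
       (\<forall>\<phi>\<in>test_functions (\<Omega> - {0}).
          (LINT x|lebesgue_on \<Omega>. g x \<bullet> grad \<phi> x)
          - ((real DIM('a) - 2) / 2)\<^sup>2 * (LINT x|lebesgue_on \<Omega>. u x * \<phi> x / (norm x)\<^sup>2)
          = (LINT x|lebesgue_on \<Omega>. (h x * u x + f x (u x)) * \<phi> x)))"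

text \<open>The representative of a solution \<open>u\<close> that supplies its pointwise values. By elliptic regularity
  \<open>u\<close> has a representative that is \<open>C\<^sup>1\<^sup>,\<^sup>\<alpha>\<close> on \<open>\<Omega> - {0}\<close> for every \<open>\<alpha> < 1\<close>; continuity alone already
  determines it on \<open>\<Omega> - {0}\<close>, and its value at the origin is irrelevant.\<close>

definition pointwise_representative ::
    "'a::euclidean_space set \<Rightarrow> ('a \<Rightarrow> real) \<Rightarrow> ('a \<Rightarrow> real) \<Rightarrow> bool" where
  "pointwise_representative \<Omega> u v \<longleftrightarrow>
     continuous_on (\<Omega> - {0}) v \<and> (AE x in lebesgue_on \<Omega>. v x = u x)"


section \<open>Assumptions on the data\<close>

definition assumption_H :: "'a::euclidean_space set \<Rightarrow> ('a \<Rightarrow> real) \<Rightarrow> bool" where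
  "assumption_H \<Omega> h \<longleftrightarrow> Linf_loc (\<Omega> - {0}) h \<and>
     (\<exists>C \<epsilon>. C > 0 \<and> 0 < \<epsilon> \<and> \<epsilon> < 2 \<and>
        (AE x in lebesgue_on (\<Omega> - {0}). \<bar>h x\<bar> \<le> C * norm x powr (- 2 + \<epsilon>)))"

definition primitive :: "('a::euclidean_space \<Rightarrow> real \<Rightarrow> real) \<Rightarrow> 'a \<Rightarrow> real \<Rightarrow> real" where
  "primitive f x s = (LBINT t=0..s. f x t)"

definition assumption_F :: "'a::euclidean_space set \<Rightarrow> ('a \<Rightarrow> real \<Rightarrow> real) \<Rightarrow> bool" where
  "assumption_F \<Omega> f \<longleftrightarrow>
     continuous_on (\<Omega> \<times> UNIV) (\<lambda>(x, s). f x s) \<and>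
     Ck_on 1 (\<Omega> \<times> UNIV) (\<lambda>(x, s). primitive f x s) \<and>
     (AE x in lebesgue_on \<Omega>. Ck_on 1 UNIV (f x)) \<and>
     (\<exists>C p. C > 0 \<and> 2 < p \<and> p < 2 * real DIM('a) / (real DIM('a) - 2) \<and>
        (AE x in lebesgue_on \<Omega>. \<forall>s.
           \<bar>f x s * s\<bar> + \<bar>deriv (f x) s * s\<^sup>2\<bar> + \<bar>grad (\<lambda>y. primitive f y s) x \<bullet> x\<bar>
             \<le> C * (\<bar>s\<bar>\<^sup>2 + \<bar>s\<bar> powr p)))"

end

theory Submission
  imports Defs
begin

text \<open>Near the origin a solution satisfies \<open>| |x|\<^sup>2 \<Delta>u + c u | \<le> C |x|\<^sup>\<delta> |u|\<close> with the Hardy constant \<open>c\<close>.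
  In the variable \<open>t = ln |x|\<close> the operator \<open>|x|\<^sup>2 \<Delta> + c\<close> is, up to a weight, \<open>\<partial>\<^sub>t\<^sup>2\<close> plus the spherical
  Laplacian plus a constant. Conjugation with \<open>exp (- \<tau> \<psi>(t))\<close> for the concave function
  \<open>\<psi>(t) = t - exp (\<delta> t) / \<delta>\<close> produces a commutator of symmetric and antisymmetric part that is
  nonnegative, contains no spherical derivatives, and bounds \<open>\<tau>\<^sup>3 |x|\<^sup>\<delta> w\<^sup>2\<close>; hence a Carleman estimate
  that absorbs the right-hand side. Applied to \<open>u\<close> cut off near the origin and at a fixed radius, where
  Caccioppoli's inequality controls the gradient, it gives \<open>u = 0\<close> near the origin: the inner error
  vanishes by the infinite order of vanishing, the outer one after \<open>\<tau> \<rightarrow> \<infinity>\<close>. Away from the origin the same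
  argument with \<open>c = 0\<close> applies around points where \<open>u\<close> vanishes locally, and connectedness finishes the proof.
  Only the very weak form of the equation for the continuous representative is used, after mollification.\<close>

section \<open>Smooth bump functions\<close>

text \<open>The pure power weight, \<psi>(t) = t, would give commutator zero, because in t the
  operator has constant coefficients. The gain comes from the concave correction alone, and its
  exponent is dictated by the right-hand side: - \<psi>'' = \<delta> |x|^\<delta>, so a perturbation
  of size C |x|^\<delta> |w|, once squared, is absorbed as soon as \<tau>^3 \<delta> exceeds a
  multiple of C^2. Spherical derivatives drop out because weight and cut-offs are radial. The
  constant c commutes with everything; its critical size is therefore no obstacle, and no Hardy
  inequality enters. Three limits are taken in a fixed order: mollification error to 0, inner radius
  to 0, then \<tau> to infinity. All constants have to be uniform in the earlier parameters. This is
  why cut-off layers have unit length in t (a fixed ratio of radii) and why the gradient bound is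
  scale invariant. The radius of the ball on which vanishing is obtained does not depend on C, only
  on \<delta> and on where the differential inequality holds. The connectedness argument uses this,
  since C varies there from point to point.\<close>

definition bfun :: "nat \<Rightarrow> real \<Rightarrow> real" where
  "bfun k t = (if t \<le> 0 then 0 else exp (- 1 / t) / t ^ k)"

lemma bfun_nonneg: "0 \<le> bfun k t"
  by (simp add: bfun_def)

lemma bfun_tendsto_0: "(bfun k \<longlongrightarrow> 0) (at 0)"
proof -
  have "((\<lambda>t. (1/t) ^ k / exp (1/t)) \<longlongrightarrow> 0) (at_right (0::real))"
    using filterlim_compose[OF tendsto_power_div_exp_0[of k] filterlim_inverse_at_top_right]
    by (simp add: inverse_eq_divide)
  then have "(bfun k \<longlongrightarrow> 0) (at_right 0)"
    by (rule tendsto_cong[THEN iffD1, rotated])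
      (auto simp: eventually_at_filter bfun_def exp_minus field_simps power_divide)
  moreover have "(bfun k \<longlongrightarrow> 0) (at_left 0)"
    by (rule tendsto_eventually) (auto simp: eventually_at_filter bfun_def)
  ultimately show ?thesis by (simp add: filterlim_split_at)
qed

text \<open>The powers in \<open>bfun\<close> exist for this formula: the family is closed under
  differentiation up to linear combinations, so smoothness of the bumps becomes an induction on the
  order with \<open>k\<close> arbitrary.\<close>

lemma bfun_has_real_derivative:
  "(bfun k has_real_derivative (bfun (k+2) t - real k * bfun (k+1) t)) (at t)"
proof -
  consider "t < 0" | "t = 0" | "t > 0" by linarith
  then show ?thesis
  proof cases
    case 1
    have "(bfun k has_real_derivative 0) (at t)"
      by (rule has_field_derivative_transform_within_open[of "\<lambda>t. 0" _ _ "{..<0}"])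
        (use 1 in \<open>auto simp: bfun_def\<close>)
    then show ?thesis using 1 by (simp add: bfun_def)
  next
    case 2
    \<comment> \<open>At 0 the difference quotient \<open>bfun k h / h\<close> is
      \<open>bfun (k+1) h\<close>, so differentiability there is the limit at 0 for the next
      index.\<close>
    have "((\<lambda>h. bfun (k+1) h) \<longlongrightarrow> 0) (at 0)" by (rule bfun_tendsto_0)
    then have "((\<lambda>h. bfun k h / h) \<longlongrightarrow> 0) (at 0)"
      by (rule tendsto_cong[THEN iffD1, rotated]) (auto simp: eventually_at_filter bfun_def)
    then show ?thesis using 2 by (simp add: DERIV_def bfun_def)
  next
    case 3
    have "((\<lambda>t. exp (- 1 / t) / t ^ k) has_real_derivative
       (bfun (k+2) t - real k * bfun (k+1) t)) (at t)"
    proof (cases k)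
      case 0
      then show ?thesis using 3
        by (auto intro!: derivative_eq_intros simp: bfun_def field_simps power2_eq_square)
    next
      case (Suc m)
      have "((\<lambda>t. exp (- 1 / t) / t ^ Suc m) has_real_derivative
        (exp (- 1 / t) * (1 / t\<^sup>2) * t ^ Suc m - exp (- 1 / t) * (real (Suc m) * t ^ m)) / (t ^ Suc m * t ^ Suc m)) (at t)"
        using 3 by (auto intro!: derivative_eq_intros DERIV_pow[of "Suc m", simplified] simp: power2_eq_square simp del: power_Suc)
      also have "(exp (- 1 / t) * (1 / t\<^sup>2) * t ^ Suc m - exp (- 1 / t) * (real (Suc m) * t ^ m)) / (t ^ Suc m * t ^ Suc m)
        = bfun (k + 2) t - real k * bfun (k + 1) t"
        using 3 by (simp add: bfun_def Suc field_simps power2_eq_square)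
      finally show ?thesis by (simp only: Suc)
    qed
    then show ?thesis
      by (rule has_field_derivative_transform_within_open[of _ _ _ "{0<..}"])
        (use 3 in \<open>auto simp: bfun_def\<close>)
  qed
qed

section \<open>Sums, products and radial bumps in the classes \<open>Ck_on\<close>\<close>

lemma Ck_on_Suc_imp: "Ck_on (Suc k) S f \<Longrightarrow> Ck_on k S f"
proof (induction k arbitrary: f)
  case 0
  then show ?case
    by (metis Ck_on.simps continuous_at_imp_continuous_on differentiable_imp_continuous_within)
next
  case (Suc k)
  have "f differentiable at x" if "x \<in> S" for x using Suc.prems that by simp
  moreover have "Ck_on k S (\<lambda>x. frechet_derivative f (at x) b)" if "b \<in> Basis" for b
    using Suc.prems that by (intro Suc.IH) (simp only: Ck_on.simps(2)[of "Suc k"])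
  ultimately show ?case by simp
qed

lemma Ck_on_const: "Ck_on k S (\<lambda>x. c)"
  by (induction k arbitrary: c) (simp_all add: frechet_derivative_const)

lemma Ck_on_UNIV_derivI:
  assumes "\<And>x. (f has_derivative f' x) (at x)" "\<And>b. b \<in> Basis \<Longrightarrow> Ck_on k UNIV (\<lambda>x. f' x b)"
  shows "Ck_on (Suc k) UNIV f"
  using assms frechet_derivative_at[OF assms(1)] by (auto simp: differentiable_def)

lemma Ck_on_UNIV_has_derivative:
  "Ck_on (Suc k) UNIV f \<Longrightarrow> (f has_derivative frechet_derivative f (at x)) (at x)"
  by (simp add: frechet_derivative_works)

lemma Ck_on_add:
  "Ck_on k UNIV f \<Longrightarrow> Ck_on k UNIV g \<Longrightarrow> Ck_on k UNIV (\<lambda>x. f x + g x)"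
proof (induction k arbitrary: f g)
  case (Suc k)
  have "Ck_on k UNIV (\<lambda>x. frechet_derivative f (at x) b)"
    "Ck_on k UNIV (\<lambda>x. frechet_derivative g (at x) b)" if "b \<in> Basis" for b
    using Suc.prems that by auto
  then show ?case
    by (intro Ck_on_UNIV_derivI[OF has_derivative_add[OF Ck_on_UNIV_has_derivative[OF Suc.prems(1)]
            Ck_on_UNIV_has_derivative[OF Suc.prems(2)]]] Suc.IH) auto
qed (auto intro: continuous_on_add)

lemma Ck_on_mult:
  "Ck_on k UNIV f \<Longrightarrow> Ck_on k UNIV g \<Longrightarrow> Ck_on k UNIV (\<lambda>x. f x * g x)"
proof (induction k arbitrary: f g)
  case (Suc k)
  have "Ck_on k UNIV f" "Ck_on k UNIV g" using Suc.prems by (auto intro: Ck_on_Suc_imp simp del: Ck_on.simps)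
  moreover have "Ck_on k UNIV (\<lambda>x. frechet_derivative f (at x) b)"
    "Ck_on k UNIV (\<lambda>x. frechet_derivative g (at x) b)" if "b \<in> Basis" for b
    using Suc.prems that by auto
  ultimately show ?case
    by (intro Ck_on_UNIV_derivI[OF has_derivative_mult[OF Ck_on_UNIV_has_derivative[OF Suc.prems(1)]
            Ck_on_UNIV_has_derivative[OF Suc.prems(2)]]] Ck_on_add Suc.IH) auto
qed (auto intro: continuous_on_mult)

lemma Ck_on_inner_affine:
  "Ck_on k UNIV (\<lambda>y::'a::euclidean_space. (y - z) \<bullet> b)"
proof (cases k)
  case (Suc m)
  have "((\<lambda>y. (y - z) \<bullet> b) has_derivative (\<lambda>h. h \<bullet> b)) (at y)" for y
    by (auto intro!: derivative_eq_intros)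
  then show ?thesis unfolding Suc
    by (rule Ck_on_UNIV_derivI) (simp add: Ck_on_const)
qed (auto intro!: continuous_intros)

lemma bump_has_derivative:
  "((\<lambda>y::'a::euclidean_space. bfun k (c - (y - z) \<bullet> (y - z))) has_derivative
    (\<lambda>h. (bfun (k+2) (c - (y - z) \<bullet> (y - z)) - real k * bfun (k+1) (c - (y - z) \<bullet> (y - z)))
         * (- 2 * ((y - z) \<bullet> h)))) (at y)"
proof -
  have "((\<lambda>y. c - (y - z) \<bullet> (y - z)) has_derivative (\<lambda>h. - 2 * ((y - z) \<bullet> h))) (at y)"
    by (auto intro!: derivative_eq_intros simp: inner_commute)
  from has_derivative_compose[OF this bfun_has_real_derivative[of k, unfolded has_field_derivative_def]]
  show ?thesis by simp
qed

lemma Ck_on_bump: "Ck_on m UNIV (\<lambda>y::'a::euclidean_space. bfun k (c - (y - z) \<bullet> (y - z)))"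
proof (induction m arbitrary: k)
  case 0
  then show ?case
    by (auto intro!: continuous_at_imp_continuous_on has_derivative_continuous[OF bump_has_derivative])
next
  case (Suc m)
  show ?case
  proof (rule Ck_on_UNIV_derivI[OF bump_has_derivative])
    fix b :: 'a
    have "Ck_on m UNIV (\<lambda>y. (bfun (k + 2) (c - (y - z) \<bullet> (y - z))
        + (- real k) * bfun (k + 1) (c - (y - z) \<bullet> (y - z))) * (- 2 * ((y - z) \<bullet> b)))"
      by (intro Ck_on_mult Ck_on_add Suc.IH Ck_on_const Ck_on_inner_affine)
    then show "Ck_on m UNIV (\<lambda>y. (bfun (k + 2) (c - (y - z) \<bullet> (y - z))
        - real k * bfun (k + 1) (c - (y - z) \<bullet> (y - z))) * (- 2 * ((y - z) \<bullet> b)))"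
      by simp
  qed
qed

lemma bump_eq_0: "0 \<le> e \<Longrightarrow> e \<le> norm x \<Longrightarrow> bfun k (e\<^sup>2 - x \<bullet> x) = 0"
  using power_mono[of e "norm x" 2] by (simp add: bfun_def dot_square_norm)

lemma test_function_bump:
  fixes z :: "'a::euclidean_space"
  assumes "cball z e \<subseteq> U" "0 \<le> e"
  shows "(\<lambda>y. bfun k (e\<^sup>2 - (y - z) \<bullet> (y - z))) \<in> test_functions U"
proof -
  have sub: "{y. bfun k (e\<^sup>2 - (y - z) \<bullet> (y - z)) \<noteq> 0} \<subseteq> cball z e"
  proof
    fix y assume "y \<in> {y. bfun k (e\<^sup>2 - (y - z) \<bullet> (y - z)) \<noteq> 0}"
    then have "\<not> e \<le> norm (y - z)" using bump_eq_0[OF assms(2), of "y - z" k] by auto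
    then show "y \<in> cball z e" by (simp add: dist_norm norm_minus_commute)
  qed
  then have "closure {y. bfun k (e\<^sup>2 - (y - z) \<bullet> (y - z)) \<noteq> 0} \<subseteq> cball z e"
    by (rule closure_minimal) auto
  moreover have "bounded {y. bfun k (e\<^sup>2 - (y - z) \<bullet> (y - z)) \<noteq> 0}"
    using sub bounded_cball bounded_subset by blast
  ultimately show ?thesis
    using assms by (auto simp: test_functions_def smooth_on_def Ck_on_bump)
qed

section \<open>The divergence theorem\<close>

lemma lborel_integral_translate:
  fixes f :: "'a::euclidean_space \<Rightarrow> real"
  assumes "f \<in> borel_measurable borel"
  shows "(LINT x|lborel. f (c + x)) = (LINT x|lborel. f x)"
  using integral_distr[of "(+) c" lborel borel f] assms by (simp add: lborel_distr_plus)

lemma lborel_integrable_translate: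
  fixes f :: "'a::euclidean_space \<Rightarrow> real"
  assumes "integrable lborel f"
  shows "integrable lborel (\<lambda>x. f (c + x))"
  using integrable_distr_eq[of "(+) c" lborel borel f] assms by (simp add: lborel_distr_plus)

text \<open>Difference quotients of \<open>f\<close> in direction \<open>b\<close> have integral
  zero by translation invariance, and they converge dominatedly to the directional derivative. No
  iterated integrals are involved. The factor \<open>indicator K\<close> is there because
  \<open>f'\<close> is unconstrained outside \<open>U\<close>.\<close>

lemma integral_partial_derivative_eq_0:
  fixes f :: "'a::euclidean_space \<Rightarrow> real"
  assumes "open U" "compact K" "K \<subseteq> U"
    and der: "\<And>x. x \<in> U \<Longrightarrow> (f has_derivative f' x) (at x)"
    and cont: "continuous_on U (\<lambda>x. f' x b)"
    and zero: "\<And>x. x \<notin> K \<Longrightarrow> f x = 0"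
  shows "(LINT x|lborel. indicator K x * f' x b) = 0"
proof -
  define D where "D x = indicator K x * f' x b" for x
  have dir: "\<exists>F. (f has_derivative F) (at x) \<and> F b = D x" for x
  proof (cases "x \<in> K")
    case True
    then show ?thesis using der assms(3) by (auto simp: D_def)
  next
    case False
    have "(f has_derivative (\<lambda>h. 0)) (at x)"
      by (rule has_derivative_transform_within_open[of "\<lambda>x. 0" _ _ _ "- K"])
        (use False zero assms(2) in \<open>auto simp: compact_imp_closed open_Compl\<close>)
    then show ?thesis using False by (auto simp: D_def)
  qed
  have line: "((\<lambda>t. f (x + t *\<^sub>R b)) has_real_derivative D (x + t *\<^sub>R b)) (at t)" for x t
  proof -
    obtain F where F: "(f has_derivative F) (at (x + t *\<^sub>R b))" "F b = D (x + t *\<^sub>R b)"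
      using dir by blast
    have "((\<lambda>t. x + t *\<^sub>R b) has_derivative (\<lambda>h. h *\<^sub>R b)) (at t)"
      by (auto intro!: derivative_eq_intros)
    from has_derivative_compose[OF this F(1)]
    have "((\<lambda>t. f (x + t *\<^sub>R b)) has_derivative (\<lambda>h. F (h *\<^sub>R b))) (at t)" .
    moreover have "(\<lambda>h. F (h *\<^sub>R b)) = (*) (D (x + t *\<^sub>R b))"
      using F linear_cmul[OF has_derivative_linear[OF F(1)]] by (auto simp: mult.commute)
    ultimately show ?thesis by (simp add: has_field_derivative_def)
  qed
  have "continuous_on K (\<lambda>x. f' x b)" using cont assms(3) continuous_on_subset by blast
  then have "bounded ((\<lambda>x. f' x b) ` K)" using compact_imp_bounded compact_continuous_image assms(2) by blast
  then obtain B where "\<forall>y\<in>(\<lambda>x. f' x b) ` K. norm y \<le> B" unfolding bounded_iff by blast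
  then have B0: "\<bar>f' x b\<bar> \<le> B" if "x \<in> K" for x using that by simp
  define C where "C = max B 0"
  have C: "\<bar>D x\<bar> \<le> C" for x using B0[of x] by (auto simp: D_def C_def split: split_indicator)
  have lip: "\<bar>f (x + t *\<^sub>R b) - f x\<bar> \<le> C * t" if "t \<ge> 0" for x t
  proof -
    have "norm (f (x + t *\<^sub>R b) - f (x + 0 *\<^sub>R b)) \<le> C * norm (t - 0)"
      by (rule field_differentiable_bound[of UNIV "\<lambda>t. f (x + t *\<^sub>R b)" "\<lambda>t. D (x + t *\<^sub>R b)"])
        (use line C in auto)
    then show ?thesis using that by simp
  qed
  have "isCont f x" for x using dir[of x] has_derivative_continuous by blast
  then have contf: "continuous_on UNIV f" by (simp add: continuous_at_imp_continuous_on)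
  then have fm: "f \<in> borel_measurable borel" by (rule borel_measurable_continuous_onI)
  have "integrable lborel (\<lambda>x. indicator K x *\<^sub>R f x)"
    by (rule borel_integrable_compact) (use assms(2) continuous_on_subset[OF contf] in auto)
  moreover have "(\<lambda>x. indicator K x *\<^sub>R f x) = f"
    using zero by (auto simp: fun_eq_iff split: split_indicator)
  ultimately have fi: "integrable lborel f" by simp
  obtain R where "\<forall>x\<in>K. norm x \<le> R" using compact_imp_bounded[OF assms(2)] unfolding bounded_iff by blast
  then have R: "K \<subseteq> cball 0 R" by auto
  define q where "q k x = real (Suc k) * (f ((1 / real (Suc k)) *\<^sub>R b + x) - f x)" for k x
  have q0: "(LINT x|lborel. q k x) = 0" for k
    unfolding q_def
    by (simp add: Bochner_Integration.integral_diff lborel_integrable_translate fi lborel_integral_translate fm)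
  \<comment> \<open>The dominating function is the Lipschitz constant \<open>C\<close> on a ball.
    Its radius is \<open>R + norm b\<close> because \<open>K\<close> has radius \<open>R\<close> and
    every shift has length at most \<open>norm b\<close>.\<close>
  have "(\<lambda>k. LINT x|lborel. q k x) \<longlonglongrightarrow> (LINT x|lborel. D x)"
  proof (rule integral_dominated_convergence[where w = "\<lambda>x. indicator (cball 0 (R + norm b)) x *\<^sub>R C"])
    have "integrable lborel (\<lambda>x. indicator K x *\<^sub>R f' x b)"
      by (rule borel_integrable_compact) (use assms in \<open>auto intro: continuous_on_subset\<close>)
    then show "D \<in> borel_measurable lborel" unfolding D_def by simp
    show "integrable lborel (\<lambda>x. indicator (cball (0::'a) (R + norm b)) x *\<^sub>R C)"
      by (rule borel_integrable_compact) auto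
    show "q k \<in> borel_measurable lborel" for k
      unfolding q_def using fm by measurable
    show "AE x in lborel. norm (q k x) \<le> indicator (cball 0 (R + norm b)) x *\<^sub>R C" for k
    proof (rule AE_I2)
      fix x
      let ?t = "1 / real (Suc k)"
      show "norm (q k x) \<le> indicator (cball 0 (R + norm b)) x *\<^sub>R C"
      proof (cases "x \<in> cball 0 (R + norm b)")
        case True
        have "\<bar>q k x\<bar> = real (Suc k) * \<bar>f (x + ?t *\<^sub>R b) - f x\<bar>"
          by (simp add: q_def abs_mult add.commute)
        also have "\<dots> \<le> real (Suc k) * (C * ?t)" by (intro mult_left_mono lip) auto
        also have "\<dots> = C" by simp
        finally show ?thesis using True by simp
      next
        case False
        then have n: "norm x > R + norm b" by simp
        then have "\<not> norm x \<le> R" using norm_ge_zero[of b] by linarith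
        then have "f x = 0" using R by (intro zero) (auto simp: subset_iff)
        moreover have "f (?t *\<^sub>R b + x) = 0"
        proof (rule zero)
          have "norm (?t *\<^sub>R b) \<le> norm b" by (simp add: divide_le_eq algebra_simps)
          moreover have "norm x \<le> norm (?t *\<^sub>R b + x) + norm (?t *\<^sub>R b)"
            using norm_triangle_ineq4[of "?t *\<^sub>R b + x" "?t *\<^sub>R b"] by simp
          ultimately have "\<not> norm (?t *\<^sub>R b + x) \<le> R" using n by linarith
          then show "?t *\<^sub>R b + x \<notin> K" using R by (auto simp: subset_iff)
        qed
        ultimately show ?thesis using False by (simp add: q_def)
      qed
    qed
    show "AE x in lborel. (\<lambda>k. q k x) \<longlonglongrightarrow> D x"
    proof (rule AE_I2)
      fix x
      have "((\<lambda>h. (f (x + h *\<^sub>R b) - f x) / h) \<longlongrightarrow> D x) (at 0)"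
        using line[of x 0] by (simp add: DERIV_def)
      moreover have "filterlim (\<lambda>k. 1 / real (Suc k)) (at 0) sequentially"
        unfolding filterlim_at using LIMSEQ_inverse_real_of_nat by (auto simp: inverse_eq_divide)
      ultimately have "(\<lambda>k. (f (x + (1 / real (Suc k)) *\<^sub>R b) - f x) / (1 / real (Suc k))) \<longlonglongrightarrow> D x"
        by (rule filterlim_compose)
      then show "(\<lambda>k. q k x) \<longlonglongrightarrow> D x" by (simp add: q_def mult.commute add.commute)
    qed
  qed
  then have "(\<lambda>k. 0) \<longlonglongrightarrow> (LINT x|lborel. D x)" by (simp only: q0)
  then show ?thesis using LIMSEQ_unique[OF tendsto_const] unfolding D_def by metis
qed

lemma integral_divergence_eq_0:
  fixes X :: "'a::euclidean_space \<Rightarrow> 'a"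
  assumes "open U" "compact K" "K \<subseteq> U"
    and der: "\<And>x. x \<in> U \<Longrightarrow> (X has_derivative X' x) (at x)"
    and cont: "\<And>b. b \<in> Basis \<Longrightarrow> continuous_on U (\<lambda>x. X' x b)"
    and zero: "\<And>x. x \<notin> K \<Longrightarrow> X x = 0"
  shows "(LINT x|lborel. indicator K x * (\<Sum>b\<in>Basis. X' x b \<bullet> b)) = 0"
proof -
  have "(LINT x|lborel. indicator K x * (\<Sum>b\<in>Basis. X' x b \<bullet> b))
      = (\<Sum>b\<in>Basis. LINT x|lborel. indicator K x * (X' x b \<bullet> b))"
    unfolding sum_distrib_left
  proof (rule Bochner_Integration.integral_sum)
    fix b :: 'a assume "b \<in> Basis"
    then have "integrable lborel (\<lambda>x. indicator K x *\<^sub>R (X' x b \<bullet> b))"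
      by (intro borel_integrable_compact assms continuous_intros) (use assms cont in \<open>blast intro: continuous_on_subset\<close>)
    then show "integrable lborel (\<lambda>x. indicator K x * (X' x b \<bullet> b))" by simp
  qed
  also have "\<dots> = 0"
  proof (rule sum.neutral, rule ballI)
    fix b :: 'a assume b: "b \<in> Basis"
    show "(LINT x|lborel. indicator K x * (X' x b \<bullet> b)) = 0"
      by (rule integral_partial_derivative_eq_0[OF assms(1-3), of "\<lambda>x. X x \<bullet> b" "\<lambda>x h. X' x h \<bullet> b"])
        (use der cont[OF b] zero in \<open>auto intro!: continuous_intros derivative_eq_intros\<close>)
  qed
  finally show ?thesis .
qed

section \<open>A Rellich--Pohozaev identity\<close>

text \<open>Gradient \<open>G\<close> and Hessian \<open>H\<close> are carried along as data because
  the proof works with explicit formulas for products and convolutions. Symmetry of the Hessian is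
  part of the notion instead of a consequence of Schwarz's theorem: the Pohozaev identity relies on
  it, and convolutions inherit it from their kernel.\<close>

definition C2_on :: "'a::euclidean_space set \<Rightarrow> ('a \<Rightarrow> real) \<Rightarrow> ('a \<Rightarrow> 'a) \<Rightarrow> ('a \<Rightarrow> 'a \<Rightarrow> 'a) \<Rightarrow> bool" where
  "C2_on S w G H \<longleftrightarrow>
     (\<forall>x\<in>S. (w has_derivative (\<lambda>h. G x \<bullet> h)) (at x) \<and> (G has_derivative H x) (at x) \<and>
        (\<forall>u v. H x u \<bullet> v = u \<bullet> H x v)) \<and>
     (\<forall>h. continuous_on S (\<lambda>x. H x h))"

text \<open>Applied to a Hessian this is the Laplacian.\<close>

definition tr :: "('a::euclidean_space \<Rightarrow> 'a) \<Rightarrow> real" where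
  "tr L = (\<Sum>b\<in>Basis. L b \<bullet> b)"

lemma C2_onD:
  assumes "C2_on S w G H"
  shows "x \<in> S \<Longrightarrow> (w has_derivative (\<lambda>h. G x \<bullet> h)) (at x)"
    and "x \<in> S \<Longrightarrow> (G has_derivative H x) (at x)"
    and "x \<in> S \<Longrightarrow> H x u \<bullet> v = u \<bullet> H x v"
    and "continuous_on S (\<lambda>x. H x h)"
  using assms unfolding C2_on_def by blast+

lemma C2_on_continuous:
  assumes "C2_on S w G H"
  shows "continuous_on S w" "continuous_on S G" "continuous_on S (\<lambda>x. tr (H x))"
  unfolding tr_def
  by (intro continuous_at_imp_continuous_on ballI has_derivative_continuous[OF C2_onD(1)[OF assms]]
        has_derivative_continuous[OF C2_onD(2)[OF assms]] continuous_intros C2_onD(4)[OF assms]; assumption)+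

lemma C2_on_cong:
  assumes "C2_on S w G H" "\<And>x. x \<in> S \<Longrightarrow> w' x = w x" "\<And>x. x \<in> S \<Longrightarrow> G' x = G x"
    "\<And>x h. x \<in> S \<Longrightarrow> H' x h = H x h" "open S"
  shows "C2_on S w' G' H'"
proof -
  have "H' x = H x" if "x \<in> S" for x using assms(4)[OF that] by auto
  moreover have "continuous_on S (\<lambda>x. H' x h)" for h
    using C2_onD(4)[OF assms(1), of h] assms(4) by (simp cong: continuous_on_cong)
  moreover have "(w' has_derivative (\<lambda>h. G' x \<bullet> h)) (at x)" if "x \<in> S" for x
    using has_derivative_transform_within_open[OF C2_onD(1)[OF assms(1) that] assms(5) that, of w'] assms(2,3) that
    by simp
  moreover have "(G' has_derivative H x) (at x)" if "x \<in> S" for x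
    using has_derivative_transform_within_open[OF C2_onD(2)[OF assms(1) that] assms(5) that, of G'] assms(3) that
    by simp
  ultimately show ?thesis using C2_onD(3)[OF assms(1)] unfolding C2_on_def by simp
qed

lemma radial_has_derivative:
  fixes x :: "'a::euclidean_space"
  assumes "\<And>t. (k has_real_derivative k' t) (at t)" "x \<noteq> 0"
  shows "((\<lambda>x. k (ln (norm x))) has_derivative (\<lambda>h. k' (ln (norm x)) * (x \<bullet> h) / (norm x)\<^sup>2)) (at x)"
proof -
  have "((\<lambda>x. ln (norm x)) has_derivative (\<lambda>h. (x \<bullet> h) / (norm x)\<^sup>2)) (at x)"
    using assms(2)
    by (auto intro!: derivative_eq_intros has_derivative_norm simp: sgn_div_norm power2_eq_square divide_simps inner_commute)
  from has_derivative_compose[OF this assms(1)[unfolded has_field_derivative_def]]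
  show ?thesis by simp
qed

lemma radial_continuous_on:
  fixes S :: "'a::euclidean_space set"
  assumes "continuous_on UNIV k" "0 \<notin> S"
  shows "continuous_on S (\<lambda>x. k (ln (norm x)))"
  by (rule continuous_on_compose2[OF assms(1)]) (use assms(2) in \<open>auto intro!: continuous_intros\<close>)

lemma C2_on_radial_mult:
  fixes w :: "'a::euclidean_space \<Rightarrow> real"
  assumes "C2_on S w G H" "0 \<notin> S"
    and k: "\<And>t. (k has_real_derivative k1 t) (at t)" "\<And>t. (k1 has_real_derivative k2 t) (at t)"
    and k2: "continuous_on UNIV k2"
  defines "t \<equiv> \<lambda>x::'a. ln (norm x)"
  shows "C2_on S (\<lambda>x. k (t x) * w x)
     (\<lambda>x. k (t x) *\<^sub>R G x + (k1 (t x) / (norm x)\<^sup>2 * w x) *\<^sub>R x)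
     (\<lambda>x h. k (t x) *\<^sub>R H x h + (k1 (t x) / (norm x)\<^sup>2 * (x \<bullet> h)) *\<^sub>R G x
        + (k1 (t x) / (norm x)\<^sup>2 * (G x \<bullet> h)) *\<^sub>R x + (k1 (t x) / (norm x)\<^sup>2 * w x) *\<^sub>R h
        + ((k2 (t x) - 2 * k1 (t x)) / (norm x)^4 * (x \<bullet> h) * w x) *\<^sub>R x)"
  unfolding C2_on_def
proof (intro conjI ballI allI)
  fix x u v assume x: "x \<in> S"
  then have x0: "x \<noteq> 0" using assms(2) by auto
  note w = C2_onD[OF assms(1)]
  have K: "((\<lambda>x. k (t x)) has_derivative (\<lambda>h. k1 (t x) * (x \<bullet> h) / (norm x)\<^sup>2)) (at x)"
    "((\<lambda>x. k1 (t x)) has_derivative (\<lambda>h. k2 (t x) * (x \<bullet> h) / (norm x)\<^sup>2)) (at x)"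
    unfolding t_def by (rule radial_has_derivative k x0)+
  show "((\<lambda>x. k (t x) * w x) has_derivative
      (\<lambda>h. (k (t x) *\<^sub>R G x + (k1 (t x) / (norm x)\<^sup>2 * w x) *\<^sub>R x) \<bullet> h)) (at x)"
    by (rule has_derivative_eq_rhs, (rule K w x derivative_intros)+)
      (simp add: inner_add_left algebra_simps)
  have n2: "((\<lambda>x. (norm x)\<^sup>2) has_derivative (\<lambda>h. 2 * (x \<bullet> h))) (at x)"
    unfolding power2_norm_eq_inner by (auto intro!: derivative_eq_intros simp: inner_commute)
  have KK: "((\<lambda>x. k1 (t x) / (norm x)\<^sup>2) has_derivative
      (\<lambda>h. (k2 (t x) - 2 * k1 (t x)) / (norm x)^4 * (x \<bullet> h))) (at x)"
    using x0
    by (intro has_derivative_eq_rhs[OF has_derivative_divide[OF K(2) n2]])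
      (auto simp: fun_eq_iff field_simps power2_eq_square power4_eq_xxxx)
  show "((\<lambda>x. k (t x) *\<^sub>R G x + (k1 (t x) / (norm x)\<^sup>2 * w x) *\<^sub>R x) has_derivative
     (\<lambda>h. k (t x) *\<^sub>R H x h + (k1 (t x) / (norm x)\<^sup>2 * (x \<bullet> h)) *\<^sub>R G x
        + (k1 (t x) / (norm x)\<^sup>2 * (G x \<bullet> h)) *\<^sub>R x + (k1 (t x) / (norm x)\<^sup>2 * w x) *\<^sub>R h
        + ((k2 (t x) - 2 * k1 (t x)) / (norm x)^4 * (x \<bullet> h) * w x) *\<^sub>R x)) (at x)"
    by (rule has_derivative_eq_rhs, (rule K KK w x derivative_intros)+)
      (simp add: fun_eq_iff algebra_simps)
  show "(k (t x) *\<^sub>R H x u + (k1 (t x) / (norm x)\<^sup>2 * (x \<bullet> u)) *\<^sub>R G x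
        + (k1 (t x) / (norm x)\<^sup>2 * (G x \<bullet> u)) *\<^sub>R x + (k1 (t x) / (norm x)\<^sup>2 * w x) *\<^sub>R u
        + ((k2 (t x) - 2 * k1 (t x)) / (norm x)^4 * (x \<bullet> u) * w x) *\<^sub>R x) \<bullet> v =
     u \<bullet> (k (t x) *\<^sub>R H x v + (k1 (t x) / (norm x)\<^sup>2 * (x \<bullet> v)) *\<^sub>R G x
        + (k1 (t x) / (norm x)\<^sup>2 * (G x \<bullet> v)) *\<^sub>R x + (k1 (t x) / (norm x)\<^sup>2 * w x) *\<^sub>R v
        + ((k2 (t x) - 2 * k1 (t x)) / (norm x)^4 * (x \<bullet> v) * w x) *\<^sub>R x)"
    by (simp add: inner_add_left inner_add_right w(3)[OF x] inner_commute[of _ u] mult_ac)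
next
  fix h
  have c: "continuous_on UNIV k" "continuous_on UNIV k1"
    using k by (auto intro!: continuous_at_imp_continuous_on DERIV_isCont)
  have "continuous_on S (\<lambda>x. k (t x))" "continuous_on S (\<lambda>x. k1 (t x))" "continuous_on S (\<lambda>x. k2 (t x))"
    unfolding t_def using c k2 assms(2) by (auto intro: radial_continuous_on)
  then show "continuous_on S (\<lambda>x. k (t x) *\<^sub>R H x h + (k1 (t x) / (norm x)\<^sup>2 * (x \<bullet> h)) *\<^sub>R G x
        + (k1 (t x) / (norm x)\<^sup>2 * (G x \<bullet> h)) *\<^sub>R x + (k1 (t x) / (norm x)\<^sup>2 * w x) *\<^sub>R h
        + ((k2 (t x) - 2 * k1 (t x)) / (norm x)^4 * (x \<bullet> h) * w x) *\<^sub>R x)"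
    using assms(2) C2_on_continuous[OF assms(1)] C2_onD(4)[OF assms(1), of h]
    by (auto intro!: continuous_intros)
qed

text \<open>In t = ln |x| the operator x \<bullet> \<nabla> is \<partial>_t, and |x|^2 \<Delta> is
  \<partial>_t^2 + (n - 2) \<partial>_t plus the spherical Laplacian. This is the product rule of
  that operator for a factor k(t), with \<open>k0\<close>, \<open>k1\<close>, \<open>k2\<close> the
  values of k, k', k''. The spherical part does not see k.\<close>

lemma tr_radial_mult:
  fixes x :: "'a::euclidean_space"
  assumes "x \<noteq> 0"
  shows "(norm x)\<^sup>2 * tr (\<lambda>h. k0 *\<^sub>R L h + (k1 / (norm x)\<^sup>2 * (x \<bullet> h)) *\<^sub>R g
        + (k1 / (norm x)\<^sup>2 * (g \<bullet> h)) *\<^sub>R x + (k1 / (norm x)\<^sup>2 * W) *\<^sub>R h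
        + ((k2 - 2 * k1) / (norm x)^4 * (x \<bullet> h) * W) *\<^sub>R x)
     = k0 * ((norm x)\<^sup>2 * tr L) + 2 * k1 * (x \<bullet> g) + (k2 + (real DIM('a) - 2) * k1) * W"
proof -
  have e: "(\<Sum>b\<in>Basis. (u \<bullet> b) * (v \<bullet> b)) = u \<bullet> v" for u v :: 'a
    by (rule euclidean_inner[symmetric])
  have "tr (\<lambda>h. k0 *\<^sub>R L h + (k1 / (norm x)\<^sup>2 * (x \<bullet> h)) *\<^sub>R g
        + (k1 / (norm x)\<^sup>2 * (g \<bullet> h)) *\<^sub>R x + (k1 / (norm x)\<^sup>2 * W) *\<^sub>R h
        + ((k2 - 2 * k1) / (norm x)^4 * (x \<bullet> h) * W) *\<^sub>R x)
     = k0 * tr L + k1 / (norm x)\<^sup>2 * (\<Sum>b\<in>Basis. (x \<bullet> b) * (g \<bullet> b))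
       + k1 / (norm x)\<^sup>2 * (\<Sum>b\<in>Basis. (g \<bullet> b) * (x \<bullet> b)) + k1 / (norm x)\<^sup>2 * W * real DIM('a)
       + (k2 - 2 * k1) / (norm x)^4 * W * (\<Sum>b\<in>Basis. (x \<bullet> b) * (x \<bullet> b))"
    unfolding tr_def
    by (simp add: inner_add_left sum.distrib sum_distrib_left sum_divide_distrib mult_ac)
  also have "\<dots> = k0 * tr L + 2 * k1 / (norm x)\<^sup>2 * (x \<bullet> g) + k1 / (norm x)\<^sup>2 * W * real DIM('a)
       + (k2 - 2 * k1) / (norm x)^4 * W * (norm x)\<^sup>2"
    unfolding e by (simp add: inner_commute[of g] power2_norm_eq_inner)
  finally have T: "tr (\<lambda>h. k0 *\<^sub>R L h + (k1 / (norm x)\<^sup>2 * (x \<bullet> h)) *\<^sub>R g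
        + (k1 / (norm x)\<^sup>2 * (g \<bullet> h)) *\<^sub>R x + (k1 / (norm x)\<^sup>2 * W) *\<^sub>R h
        + ((k2 - 2 * k1) / (norm x)^4 * (x \<bullet> h) * W) *\<^sub>R x) = \<dots>" .
  show ?thesis unfolding T using assms by (simp add: field_simps power2_eq_square power4_eq_xxxx)
qed

text \<open>The divergence theorem for
  \<open>(2 B\<^sub>0 (x \<bullet> \<nabla>w) + A\<^sub>1 w) \<nabla>w + (B\<^sub>1 w\<^sup>2 - B\<^sub>0 |\<nabla>w|\<^sup>2) x\<close>. The choice of \<open>A\<^sub>1\<close> removes the terms
  in \<open>|\<nabla>w|\<^sup>2\<close>.\<close>

lemma pohozaev_identity:
  fixes w :: "'a::euclidean_space \<Rightarrow> real" and B0 B0' B0'' B1 B1' :: "real \<Rightarrow> real"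
  defines "n \<equiv> real DIM('a)" and "t \<equiv> \<lambda>x::'a. ln (norm x)"
  assumes C2: "C2_on (-{0}) w G H"
    and K: "compact K" "0 \<notin> K" and zero: "\<And>x. x \<notin> K \<Longrightarrow> w x = 0" "\<And>x. x \<notin> K \<Longrightarrow> G x = 0"
    and B0: "\<And>t. (B0 has_real_derivative B0' t) (at t)" "\<And>t. (B0' has_real_derivative B0'' t) (at t)"
      "continuous_on UNIV B0''"
    and B1: "\<And>t. (B1 has_real_derivative B1' t) (at t)" "continuous_on UNIV B1'"
  defines "A1 \<equiv> \<lambda>t. B0' t + (n - 2) * B0 t" and "A1' \<equiv> \<lambda>t. B0'' t + (n - 2) * B0' t"
  shows "(LINT x|lborel. indicator K x * (
      (2 * B0 (t x) * (x \<bullet> G x) + A1 (t x) * w x) * tr (H x)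
      + 2 * B0' (t x) * (x \<bullet> G x)\<^sup>2 / (norm x)\<^sup>2
      + (A1' (t x) / (norm x)\<^sup>2 + 2 * B1 (t x)) * (x \<bullet> G x) * w x
      + (n * B1 (t x) + B1' (t x)) * (w x)\<^sup>2)) = 0"
proof -
  define X where "X x = (2 * B0 (t x) * (x \<bullet> G x) + A1 (t x) * w x) *\<^sub>R G x
     + (B1 (t x) * (w x)\<^sup>2 - B0 (t x) * (G x \<bullet> G x)) *\<^sub>R x" for x
  define DP where "DP x h = 2 * B0' (t x) * (x \<bullet> h) / (norm x)\<^sup>2 * (x \<bullet> G x)
     + 2 * B0 (t x) * (h \<bullet> G x + x \<bullet> H x h) + A1' (t x) * (x \<bullet> h) / (norm x)\<^sup>2 * w x
     + A1 (t x) * (G x \<bullet> h)" for x h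
  define DQ where "DQ x h = B1' (t x) * (x \<bullet> h) / (norm x)\<^sup>2 * (w x)\<^sup>2 + 2 * B1 (t x) * w x * (G x \<bullet> h)
     - B0' (t x) * (x \<bullet> h) / (norm x)\<^sup>2 * (G x \<bullet> G x) - 2 * B0 (t x) * (G x \<bullet> H x h)" for x h
  define X' where "X' x h = (2 * B0 (t x) * (x \<bullet> G x) + A1 (t x) * w x) *\<^sub>R H x h + DP x h *\<^sub>R G x
     + (B1 (t x) * (w x)\<^sup>2 - B0 (t x) * (G x \<bullet> G x)) *\<^sub>R h + DQ x h *\<^sub>R x" for x h
  note w = C2_onD[OF C2]
  have A1: "(A1 has_real_derivative A1' t) (at t)" for t
    unfolding A1_def A1'_def by (auto intro!: derivative_eq_intros B0)
  have der: "(X has_derivative X' x) (at x)" if x: "x \<in> -{0}" for x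
  proof -
    have x0: "x \<noteq> 0" using x by simp
    have R: "((\<lambda>x. B0 (t x)) has_derivative (\<lambda>h. B0' (t x) * (x \<bullet> h) / (norm x)\<^sup>2)) (at x)"
      "((\<lambda>x. A1 (t x)) has_derivative (\<lambda>h. A1' (t x) * (x \<bullet> h) / (norm x)\<^sup>2)) (at x)"
      "((\<lambda>x. B1 (t x)) has_derivative (\<lambda>h. B1' (t x) * (x \<bullet> h) / (norm x)\<^sup>2)) (at x)"
      unfolding t_def by (rule radial_has_derivative B0 B1 A1 x0)+
    have P: "((\<lambda>x. 2 * B0 (t x) * (x \<bullet> G x) + A1 (t x) * w x) has_derivative DP x) (at x)"
      by (rule has_derivative_eq_rhs, (rule R w x derivative_intros)+)
        (simp add: DP_def fun_eq_iff algebra_simps inner_commute)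
    have Q: "((\<lambda>x. B1 (t x) * (w x)\<^sup>2 - B0 (t x) * (G x \<bullet> G x)) has_derivative DQ x) (at x)"
      unfolding power2_eq_square
      by (rule has_derivative_eq_rhs, (rule R w x derivative_intros)+)
        (simp add: DQ_def fun_eq_iff algebra_simps inner_commute power2_eq_square)
    show ?thesis unfolding X_def
      by (rule has_derivative_eq_rhs, (rule P Q w x derivative_intros)+)
        (simp add: X'_def fun_eq_iff)
  qed
  have cont: "continuous_on (-{0}) (\<lambda>x. X' x b)" for b
  proof -
    have *: "continuous_on UNIV k \<Longrightarrow> continuous_on (-{0}) (\<lambda>x. k (t x))" for k
      unfolding t_def by (rule radial_continuous_on) auto
    have "continuous_on UNIV B0" "continuous_on UNIV B0'" "continuous_on UNIV B1" "continuous_on UNIV A1"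
      using B0 B1 A1 by (auto intro!: continuous_at_imp_continuous_on DERIV_isCont)
    moreover from this have "continuous_on UNIV A1'" unfolding A1'_def using B0(3) by (intro continuous_intros)
    ultimately show ?thesis
      unfolding X'_def DP_def DQ_def using C2_on_continuous[OF C2] w(4) B1(2)
      by (intro continuous_intros *) auto
  qed
  have 1: "(LINT x|lborel. indicator K x * (\<Sum>b\<in>Basis. X' x b \<bullet> b)) = 0"
    by (rule integral_divergence_eq_0[of "-{0}" K X])
      (use K der cont in \<open>auto simp: X_def zero open_Compl\<close>)
  have "(\<Sum>b\<in>Basis. X' x b \<bullet> b) = (2 * B0 (t x) * (x \<bullet> G x) + A1 (t x) * w x) * tr (H x)
      + 2 * B0' (t x) * (x \<bullet> G x)\<^sup>2 / (norm x)\<^sup>2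
      + (A1' (t x) / (norm x)\<^sup>2 + 2 * B1 (t x)) * (x \<bullet> G x) * w x
      + (n * B1 (t x) + B1' (t x)) * (w x)\<^sup>2" if x: "x \<noteq> 0" for x
  proof -
    have e: "(\<Sum>b\<in>Basis. (u \<bullet> b) * (v \<bullet> b)) = u \<bullet> v" for u v :: 'a
      by (rule euclidean_inner[symmetric])
    have eH: "(\<Sum>b\<in>Basis. (x \<bullet> H x b) * (v \<bullet> b)) = H x x \<bullet> v"
      "(\<Sum>b\<in>Basis. (G x \<bullet> H x b) * (v \<bullet> b)) = H x (G x) \<bullet> v" for v
      using e[of "H x x" v] e[of "H x (G x)" v] w(3)[of x] x by (simp_all)
    have sDP: "(\<Sum>b\<in>Basis. DP x b * (G x \<bullet> b)) =
       2 * B0' (t x) / (norm x)\<^sup>2 * (x \<bullet> G x) * (\<Sum>b\<in>Basis. (x \<bullet> b) * (G x \<bullet> b))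
     + 2 * B0 (t x) * ((\<Sum>b\<in>Basis. (G x \<bullet> b) * (G x \<bullet> b)) + (\<Sum>b\<in>Basis. (x \<bullet> H x b) * (G x \<bullet> b)))
     + A1' (t x) / (norm x)\<^sup>2 * w x * (\<Sum>b\<in>Basis. (x \<bullet> b) * (G x \<bullet> b))
     + A1 (t x) * (\<Sum>b\<in>Basis. (G x \<bullet> b) * (G x \<bullet> b))"
      unfolding DP_def
      by (simp add: sum.distrib sum_distrib_left sum_divide_distrib algebra_simps inner_commute)
    have sDQ: "(\<Sum>b\<in>Basis. DQ x b * (x \<bullet> b)) =
       B1' (t x) / (norm x)\<^sup>2 * (w x)\<^sup>2 * (\<Sum>b\<in>Basis. (x \<bullet> b) * (x \<bullet> b))
     + 2 * B1 (t x) * w x * (\<Sum>b\<in>Basis. (G x \<bullet> b) * (x \<bullet> b))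
     - B0' (t x) / (norm x)\<^sup>2 * (G x \<bullet> G x) * (\<Sum>b\<in>Basis. (x \<bullet> b) * (x \<bullet> b))
     - 2 * B0 (t x) * (\<Sum>b\<in>Basis. (G x \<bullet> H x b) * (x \<bullet> b))"
      unfolding DQ_def
      by (simp add: sum.distrib sum_subtractf sum_distrib_left sum_divide_distrib algebra_simps)
    have S: "(\<Sum>b\<in>Basis. X' x b \<bullet> b) = (2 * B0 (t x) * (x \<bullet> G x) + A1 (t x) * w x) * tr (H x)
      + (\<Sum>b\<in>Basis. DP x b * (G x \<bullet> b)) + (B1 (t x) * (w x)\<^sup>2 - B0 (t x) * (G x \<bullet> G x)) * n
      + (\<Sum>b\<in>Basis. DQ x b * (x \<bullet> b))"
      unfolding X'_def tr_def n_def by (simp add: inner_add_left sum.distrib sum_distrib_left sum_distrib_right sum_divide_distrib mult_ac)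
    \<comment> \<open>Two cancellations: the terms with \<open>x \<bullet> H x (G x)\<close> from
      \<open>sDP\<close> and \<open>sDQ\<close>, by symmetry of the Hessian, and the terms with
      \<open>G x \<bullet> G x\<close>, whose coefficient is 2 B0 + A1 - n B0 - B0' = 0.\<close>
    show ?thesis
      unfolding S sDP sDQ e eH using x w(3)[of x x "G x"]
      by (simp add: A1_def power2_norm_eq_inner[symmetric] inner_commute power2_eq_square field_simps)
  qed
  then have "indicator K x * (\<Sum>b\<in>Basis. X' x b \<bullet> b) = indicator K x * (
      (2 * B0 (t x) * (x \<bullet> G x) + A1 (t x) * w x) * tr (H x)
      + 2 * B0' (t x) * (x \<bullet> G x)\<^sup>2 / (norm x)\<^sup>2
      + (A1' (t x) / (norm x)\<^sup>2 + 2 * B1 (t x)) * (x \<bullet> G x) * w x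
      + (n * B1 (t x) + B1' (t x)) * (w x)\<^sup>2)" for x
    using K(2) by (cases "x = 0") auto
  with 1 show ?thesis by simp
qed

section \<open>Carleman and Caccioppoli inequalities\<close>

lemma integrable_indicator_compact:
  fixes f :: "'a::euclidean_space \<Rightarrow> real"
  assumes "compact K" "continuous_on K f"
  shows "integrable lborel (\<lambda>x. indicator K x * f x)"
  using borel_integrable_compact[OF assms] by simp

text \<open>Dictionary: \<open>a\<close> = \<psi>'(t), - \<delta> s = \<psi>''(t), \<open>d\<close>
  = \<partial>_t w, \<open>l\<close> = \<Delta>w, \<open>r2\<close> = |x|^2, and \<open>E\<close> =
  |x|^(-n) is the density of dt times spherical measure. In the proof \<open>S\<close> and \<tau>
  \<open>A\<close> are the symmetric and antisymmetric parts of the conjugated operator. The bracket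
  behind 2 \<tau> on the left is the integrand of the Pohozaev identity and will integrate to zero.
  The inequality is (S + \<tau> A)^2 \<ge> 2 \<tau> S A together with the positivity of what
  separates S A from that bracket.\<close>

lemma carleman_pointwise:
  fixes E s d l W n \<delta> \<tau> c r2 :: real
  assumes "0 \<le> E" "0 \<le> s" "s \<le> 1/2" "0 < \<delta>" "\<delta> \<le> 1" "2 \<le> \<tau>"
  defines "a \<equiv> 1 - s"
  shows "\<tau>^3 * \<delta> / 2 * (E * s * W\<^sup>2)
     + 2 * \<tau> * ((2 * (r2 * E * a) * d - \<delta> * (r2 * E * s) * W) * l
        + 2 * E * ((2 - n) * a - \<delta> * s) * d\<^sup>2
        + (- \<delta> * (2 - n + \<delta>) * E * s + 2 * E * (\<delta>\<^sup>2 * s / 2 + (\<tau>\<^sup>2 * a\<^sup>2 + c) * a)) * d * W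
        + E * (\<delta>^3 * s / 2 - \<delta> * s * (3 * \<tau>\<^sup>2 * a\<^sup>2 + c)) * W\<^sup>2)
     \<le> E * (r2 * l - (n - 2) * d + (\<tau>\<^sup>2 * a\<^sup>2 + c) * W + \<tau> * (2 * a * d - \<delta> * s * W))\<^sup>2"
proof -
  define S A where "S = r2 * l - (n - 2) * d + (\<tau>\<^sup>2 * a\<^sup>2 + c) * W" and "A = 2 * a * d - \<delta> * s * W"
  \<comment> \<open>The subtracted form is what integrating S A by parts leaves: - 2 \<psi>'' d^2 +
    (\<psi>''''/2 - 2 \<tau>^2 \<psi>'^2 \<psi>'') W^2, times \<open>E\<close>. The constant
    \<open>c\<close> has disappeared from it.\<close>
  have id: "(2 * (r2 * E * a) * d - \<delta> * (r2 * E * s) * W) * l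
        + 2 * E * ((2 - n) * a - \<delta> * s) * d\<^sup>2
        + (- \<delta> * (2 - n + \<delta>) * E * s + 2 * E * (\<delta>\<^sup>2 * s / 2 + (\<tau>\<^sup>2 * a\<^sup>2 + c) * a)) * d * W
        + E * (\<delta>^3 * s / 2 - \<delta> * s * (3 * \<tau>\<^sup>2 * a\<^sup>2 + c)) * W\<^sup>2
      = E * (S * A) - E * (2 * \<delta> * s * d\<^sup>2 + (2 * \<tau>\<^sup>2 * a\<^sup>2 - \<delta>\<^sup>2 / 2) * \<delta> * s * W\<^sup>2)"
    unfolding S_def A_def by (simp add: algebra_simps power2_eq_square power3_eq_cube)
  \<comment> \<open>From s \<le> 1/2 one has \<psi>' \<ge> 1/2, so 2 \<tau>^2 a^2 is at least
    \<tau>^2/2. Since \<delta> \<le> 1 and \<tau> \<ge> 2, half of that already covers the negative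
    \<delta>^2/2.\<close>
  have "1/4 \<le> a\<^sup>2" using power_mono[of "1/2" a 2] assms by (simp add: a_def power2_eq_square)
  then have "\<tau>\<^sup>2 * (1/4) \<le> \<tau>\<^sup>2 * a\<^sup>2" by (intro mult_left_mono) auto
  moreover have "\<delta>\<^sup>2 \<le> 1" using assms by (simp add: power_le_one)
  moreover have "4 \<le> \<tau>\<^sup>2" using power_mono[of 2 \<tau> 2] assms by simp
  ultimately have "\<tau>\<^sup>2 / 4 \<le> 2 * \<tau>\<^sup>2 * a\<^sup>2 - \<delta>\<^sup>2 / 2" by simp
  then have "\<tau>\<^sup>2 / 4 * (\<delta> * s * W\<^sup>2) \<le> (2 * \<tau>\<^sup>2 * a\<^sup>2 - \<delta>\<^sup>2 / 2) * (\<delta> * s * W\<^sup>2)"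
    using assms by (intro mult_right_mono) auto
  moreover have "0 \<le> 2 * \<delta> * s * d\<^sup>2" using assms by simp
  ultimately have "\<tau>\<^sup>2 / 4 * (\<delta> * s * W\<^sup>2) \<le> 2 * \<delta> * s * d\<^sup>2 + (2 * \<tau>\<^sup>2 * a\<^sup>2 - \<delta>\<^sup>2 / 2) * \<delta> * s * W\<^sup>2"
    by (simp add: mult.assoc)
  then have "2 * \<tau> * (E * (\<tau>\<^sup>2 / 4 * (\<delta> * s * W\<^sup>2)))
     \<le> 2 * \<tau> * (E * (2 * \<delta> * s * d\<^sup>2 + (2 * \<tau>\<^sup>2 * a\<^sup>2 - \<delta>\<^sup>2 / 2) * \<delta> * s * W\<^sup>2))"
    using assms by (intro mult_left_mono) auto
  moreover have "2 * \<tau> * (E * (\<tau>\<^sup>2 / 4 * (\<delta> * s * W\<^sup>2))) = \<tau>^3 * \<delta> / 2 * (E * s * W\<^sup>2)"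
    by (simp add: power2_eq_square power3_eq_cube)
  moreover have "E * (2 * (\<tau> * (S * A))) \<le> E * (S + \<tau> * A)\<^sup>2"
  proof (intro mult_left_mono)
    have "0 \<le> S\<^sup>2 + (\<tau> * A)\<^sup>2" by simp
    then show "2 * (\<tau> * (S * A)) \<le> (S + \<tau> * A)\<^sup>2" by (simp add: power2_sum mult_ac)
  qed (use assms in auto)
  moreover have "2 * \<tau> * (E * (S * A) - E * (2 * \<delta> * s * d\<^sup>2 + (2 * \<tau>\<^sup>2 * a\<^sup>2 - \<delta>\<^sup>2 / 2) * \<delta> * s * W\<^sup>2))
     = E * (2 * (\<tau> * (S * A))) - 2 * \<tau> * (E * (2 * \<delta> * s * d\<^sup>2 + (2 * \<tau>\<^sup>2 * a\<^sup>2 - \<delta>\<^sup>2 / 2) * \<delta> * s * W\<^sup>2))"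
    by (simp add: right_diff_distrib mult_ac)
  ultimately show ?thesis unfolding id S_def[symmetric] A_def[symmetric] by linarith
qed

lemma carleman_conjugated:
  fixes w :: "'a::euclidean_space \<Rightarrow> real" and \<delta> \<tau> c :: real
  defines "n \<equiv> real DIM('a)" and "t \<equiv> \<lambda>x::'a. ln (norm x)"
  defines "s \<equiv> \<lambda>x. exp (\<delta> * t x)"
  assumes C2: "C2_on (-{0}) w G H"
    and K: "compact K" "0 \<notin> K" and zero: "\<And>x. x \<notin> K \<Longrightarrow> w x = 0" "\<And>x. x \<notin> K \<Longrightarrow> G x = 0"
    and s: "\<And>x. x \<in> K \<Longrightarrow> s x \<le> 1/2" and \<delta>: "0 < \<delta>" "\<delta> \<le> 1" and \<tau>: "2 \<le> \<tau>"
  shows "\<tau>^3 * \<delta> / 2 * (LINT x|lborel. indicator K x * (exp (- n * t x) * s x * (w x)\<^sup>2))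
    \<le> (LINT x|lborel. indicator K x * (exp (- n * t x) *
        ((norm x)\<^sup>2 * tr (H x) - (n - 2) * (x \<bullet> G x) + (\<tau>\<^sup>2 * (1 - s x)\<^sup>2 + c) * w x
          + \<tau> * (2 * (1 - s x) * (x \<bullet> G x) - \<delta> * s x * w x))\<^sup>2))"
proof -
  \<comment> \<open>Multipliers for the Pohozaev identity, with \<psi>' = 1 - exp (\<delta> t).
    \<open>B0\<close> is |x|^(2-n) \<psi>', so the factor of the Laplacian becomes |x|^(2-n) (2
    \<psi>' \<partial>_t w + \<psi>'' w), the antisymmetric part applied to w.
    \<open>\<beta>\<close> is \<psi>' (\<tau>^2 \<psi>'^2 + c) - \<psi>'''/2 and accounts for the
    zero-order terms of the symmetric part.\<close>
  define B0 where "B0 t = exp ((2 - n) * t) - exp ((2 - n + \<delta>) * t)" for t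
  define B0' where "B0' t = (2 - n) * exp ((2 - n) * t) - (2 - n + \<delta>) * exp ((2 - n + \<delta>) * t)" for t
  define B0'' where "B0'' t = (2 - n)\<^sup>2 * exp ((2 - n) * t) - (2 - n + \<delta>)\<^sup>2 * exp ((2 - n + \<delta>) * t)" for t
  define \<beta> where "\<beta> t = \<delta>\<^sup>2 * exp (\<delta> * t) / 2 + (\<tau>\<^sup>2 * (1 - exp (\<delta> * t))\<^sup>2 + c) * (1 - exp (\<delta> * t))" for t
  define \<beta>' where "\<beta>' t = \<delta>^3 * exp (\<delta> * t) / 2 - \<delta> * exp (\<delta> * t) * (3 * \<tau>\<^sup>2 * (1 - exp (\<delta> * t))\<^sup>2 + c)" for t
  define B1 where "B1 t = exp (- n * t) * \<beta> t" for t
  define B1' where "B1' t = - n * exp (- n * t) * \<beta> t + exp (- n * t) * \<beta>' t" for t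
  define Y where "Y x = (2 * B0 (t x) * (x \<bullet> G x) + (B0' (t x) + (n - 2) * B0 (t x)) * w x) * tr (H x)
      + 2 * B0' (t x) * (x \<bullet> G x)\<^sup>2 / (norm x)\<^sup>2
      + ((B0'' (t x) + (n - 2) * B0' (t x)) / (norm x)\<^sup>2 + 2 * B1 (t x)) * (x \<bullet> G x) * w x
      + (n * B1 (t x) + B1' (t x)) * (w x)\<^sup>2" for x
  define L where "L x = exp (- n * t x) * s x * (w x)\<^sup>2" for x
  define R where "R x = exp (- n * t x) *
        ((norm x)\<^sup>2 * tr (H x) - (n - 2) * (x \<bullet> G x) + (\<tau>\<^sup>2 * (1 - s x)\<^sup>2 + c) * w x
          + \<tau> * (2 * (1 - s x) * (x \<bullet> G x) - \<delta> * s x * w x))\<^sup>2" for x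
  have "(\<beta> has_real_derivative \<beta>' t) (at t)" for t
    unfolding \<beta>_def \<beta>'_def
    by (auto intro!: derivative_eq_intros simp: algebra_simps power2_eq_square power3_eq_cube)
  note \<beta> = this
  have d0: "(B0 has_real_derivative B0' t) (at t)" for t
    unfolding B0_def B0'_def by (auto intro!: derivative_eq_intros)
  have d1: "(B0' has_real_derivative B0'' t) (at t)" for t
    unfolding B0'_def B0''_def by (auto intro!: derivative_eq_intros simp: power2_eq_square)
  have c2: "continuous_on UNIV B0''" unfolding B0''_def by (intro continuous_intros)
  have d3: "(B1 has_real_derivative B1' t) (at t)" for t
    unfolding B1_def B1'_def by (auto intro!: derivative_eq_intros \<beta>)
  have c3: "continuous_on UNIV B1'" unfolding B1'_def \<beta>_def \<beta>'_def by (auto intro!: continuous_intros)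
  have Y0: "(LINT x|lborel. indicator K x * Y x) = 0"
    using pohozaev_identity[OF C2 K zero d0 d1 c2 d3 c3] unfolding Y_def n_def t_def by simp
  have "K \<subseteq> -{0}" using K by auto
  then have cont: "continuous_on K w" "continuous_on K G" "continuous_on K (\<lambda>x. tr (H x))"
    using C2_on_continuous[OF C2] continuous_on_subset by blast+
  have "continuous_on K t" unfolding t_def using K by (auto intro!: continuous_intros)
  note cont = cont this
  have "continuous_on K Y" "continuous_on K L" "continuous_on K R"
    unfolding Y_def L_def R_def s_def B0_def B0'_def B0''_def B1_def B1'_def \<beta>_def \<beta>'_def
    using K(2) by (auto intro!: continuous_intros cont)
  then have int: "integrable lborel (\<lambda>x. indicator K x * Y x)" "integrable lborel (\<lambda>x. indicator K x * L x)"
    "integrable lborel (\<lambda>x. indicator K x * R x)"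
    using integrable_indicator_compact[OF K(1)] by blast+
  have pw: "\<tau>^3 * \<delta> / 2 * L x + 2 * \<tau> * Y x \<le> R x" if x: "x \<in> K" for x
  proof -
    have x0: "norm x > 0" using x K by auto
    define E where "E = exp (- n * t x)"
    have r2: "(norm x)\<^sup>2 = exp (2 * t x)" using x0 by (simp add: t_def exp_double)
    have e: "exp ((2 - n) * t x) = (norm x)\<^sup>2 * E" "exp ((2 - n + \<delta>) * t x) = (norm x)\<^sup>2 * E * s x"
      by (simp_all add: r2 E_def s_def exp_add[symmetric] algebra_simps)
    have 0: "B0 (t x) = (norm x)\<^sup>2 * E * (1 - s x)"
      unfolding B0_def e by (simp add: algebra_simps)
    have 1: "B0' (t x) = (norm x)\<^sup>2 * E * ((2 - n) * (1 - s x) - \<delta> * s x)"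
      unfolding B0'_def e by (simp add: algebra_simps)
    have 2: "B0'' (t x) + (n - 2) * B0' (t x) = (norm x)\<^sup>2 * (- \<delta> * (2 - n + \<delta>) * E * s x)"
      unfolding B0'_def B0''_def e by (simp add: algebra_simps power2_eq_square)
    have 3: "B0' (t x) + (n - 2) * B0 (t x) = - \<delta> * ((norm x)\<^sup>2 * E * s x)"
      unfolding 0 1 by (simp add: algebra_simps)
    have 4: "n * B1 (t x) + B1' (t x) = E * (\<delta>^3 * s x / 2 - \<delta> * s x * (3 * \<tau>\<^sup>2 * (1 - s x)\<^sup>2 + c))"
      unfolding B1_def B1'_def \<beta>'_def E_def s_def by (simp add: algebra_simps)
    have 5: "B1 (t x) = E * (\<delta>\<^sup>2 * s x / 2 + (\<tau>\<^sup>2 * (1 - s x)\<^sup>2 + c) * (1 - s x))"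
      unfolding B1_def \<beta>_def E_def s_def by simp
    have "Y x = ((2 * ((norm x)\<^sup>2 * E * (1 - s x)) * (x \<bullet> G x) - \<delta> * ((norm x)\<^sup>2 * E * s x) * w x) * tr (H x)
        + 2 * E * ((2 - n) * (1 - s x) - \<delta> * s x) * (x \<bullet> G x)\<^sup>2
        + (- \<delta> * (2 - n + \<delta>) * E * s x + 2 * E * (\<delta>\<^sup>2 * s x / 2 + (\<tau>\<^sup>2 * (1 - s x)\<^sup>2 + c) * (1 - s x))) * (x \<bullet> G x) * w x
        + E * (\<delta>^3 * s x / 2 - \<delta> * s x * (3 * \<tau>\<^sup>2 * (1 - s x)\<^sup>2 + c)) * (w x)\<^sup>2)"
      unfolding Y_def 2 3 4 unfolding 0 1 5 using x0 by simp
    then show ?thesis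
      unfolding L_def R_def E_def[symmetric]
      using carleman_pointwise[of E "s x" \<delta> \<tau> "w x" "(norm x)\<^sup>2" "x \<bullet> G x" "tr (H x)" n c] s[OF x] \<delta> \<tau>
      by (simp add: E_def s_def)
  qed
  have "\<tau>^3 * \<delta> / 2 * (LINT x|lborel. indicator K x * L x) =
     \<tau>^3 * \<delta> / 2 * (LINT x|lborel. indicator K x * L x) + 2 * \<tau> * (LINT x|lborel. indicator K x * Y x)"
    by (simp add: Y0)
  also have "\<dots> = (LINT x|lborel. \<tau>^3 * \<delta> / 2 * (indicator K x * L x) + 2 * \<tau> * (indicator K x * Y x))"
    using int by (simp del: mult_cancel_left)
  also have "\<dots> \<le> (LINT x|lborel. indicator K x * R x)"
    by (rule integral_mono) (use int pw in \<open>auto split: split_indicator\<close>)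
  finally show ?thesis by (simp add: L_def R_def)
qed

text \<open>\<open>\<sigma>1\<close> is the derivative of \<sigma>(t) = \<tau> \<psi>(t) - (n - 2) t
  / 2; \<open>k1\<close> and \<open>k2\<close> are the first two derivatives of exp (- \<sigma>)
  \<xi>; \<open>l\<close> is |x|^2 \<Delta>w. The extra factor |x|^((n - 2)/2) removes the
  first-order term of |x|^2 \<Delta> and replaces \<open>c\<close> by c - (n - 2)^2/4, which is 0
  for the Hardy constant.\<close>

lemma conjugation_identity:
  fixes \<tau> s \<delta> n c \<xi> \<xi>1 \<xi>2 l d w E :: real
  defines "\<sigma>1 \<equiv> \<tau> * (1 - s) - (n - 2) / 2"
  defines "k1 \<equiv> E * (\<xi>1 - \<sigma>1 * \<xi>)" and "k2 \<equiv> E * (\<xi>2 - 2 * \<sigma>1 * \<xi>1 + (\<sigma>1\<^sup>2 + \<tau> * \<delta> * s) * \<xi>)"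
  shows "((E * \<xi>) * l + 2 * k1 * d + (k2 + (n - 2) * k1) * w) - (n - 2) * ((E * \<xi>) * d + k1 * w)
      + (\<tau>\<^sup>2 * (1 - s)\<^sup>2 + (c - (n - 2)\<^sup>2 / 4)) * ((E * \<xi>) * w)
      + \<tau> * (2 * (1 - s) * ((E * \<xi>) * d + k1 * w) - \<delta> * s * ((E * \<xi>) * w))
    = E * (\<xi> * (l + c * w) + 2 * \<xi>1 * d + (\<xi>2 + (n - 2) * \<xi>1) * w)"
  unfolding k1_def k2_def \<sigma>1_def by (simp add: field_simps power2_eq_square)

lemma compact_annulus: "compact {x::'a::euclidean_space. a \<le> norm x \<and> norm x \<le> b}"
proof -
  have "{x::'a. a \<le> norm x \<and> norm x \<le> b} = cball 0 b \<inter> {x. a \<le> norm x}" by auto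
  moreover have "closed {x::'a. a \<le> norm x}" by (intro closed_Collect_le continuous_intros)
  ultimately show ?thesis by (metis compact_Int_closed compact_cball)
qed

lemma annulus_iff:
  fixes x :: "'a::real_normed_vector"
  assumes "x \<noteq> 0"
  shows "(exp \<alpha> \<le> norm x \<and> norm x \<le> exp \<beta>) \<longleftrightarrow> ln (norm x) \<in> {\<alpha>..\<beta>}"
  using assms exp_le_cancel_iff[of "ln (norm x)" \<beta>] ln_ge_iff[of "norm x" \<alpha>] by simp

text \<open>The estimate of \<open>carleman_conjugated\<close> for exp (- \<sigma>) \<xi> w, which
  is supported in the closed annulus, with the conjugation undone. What appears on the right is
  |x|^2 \<Delta> + c applied to \<xi> w: the equation term times \<xi>, plus terms carrying
  derivatives of \<xi>.\<close>

lemma carleman_cutoff: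
  fixes w :: "'a::euclidean_space \<Rightarrow> real" and \<delta> \<tau> c :: real
  defines "n \<equiv> real DIM('a)" and "t \<equiv> \<lambda>x::'a. ln (norm x)"
  defines "K \<equiv> \<lambda>\<alpha> \<beta>. {x::'a. exp \<alpha> \<le> norm x \<and> norm x \<le> exp \<beta>}"
  defines "\<Lambda> \<equiv> \<lambda>t. exp (- 2 * \<tau> * (t - exp (\<delta> * t) / \<delta>) - 2 * t)"
  assumes C2: "C2_on (-{0}) w G H"
    and \<xi>: "\<And>t. (\<xi> has_real_derivative \<xi>1 t) (at t)" "\<And>t. (\<xi>1 has_real_derivative \<xi>2 t) (at t)"
       "continuous_on UNIV \<xi>2"
    and zero: "\<And>t. t \<notin> {\<alpha>..\<beta>} \<Longrightarrow> \<xi> t = 0" "\<And>t. t \<notin> {\<alpha>..\<beta>} \<Longrightarrow> \<xi>1 t = 0"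
    and s: "exp (\<delta> * \<beta>) \<le> 1/2" and \<delta>: "0 < \<delta>" "\<delta> \<le> 1" and \<tau>: "2 \<le> \<tau>"
  shows "\<tau>^3 * \<delta> / 2 * (LINT x|lborel. indicator (K \<alpha> \<beta>) x * (\<Lambda> (t x) * exp (\<delta> * t x) * (\<xi> (t x) * w x)\<^sup>2))
    \<le> (LINT x|lborel. indicator (K \<alpha> \<beta>) x * (\<Lambda> (t x) *
        (\<xi> (t x) * ((norm x)\<^sup>2 * tr (H x) + c * w x) + 2 * \<xi>1 (t x) * (x \<bullet> G x)
          + (\<xi>2 (t x) + (n - 2) * \<xi>1 (t x)) * w x)\<^sup>2))"
proof -
  define \<sigma> where "\<sigma> t = \<tau> * (t - exp (\<delta> * t) / \<delta>) - (n - 2) / 2 * t" for t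
  define \<sigma>1 where "\<sigma>1 t = \<tau> * (1 - exp (\<delta> * t)) - (n - 2) / 2" for t
  define E where "E t = exp (- \<sigma> t)" for t
  define k where "k t = E t * \<xi> t" for t
  define k1 where "k1 t = E t * (\<xi>1 t - \<sigma>1 t * \<xi> t)" for t
  define k2 where "k2 t = E t * (\<xi>2 t - 2 * \<sigma>1 t * \<xi>1 t + ((\<sigma>1 t)\<^sup>2 + \<tau> * \<delta> * exp (\<delta> * t)) * \<xi> t)" for t
  have \<sigma>: "(\<sigma> has_real_derivative \<sigma>1 t) (at t)" for t
    unfolding \<sigma>_def \<sigma>1_def using \<delta> by (auto intro!: derivative_eq_intros)
  have \<sigma>1: "(\<sigma>1 has_real_derivative - \<tau> * \<delta> * exp (\<delta> * t)) (at t)" for t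
    unfolding \<sigma>1_def by (auto intro!: derivative_eq_intros)
  have E: "(E has_real_derivative - \<sigma>1 t * E t) (at t)" for t
    unfolding E_def by (auto intro!: derivative_eq_intros \<sigma>)
  have dk: "(k has_real_derivative k1 t) (at t)" for t
    unfolding k_def k1_def by (auto intro!: derivative_eq_intros E \<xi> simp: algebra_simps)
  have dk1: "(k1 has_real_derivative k2 t) (at t)" for t
    unfolding k1_def k2_def
    by (auto intro!: derivative_eq_intros E \<xi> \<sigma>1 simp: algebra_simps power2_eq_square)
  have cont: "continuous_on UNIV E" "continuous_on UNIV \<sigma>1" "continuous_on UNIV \<xi>" "continuous_on UNIV \<xi>1"
    using E \<sigma>1 \<xi> by (auto intro!: continuous_at_imp_continuous_on DERIV_isCont)
  have ck2: "continuous_on UNIV k2"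
    unfolding k2_def by (auto intro!: continuous_intros cont \<xi>(3))
  define W where "W x = k (t x) * w x" for x
  define GW where "GW x = k (t x) *\<^sub>R G x + (k1 (t x) / (norm x)\<^sup>2 * w x) *\<^sub>R x" for x
  define HW where "HW x h = k (t x) *\<^sub>R H x h + (k1 (t x) / (norm x)\<^sup>2 * (x \<bullet> h)) *\<^sub>R G x
        + (k1 (t x) / (norm x)\<^sup>2 * (G x \<bullet> h)) *\<^sub>R x + (k1 (t x) / (norm x)\<^sup>2 * w x) *\<^sub>R h
        + ((k2 (t x) - 2 * k1 (t x)) / (norm x)^4 * (x \<bullet> h) * w x) *\<^sub>R x" for x h
  have C2W: "C2_on (-{0}) W GW HW"
    unfolding W_def GW_def HW_def t_def
    using C2_on_radial_mult[OF C2 _ dk dk1 ck2] by (simp add: fun_eq_iff)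
  have K0: "0 \<notin> K \<alpha> \<beta>" unfolding K_def by (auto simp: not_le)
  have Kc: "compact (K \<alpha> \<beta>)" unfolding K_def by (rule compact_annulus)
  have out: "x = 0 \<or> t x \<notin> {\<alpha>..\<beta>}" if "x \<notin> K \<alpha> \<beta>" for x
    using that annulus_iff[of x \<alpha> \<beta>] unfolding K_def t_def by auto
  text \<open>At the origin \<^const>\<open>ln\<close> has a junk value, so the cut-off is made to vanish there by hand.\<close>
  define W' where "W' x = (if x = 0 then 0 else W x)" for x
  define GW' where "GW' x = (if x = 0 then 0 else GW x)" for x
  have C2W': "C2_on (-{0}) W' GW' HW"
    by (rule C2_on_cong[OF C2W]) (auto simp: W'_def GW'_def)
  have z: "W' x = 0" "GW' x = 0" if "x \<notin> K \<alpha> \<beta>" for x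
    using out[OF that] zero[of "t x"]
    by (auto simp: W'_def GW'_def W_def GW_def k_def k1_def)
  have tb: "\<alpha> \<le> t x" "t x \<le> \<beta>" "x \<noteq> 0" if "x \<in> K \<alpha> \<beta>" for x
  proof -
    show x0: "x \<noteq> 0" using that K0 by auto
    then show "\<alpha> \<le> t x" "t x \<le> \<beta>" using that annulus_iff[of x \<alpha> \<beta>] by (auto simp: K_def t_def)
  qed
  have sb: "exp (\<delta> * ln (norm x)) \<le> 1/2" if "x \<in> K \<alpha> \<beta>" for x
  proof -
    have "exp (\<delta> * t x) \<le> exp (\<delta> * \<beta>)" using tb(2)[OF that] \<delta> by simp
    with s show ?thesis unfolding t_def by linarith
  qed
  note main = carleman_conjugated[OF C2W' Kc K0 z sb \<delta> \<tau>, of "c - (n - 2)\<^sup>2 / 4", folded n_def]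
  \<comment> \<open>|x|^(-n) from the measure and |x|^(n-2) from the square of the extra factor in
    \<open>E\<close> leave the exp (- 2 t) of \<open>\<Lambda>\<close>.\<close>
  have E2: "exp (- n * t) * (E t)\<^sup>2 = \<Lambda> t" for t
    unfolding E_def \<sigma>_def \<Lambda>_def exp_double[symmetric] exp_add[symmetric] using \<delta> by (simp add: field_simps)
  have L: "indicator (K \<alpha> \<beta>) x * (exp (- n * ln (norm x)) * exp (\<delta> * ln (norm x)) * (W' x)\<^sup>2)
      = indicator (K \<alpha> \<beta>) x * (\<Lambda> (t x) * exp (\<delta> * t x) * (\<xi> (t x) * w x)\<^sup>2)" for x
    using tb(3)[of x] E2[of "t x", symmetric]
    by (auto simp: W'_def W_def k_def t_def power_mult_distrib split: split_indicator)
  have R: "indicator (K \<alpha> \<beta>) x * (exp (- n * ln (norm x)) *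
        ((norm x)\<^sup>2 * tr (HW x) - (n - 2) * (x \<bullet> GW' x) + (\<tau>\<^sup>2 * (1 - exp (\<delta> * ln (norm x)))\<^sup>2 + (c - (n - 2)\<^sup>2 / 4)) * W' x
          + \<tau> * (2 * (1 - exp (\<delta> * ln (norm x))) * (x \<bullet> GW' x) - \<delta> * exp (\<delta> * ln (norm x)) * W' x))\<^sup>2)
      = indicator (K \<alpha> \<beta>) x * (\<Lambda> (t x) *
        (\<xi> (t x) * ((norm x)\<^sup>2 * tr (H x) + c * w x) + 2 * \<xi>1 (t x) * (x \<bullet> G x)
          + (\<xi>2 (t x) + (n - 2) * \<xi>1 (t x)) * w x)\<^sup>2)" for x
  proof (cases "x \<in> K \<alpha> \<beta>")
    case True
    then have x: "x \<noteq> 0" using tb by auto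
    have l: "(norm x)\<^sup>2 * tr (HW x) = k (t x) * ((norm x)\<^sup>2 * tr (H x)) + 2 * k1 (t x) * (x \<bullet> G x)
        + (k2 (t x) + (n - 2) * k1 (t x)) * w x"
      unfolding HW_def n_def by (rule tr_radial_mult[OF x])
    have d: "x \<bullet> GW' x = k (t x) * (x \<bullet> G x) + k1 (t x) * w x"
      using x by (simp add: GW'_def GW_def inner_add_right power2_norm_eq_inner)
    have W: "W' x = k (t x) * w x" using x by (simp add: W'_def W_def)
    have "((norm x)\<^sup>2 * tr (HW x) - (n - 2) * (x \<bullet> GW' x) + (\<tau>\<^sup>2 * (1 - exp (\<delta> * t x))\<^sup>2 + (c - (n - 2)\<^sup>2 / 4)) * W' x
          + \<tau> * (2 * (1 - exp (\<delta> * t x)) * (x \<bullet> GW' x) - \<delta> * exp (\<delta> * t x) * W' x))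
       = E (t x) * (\<xi> (t x) * ((norm x)\<^sup>2 * tr (H x) + c * w x) + 2 * \<xi>1 (t x) * (x \<bullet> G x)
          + (\<xi>2 (t x) + (n - 2) * \<xi>1 (t x)) * w x)"
      unfolding l d W k_def k1_def k2_def \<sigma>1_def by (rule conjugation_identity)
    then show ?thesis using E2[of "t x"] by (simp add: power_mult_distrib t_def mult.assoc[symmetric])
  qed simp
  from main[unfolded L R] show ?thesis .
qed

text \<open>Caccioppoli's inequality: the divergence theorem for \<open>\<zeta>\<^sup>2 w \<nabla>w\<close> with a radial cut-off \<open>\<zeta>\<close>.\<close>

lemma caccioppoli:
  fixes w :: "'a::euclidean_space \<Rightarrow> real"
  defines "t \<equiv> \<lambda>x::'a. ln (norm x)"
  assumes C2: "C2_on (-{0}) w G H"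
    and K: "compact K" "0 \<notin> K" and zero: "\<And>x. x \<noteq> 0 \<Longrightarrow> x \<notin> K \<Longrightarrow> \<zeta> (t x) = 0"
    and \<zeta>: "\<And>t. (\<zeta> has_real_derivative \<zeta>1 t) (at t)" "continuous_on UNIV \<zeta>1"
  shows "(LINT x|lborel. indicator K x * ((\<zeta> (t x))\<^sup>2 * (G x \<bullet> G x)))
    \<le> (LINT x|lborel. indicator K x * (2 * (\<zeta> (t x))\<^sup>2 * \<bar>w x * tr (H x)\<bar> + 4 * (w x)\<^sup>2 * (\<zeta>1 (t x))\<^sup>2 / (norm x)\<^sup>2))"
proof -
  define X where "X x = (if x = 0 then 0 else ((\<zeta> (t x))\<^sup>2 * w x) *\<^sub>R G x)" for x
  define X' where "X' x h = ((\<zeta> (t x))\<^sup>2 * w x) *\<^sub>R H x h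
     + (2 * \<zeta> (t x) * (\<zeta>1 (t x) * (x \<bullet> h) / (norm x)\<^sup>2) * w x + (\<zeta> (t x))\<^sup>2 * (G x \<bullet> h)) *\<^sub>R G x" for x h
  define Y where "Y x = (\<zeta> (t x))\<^sup>2 * w x * tr (H x) + 2 * \<zeta> (t x) * \<zeta>1 (t x) * (x \<bullet> G x) / (norm x)\<^sup>2 * w x
      + (\<zeta> (t x))\<^sup>2 * (G x \<bullet> G x)" for x
  define L where "L x = (\<zeta> (t x))\<^sup>2 * (G x \<bullet> G x)" for x
  define R where "R x = 2 * (\<zeta> (t x))\<^sup>2 * \<bar>w x * tr (H x)\<bar> + 4 * (w x)\<^sup>2 * (\<zeta>1 (t x))\<^sup>2 / (norm x)\<^sup>2" for x
  note w = C2_onD[OF C2]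
  have der: "(X has_derivative X' x) (at x)" if x: "x \<in> -{0}" for x
  proof -
    have Z: "((\<lambda>x. \<zeta> (t x)) has_derivative (\<lambda>h. \<zeta>1 (t x) * (x \<bullet> h) / (norm x)\<^sup>2)) (at x)"
      unfolding t_def by (rule radial_has_derivative \<zeta>)+ (use x in auto)
    have "((\<lambda>x. ((\<zeta> (t x))\<^sup>2 * w x) *\<^sub>R G x) has_derivative X' x) (at x)"
      unfolding power2_eq_square
      by (rule has_derivative_eq_rhs, (rule Z w x derivative_intros)+)
        (simp add: X'_def fun_eq_iff algebra_simps power2_eq_square)
    then show ?thesis
      by (rule has_derivative_transform_within_open[of _ _ _ _ "-{0}"]) (use x in \<open>auto simp: X_def\<close>)
  qed
  have ct: "continuous_on (-{0}) (\<lambda>x. \<zeta> (t x))" "continuous_on (-{0}) (\<lambda>x. \<zeta>1 (t x))"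
    unfolding t_def using \<zeta>(2)
    by (auto intro!: radial_continuous_on[where k=\<zeta>] radial_continuous_on[where k=\<zeta>1]
        continuous_at_imp_continuous_on[of UNIV \<zeta>] DERIV_isCont[OF \<zeta>(1)])
  note cont = ct C2_on_continuous[OF C2] w(4)
  have "continuous_on (-{0}) (\<lambda>x. X' x b)" for b
    unfolding X'_def by (auto intro!: continuous_intros cont)
  then have 1: "(LINT x|lborel. indicator K x * (\<Sum>b\<in>Basis. X' x b \<bullet> b)) = 0"
    by (intro integral_divergence_eq_0[of "-{0}" K X])
      (use K der zero in \<open>auto simp: X_def open_Compl\<close>)
  have "(\<Sum>b\<in>Basis. X' x b \<bullet> b) = Y x" for x
  proof -
    have e: "(\<Sum>b\<in>Basis. (u \<bullet> b) * (v \<bullet> b)) = u \<bullet> v" for u v :: 'a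
      by (rule euclidean_inner[symmetric])
    have "(\<Sum>b\<in>Basis. X' x b \<bullet> b) = (\<zeta> (t x))\<^sup>2 * w x * tr (H x)
       + 2 * \<zeta> (t x) * \<zeta>1 (t x) / (norm x)\<^sup>2 * w x * (\<Sum>b\<in>Basis. (x \<bullet> b) * (G x \<bullet> b))
       + (\<zeta> (t x))\<^sup>2 * (\<Sum>b\<in>Basis. (G x \<bullet> b) * (G x \<bullet> b))"
      unfolding X'_def tr_def
      by (simp add: inner_add_left sum.distrib sum_distrib_left sum_divide_distrib algebra_simps)
    then show ?thesis unfolding e Y_def by simp
  qed
  with 1 have Y0: "(LINT x|lborel. indicator K x * Y x) = 0" by simp
  have "K \<subseteq> -{0}" using K by auto
  then have "continuous_on K Y" "continuous_on K L" "continuous_on K R"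
    unfolding Y_def L_def R_def
    by (auto intro!: continuous_intros cont[THEN continuous_on_subset])
  then have int: "integrable lborel (\<lambda>x. indicator K x * Y x)" "integrable lborel (\<lambda>x. indicator K x * L x)"
    "integrable lborel (\<lambda>x. indicator K x * R x)"
    using integrable_indicator_compact[OF K(1)] by blast+
  \<comment> \<open>\<open>Y\<close> integrates to zero and contains \<open>L\<close> once. Adding
    it twice leaves a spare \<open>L\<close>, which absorbs the cross term by Young's
    inequality.\<close>
  have pw: "L x \<le> R x + 2 * Y x" if x: "x \<in> K" for x
  proof -
    have x0: "norm x > 0" using x K by auto
    define z z1 r where "z = \<zeta> (t x)" and "z1 = \<zeta>1 (t x)" and "r = norm x"
    have "\<bar>x \<bullet> G x\<bar> \<le> r * norm (G x)" unfolding r_def by (rule Cauchy_Schwarz_ineq2)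
    then have "\<bar>x \<bullet> G x / r\<bar> \<le> norm (G x)" using x0 by (simp add: r_def divide_le_eq mult.commute)
    then have d: "(x \<bullet> G x / r)\<^sup>2 \<le> G x \<bullet> G x"
      unfolding power2_norm_eq_inner[symmetric] by (rule abs_le_square_iff[THEN iffD1, of _ "norm (G x)", simplified])
    have "- (4 * (z * (x \<bullet> G x / r)) * (z1 * w x / r)) \<le> (z * (x \<bullet> G x / r))\<^sup>2 + (2 * (z1 * w x / r))\<^sup>2"
      using zero_le_power2[of "z * (x \<bullet> G x / r) + 2 * (z1 * w x / r)"] by (simp add: power2_eq_square algebra_simps)
    also have "(z * (x \<bullet> G x / r))\<^sup>2 \<le> z\<^sup>2 * (G x \<bullet> G x)"
      unfolding power_mult_distrib by (intro mult_left_mono d) auto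
    finally have "- (4 * (z * (x \<bullet> G x / r)) * (z1 * w x / r)) \<le> z\<^sup>2 * (G x \<bullet> G x) + (2 * (z1 * w x / r))\<^sup>2"
      by simp
    moreover have "z\<^sup>2 * (w x * tr (H x)) \<ge> - (z\<^sup>2 * \<bar>w x * tr (H x)\<bar>)"
      using mult_left_mono[of "- \<bar>w x * tr (H x)\<bar>" "w x * tr (H x)" "z\<^sup>2"] by (simp add: minus_le_iff)
    moreover have "4 * (z * (x \<bullet> G x / r)) * (z1 * w x / r) = 2 * (2 * z * z1 * (x \<bullet> G x) / r\<^sup>2 * w x)"
      "(2 * (z1 * w x / r))\<^sup>2 = 4 * (w x)\<^sup>2 * z1\<^sup>2 / r\<^sup>2"
      by (simp_all add: power2_eq_square)
    ultimately show ?thesis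
      unfolding L_def R_def Y_def z_def[symmetric] z1_def[symmetric] r_def[symmetric]
      by (simp only: mult.assoc[of "z\<^sup>2"] mult.assoc[of 2 "z\<^sup>2"] distrib_left)
  qed
  have "(LINT x|lborel. indicator K x * L x) \<le> (LINT x|lborel. indicator K x * R x + 2 * (indicator K x * Y x))"
    by (rule integral_mono) (use int pw in \<open>auto split: split_indicator\<close>)
  also have "\<dots> = (LINT x|lborel. indicator K x * R x)" using int by (simp add: Y0)
  finally show ?thesis by (simp add: L_def R_def)
qed

section \<open>Strong unique continuation\<close>

definition annulus :: "real \<Rightarrow> real \<Rightarrow> 'a::real_normed_vector set" where
  "annulus a b = {x. exp a \<le> norm x \<and> norm x \<le> exp b}"

lemma annulus_compact: "compact (annulus a b :: 'a::euclidean_space set)"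
  unfolding annulus_def by (rule compact_annulus)

lemma zero_notin_annulus [simp]: "0 \<notin> annulus a b"
  by (simp add: annulus_def not_le)

lemma mem_annulus: "x \<in> annulus a b \<longleftrightarrow> x \<noteq> 0 \<and> a \<le> ln (norm x) \<and> ln (norm x) \<le> b"
  using annulus_iff[of x a b] by (cases "x = 0") (auto simp: annulus_def not_le)

lemma annulus_subset: "a' \<le> a \<Longrightarrow> b \<le> b' \<Longrightarrow> annulus a b \<subseteq> annulus a' b'"
  by (auto simp: mem_annulus)

lemma annulus_subset_cball: "b \<le> 0 \<Longrightarrow> annulus a b \<subseteq> cball 0 1"
  using exp_le_one_iff[of b] by (auto simp: annulus_def simp del: exp_le_one_iff)

lemma integral_indicator_le:
  fixes f :: "'a::euclidean_space \<Rightarrow> real"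
  assumes "integrable lborel (\<lambda>x. indicator A x * f x)" "\<And>x. x \<in> A \<Longrightarrow> f x \<le> B" "0 \<le> B" "A \<subseteq> cball 0 1"
  shows "(LINT x|lborel. indicator A x * f x) \<le> B * measure lborel (cball 0 1 :: 'a set)"
proof -
  have "(LINT x|lborel. indicator A x * f x) \<le> (LINT x|lborel. indicator (cball (0::'a) 1) x * B)"
  proof (rule integral_mono[OF assms(1)])
    show "integrable lborel (\<lambda>x. indicator (cball (0::'a) 1) x * B)"
      by (rule integrable_indicator_compact) auto
    show "indicator A x * f x \<le> indicator (cball 0 1) x * B" for x
      using assms(2)[of x] assms(3,4) by (auto split: split_indicator)
  qed
  then show ?thesis by (simp add: mult.commute)
qed

text \<open>Cut-off in t = ln |x| with transition layers of unit length at both ends. The length is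
  fixed so that a single \<open>M\<close> serves all \<open>a\<close> and \<open>b\<close>: later
  the inner layer moves to t = - \<infinity>, and its error must not pick up factors from
  derivatives of the cut-off.\<close>

definition is_cutoff :: "real \<Rightarrow> real \<Rightarrow> real \<Rightarrow> (real \<Rightarrow> real) \<Rightarrow> (real \<Rightarrow> real) \<Rightarrow> (real \<Rightarrow> real) \<Rightarrow> bool" where
  "is_cutoff M a b \<xi> \<xi>1 \<xi>2 \<longleftrightarrow>
     (\<forall>t. (\<xi> has_real_derivative \<xi>1 t) (at t)) \<and> (\<forall>t. (\<xi>1 has_real_derivative \<xi>2 t) (at t)) \<and>
     continuous_on UNIV \<xi>2 \<and> (\<forall>t. 0 \<le> \<xi> t \<and> \<xi> t \<le> 1 \<and> \<bar>\<xi>1 t\<bar> \<le> M \<and> \<bar>\<xi>2 t\<bar> \<le> M) \<and>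
     (\<forall>t. t \<notin> {a..b} \<longrightarrow> \<xi> t = 0 \<and> \<xi>1 t = 0) \<and>
     (\<forall>t. a + 1 \<le> t \<and> t \<le> b - 1 \<longrightarrow> \<xi> t = 1 \<and> \<xi>1 t = 0 \<and> \<xi>2 t = 0)"

lemma is_cutoffD:
  assumes "is_cutoff M a b \<xi> \<xi>1 \<xi>2"
  shows "(\<xi> has_real_derivative \<xi>1 t) (at t)" "(\<xi>1 has_real_derivative \<xi>2 t) (at t)"
    "continuous_on UNIV \<xi>" "continuous_on UNIV \<xi>1" "continuous_on UNIV \<xi>2"
    "0 \<le> \<xi> t" "\<xi> t \<le> 1" "\<bar>\<xi>1 t\<bar> \<le> M" "\<bar>\<xi>2 t\<bar> \<le> M"
    "t \<notin> {a..b} \<Longrightarrow> \<xi> t = 0" "t \<notin> {a..b} \<Longrightarrow> \<xi>1 t = 0"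
    "a + 1 \<le> t \<Longrightarrow> t \<le> b - 1 \<Longrightarrow> \<xi> t = 1" "a + 1 \<le> t \<Longrightarrow> t \<le> b - 1 \<Longrightarrow> \<xi>1 t = 0"
    "a + 1 \<le> t \<Longrightarrow> t \<le> b - 1 \<Longrightarrow> \<xi>2 t = 0"
proof -
  show "continuous_on UNIV \<xi>" "continuous_on UNIV \<xi>1"
    using assms unfolding is_cutoff_def by (blast intro: continuous_at_imp_continuous_on DERIV_isCont)+
qed (use assms in \<open>unfold is_cutoff_def, blast+\<close>)

lemma smooth_cutoff:
  obtains M :: real where "0 \<le> M" and "\<And>a b. \<exists>\<xi> \<xi>1 \<xi>2. is_cutoff M a b \<xi> \<xi>1 \<xi>2"
proof -
  define m where "m t = (max 0 t)^3" for t :: real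
  define m1 where "m1 t = 3 * (max 0 t)\<^sup>2" for t :: real
  define m2 where "m2 t = 6 * max 0 t" for t :: real
  \<comment> \<open>A C^2 step from 0 to 1: the cube \<open>m\<close> is flat to second order at 0,
    and applying it once more to 1 - m t makes the step equally flat at 1.\<close>
  define \<theta> where "\<theta> t = 1 - m (1 - m t)" for t
  define \<theta>1 where "\<theta>1 t = m1 (1 - m t) * m1 t" for t
  define \<theta>2 where "\<theta>2 t = m1 (1 - m t) * m2 t - m2 (1 - m t) * (m1 t)\<^sup>2" for t
  have pw: "((\<lambda>t. (max 0 t)^(Suc k)) has_real_derivative real (Suc k) * (max 0 t)^k) (at t)" if "k > 0" for t :: real and k
  proof -
    consider "t < 0" | "t = 0" | "t > 0" by linarith
    then show ?thesis
    proof cases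
      case 1
      have "((\<lambda>t. (max 0 t)^(Suc k)) has_real_derivative 0) (at t)"
        by (rule has_field_derivative_transform_within_open[of "\<lambda>t. 0" _ _ "{..<0}"])
          (use 1 in \<open>auto simp: max_def\<close>)
      moreover have "max 0 t = 0" using 1 by simp
      ultimately show ?thesis using that by (simp add: power_0_left del: power_Suc)
    next
      case 2
      have "((\<lambda>h::real. (max 0 h)^k) \<longlongrightarrow> (max 0 0)^k) (at 0)" by (intro tendsto_intros)
      moreover have "(max 0 (0::real))^k = 0" using that by simp
      ultimately have "((\<lambda>h::real. (max 0 h)^k) \<longlongrightarrow> 0) (at 0)" by (simp only:)
      then have "((\<lambda>h::real. (max 0 h)^(Suc k) / h) \<longlongrightarrow> 0) (at 0)"
        by (rule Lim_transform_eventually) (use that in \<open>auto simp: eventually_at_filter max_def\<close>)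
      then show ?thesis using 2 that by (simp add: DERIV_def power_0_left)
    next
      case 3
      have "((\<lambda>t. t^(Suc k)) has_real_derivative real (Suc k) * t^k) (at t)"
        using DERIV_pow[of "Suc k" t] by simp
      then have "((\<lambda>t. (max 0 t)^(Suc k)) has_real_derivative real (Suc k) * t^k) (at t)"
        by (rule has_field_derivative_transform_within_open[of _ _ _ "{0<..}"])
          (use 3 in \<open>auto simp: max_def\<close>)
      moreover have "max 0 t = t" using 3 by simp
      ultimately show ?thesis by (simp del: power_Suc)
    qed
  qed
  have m: "(m has_real_derivative m1 t) (at t)" for t
    using pw[of 2 t] unfolding m_def m1_def by (simp add: eval_nat_numeral)
  have m1: "(m1 has_real_derivative m2 t) (at t)" for t
    using DERIV_cmult[OF pw[of 1 t], of 3] unfolding m1_def m2_def by (simp add: eval_nat_numeral)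
  have \<theta>: "(\<theta> has_real_derivative \<theta>1 t) (at t)" for t
    unfolding \<theta>_def \<theta>1_def
    by (auto intro!: derivative_eq_intros m DERIV_chain2[where f=m, OF m])
  have \<theta>1: "(\<theta>1 has_real_derivative \<theta>2 t) (at t)" for t
    unfolding \<theta>1_def \<theta>2_def
    by (auto intro!: derivative_eq_intros m m1 DERIV_chain2[where f=m1, OF m1] simp: power2_eq_square)
  have c2: "continuous_on UNIV \<theta>2"
    unfolding \<theta>2_def m_def m1_def m2_def by (auto intro!: continuous_intros)
  have lo: "\<theta> t = 0" "\<theta>1 t = 0" "\<theta>2 t = 0" if "t \<le> 0" for t
    using that by (auto simp: \<theta>_def \<theta>1_def \<theta>2_def m_def m1_def m2_def max_def)
  have hi: "\<theta> t = 1" "\<theta>1 t = 0" "\<theta>2 t = 0" if "1 \<le> t" for t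
  proof -
    have "1 \<le> m t" using that one_le_power[of t 3] by (simp add: m_def max_def)
    then have "max 0 (1 - m t) = 0" by simp
    then have "m (1 - m t) = 0" "m1 (1 - m t) = 0" "m2 (1 - m t) = 0"
      by (simp_all only: m_def m1_def m2_def) auto
    then show "\<theta> t = 1" "\<theta>1 t = 0" "\<theta>2 t = 0" by (simp_all add: \<theta>_def \<theta>1_def \<theta>2_def)
  qed
  have m01: "0 \<le> m t" "0 \<le> m1 t" "0 \<le> m2 t" "t \<le> 1 \<Longrightarrow> m t \<le> 1 \<and> m1 t \<le> 3 \<and> m2 t \<le> 6" for t
    using power_le_one[of "max 0 t" 3] power_le_one[of "max 0 t" 2] by (auto simp: m_def m1_def m2_def)
  have b: "0 \<le> \<theta> t" "\<theta> t \<le> 1" for t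
    using m01[of "1 - m t"] m01(1)[of t] by (auto simp: \<theta>_def)
  have b12: "\<bar>\<theta>1 t\<bar> \<le> 9 \<and> \<bar>\<theta>2 t\<bar> \<le> 72" for t
  proof (cases "t \<le> 1")
    case True
    note A = m01[of t] m01[of "1 - m t"]
    have A': "m1 t \<le> 3" "m2 t \<le> 6" "m1 (1 - m t) \<le> 3" "m2 (1 - m t) \<le> 6" using A True by auto
    have "\<theta>1 t \<le> 3 * 3" "0 \<le> \<theta>1 t" unfolding \<theta>1_def using A A' by (rule_tac mult_mono, auto)
    moreover have "m1 (1 - m t) * m2 t \<le> 3 * 6" "0 \<le> m1 (1 - m t) * m2 t"
      using A A' by (rule_tac mult_mono, auto)
    moreover have "(m1 t)\<^sup>2 \<le> 3\<^sup>2" using A A' by (rule_tac power_mono)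
    then have "m2 (1 - m t) * (m1 t)\<^sup>2 \<le> 6 * 3\<^sup>2" "0 \<le> m2 (1 - m t) * (m1 t)\<^sup>2"
      using A A' by (rule_tac mult_mono, auto)
    ultimately show ?thesis unfolding \<theta>2_def by auto
  next
    case False
    then show ?thesis using hi[of t] by simp
  qed
  show ?thesis
  \<comment> \<open>306 = 72 + 2 * 9 * 9 + 72, from the bounds 1, 9, 72 on \<open>\<theta>\<close>,
    \<open>\<theta>1\<close>, \<open>\<theta>2\<close> in the second derivative of the product of an
    ascending and a descending step.\<close>
  proof (rule that[of 306], simp, unfold is_cutoff_def, intro exI conjI allI impI)
    fix a b :: real and t
    let ?\<xi> = "\<lambda>t. \<theta> (t - a) * \<theta> (b - t)"
    let ?\<xi>1 = "\<lambda>t. \<theta>1 (t - a) * \<theta> (b - t) - \<theta> (t - a) * \<theta>1 (b - t)"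
    let ?\<xi>2 = "\<lambda>t. \<theta>2 (t - a) * \<theta> (b - t) - 2 * \<theta>1 (t - a) * \<theta>1 (b - t) + \<theta> (t - a) * \<theta>2 (b - t)"
    show "(?\<xi> has_real_derivative ?\<xi>1 t) (at t)"
      by (auto intro!: derivative_eq_intros DERIV_chain2[where f=\<theta>, OF \<theta>])
    show "(?\<xi>1 has_real_derivative ?\<xi>2 t) (at t)"
      by (auto intro!: derivative_eq_intros DERIV_chain2[where f=\<theta>, OF \<theta>] DERIV_chain2[where f=\<theta>1, OF \<theta>1])
    have "continuous_on UNIV \<theta>" "continuous_on UNIV \<theta>1"
      using \<theta> \<theta>1 by (auto intro!: continuous_at_imp_continuous_on DERIV_isCont)
    then show "continuous_on UNIV ?\<xi>2" using c2
      by (auto intro!: continuous_intros continuous_on_compose2[of UNIV \<theta>]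
          continuous_on_compose2[of UNIV \<theta>1] continuous_on_compose2[of UNIV \<theta>2])
    show "0 \<le> ?\<xi> t" "?\<xi> t \<le> 1" using b by (auto intro!: mult_nonneg_nonneg mult_le_one)
    have B: "\<bar>p * q\<bar> \<le> P * Q" if "\<bar>p\<bar> \<le> P" "\<bar>q\<bar> \<le> Q" for p q P Q :: real
      unfolding abs_mult using that by (intro mult_mono) auto
    have T: "\<bar>\<theta> t\<bar> \<le> 1" "\<bar>\<theta>1 t\<bar> \<le> 9" "\<bar>\<theta>2 t\<bar> \<le> 72" for t using b[of t] b12[of t] by auto
    show "\<bar>?\<xi>1 t\<bar> \<le> 306"
      using B[OF T(2)[of "t - a"] T(1)[of "b - t"]] B[OF T(1)[of "t - a"] T(2)[of "b - t"]] by linarith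
    show "\<bar>?\<xi>2 t\<bar> \<le> 306"
      using B[OF T(3)[of "t - a"] T(1)[of "b - t"]] B[OF T(1)[of "t - a"] T(3)[of "b - t"]]
        B[OF T(2)[of "t - a"] T(2)[of "b - t"]] by linarith
    show "?\<xi> t = 0" "?\<xi>1 t = 0" if "t \<notin> {a..b}"
      using that lo[of "t - a"] lo[of "b - t"] by (auto simp: not_le)
    show "?\<xi> t = 1" "?\<xi>1 t = 0" "?\<xi>2 t = 0" if "a + 1 \<le> t \<and> t \<le> b - 1"
      using that hi[of "t - a"] hi[of "b - t"] by auto
  qed
qed

lemma C2_on_annulus_integrable:
  fixes w :: "'a::euclidean_space \<Rightarrow> real"
  assumes "C2_on (-{0}) w G H" "continuous_on (annulus a b) f"
  shows "integrable lborel (\<lambda>x. indicator (annulus a b) x * (f x * (x \<bullet> G x)\<^sup>2))"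
    "integrable lborel (\<lambda>x. indicator (annulus a b) x * (f x * (w x)\<^sup>2))"
proof -
  have "annulus a b \<subseteq> -{0::'a}" by auto
  note C = C2_on_continuous[OF assms(1), THEN continuous_on_subset, OF this]
  show "integrable lborel (\<lambda>x. indicator (annulus a b) x * (f x * (x \<bullet> G x)\<^sup>2))"
    "integrable lborel (\<lambda>x. indicator (annulus a b) x * (f x * (w x)\<^sup>2))"
    by (auto intro!: integrable_indicator_compact annulus_compact continuous_intros C assms(2))
qed

text \<open>Caccioppoli's inequality with a cut-off equal to 1 for a \<le> t \<le> a + 1. The point
  is that \<open>C'\<close> does not depend on \<open>a\<close>: the |x|^2 in (x \<bullet>
  \<nabla>w)^2 cancels the |x|^(-2) of the inequality up to \<open>exp 4\<close>, the squared
  quotient of exp (a + 1) and exp (a - 1). In \<open>P\<close> the sum |c| + C + 1 bounds |x|^2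
  |\<Delta>w| / m; its summand 1 comes from \<eta> \<le> m.\<close>

lemma radial_derivative_bound:
  fixes c C :: real
  assumes "0 \<le> C"
  obtains C' :: real where "0 \<le> C'"
    and "\<And>(w::'a::euclidean_space \<Rightarrow> real) G H a m \<eta>.
      C2_on (-{0}) w G H \<Longrightarrow> a + 2 \<le> 0 \<Longrightarrow> 0 \<le> \<eta> \<Longrightarrow> \<eta> \<le> m \<Longrightarrow>
      (\<And>x. x \<in> annulus (a - 1) (a + 2) \<Longrightarrow> \<bar>w x\<bar> \<le> m) \<Longrightarrow>
      (\<And>x. x \<in> annulus (a - 1) (a + 2) \<Longrightarrow> \<bar>(norm x)\<^sup>2 * tr (H x) + c * w x\<bar> \<le> C * \<bar>w x\<bar> + \<eta>) \<Longrightarrow>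
      (LINT x|lborel. indicator (annulus a (a + 1)) x * (x \<bullet> G x)\<^sup>2) \<le> C' * m\<^sup>2"
proof -
  obtain M :: real where M: "0 \<le> M" and cut: "\<And>a b. \<exists>\<xi> \<xi>1 \<xi>2. is_cutoff M a b \<xi> \<xi>1 \<xi>2"
    using smooth_cutoff by blast
  define V where "V = measure lborel (cball 0 1 :: 'a set)"
  define P where "P = 2 * (\<bar>c\<bar> + C + 1) + 4 * M\<^sup>2"
  have P: "0 \<le> P" using assms by (simp add: P_def)
  show ?thesis
  proof (rule that[of "exp 4 * P * V"])
    show "0 \<le> exp 4 * P * V" using P by (simp add: V_def)
    fix w :: "'a \<Rightarrow> real" and G H a m \<eta>
    assume C2: "C2_on (-{0}) w G H" and a: "a + 2 \<le> 0" and \<eta>: "0 \<le> \<eta>" "\<eta> \<le> m"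
      and w: "\<And>x. x \<in> annulus (a - 1) (a + 2) \<Longrightarrow> \<bar>w x\<bar> \<le> m"
      and eq: "\<And>x. x \<in> annulus (a - 1) (a + 2) \<Longrightarrow> \<bar>(norm x)\<^sup>2 * tr (H x) + c * w x\<bar> \<le> C * \<bar>w x\<bar> + \<eta>"
    obtain \<zeta> \<zeta>1 \<zeta>2 where "is_cutoff M (a - 1) (a + 2) \<zeta> \<zeta>1 \<zeta>2" using cut by blast
    note \<zeta> = is_cutoffD[OF this]
    note z0 = \<zeta>(3) and z1 = \<zeta>(4)
    define K where "K = (annulus (a - 1) (a + 2) :: 'a set)"
    have K: "compact K" "0 \<notin> K" "K \<subseteq> -{0}" unfolding K_def by (auto simp: annulus_compact)
    have zero: "\<zeta> (ln (norm x)) = 0" if "x \<noteq> 0" "x \<notin> K" for x :: 'a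
      using that by (intro \<zeta>(10)) (auto simp: K_def mem_annulus)
    note cont = C2_on_continuous[OF C2, THEN continuous_on_subset, OF K(3)]
      radial_continuous_on[OF z0 K(2)] radial_continuous_on[OF z1 K(2)]
    let ?L = "\<lambda>x. (\<zeta> (ln (norm x)))\<^sup>2 * (G x \<bullet> G x)"
    let ?R = "\<lambda>x. 2 * (\<zeta> (ln (norm x)))\<^sup>2 * \<bar>w x * tr (H x)\<bar> + 4 * (w x)\<^sup>2 * (\<zeta>1 (ln (norm x)))\<^sup>2 / (norm x)\<^sup>2"
    have int: "integrable lborel (\<lambda>x. indicator K x * ?L x)" "integrable lborel (\<lambda>x. indicator K x * ?R x)"
      using K(2) by (auto intro!: integrable_indicator_compact K(1) continuous_intros cont)
    have R: "?R x \<le> exp (2 - 2 * a) * (P * m\<^sup>2)" if x: "x \<in> K" for x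
    proof -
      have n: "exp (a - 1) \<le> norm x" and x0: "norm x > 0"
        using x K unfolding K_def by (auto simp: annulus_def)
      have wm: "\<bar>w x\<bar> \<le> m" and e: "\<bar>(norm x)\<^sup>2 * tr (H x) + c * w x\<bar> \<le> C * \<bar>w x\<bar> + \<eta>"
        using w eq x unfolding K_def by auto
      have m0: "0 \<le> m" using \<eta> by simp
      have "(norm x)\<^sup>2 * \<bar>tr (H x)\<bar> = \<bar>(norm x)\<^sup>2 * tr (H x)\<bar>" by (simp add: abs_mult)
      also have "\<dots> \<le> C * \<bar>w x\<bar> + \<eta> + \<bar>c\<bar> * \<bar>w x\<bar>" using e by (simp add: abs_mult[symmetric])
      also have "\<dots> \<le> C * m + m + \<bar>c\<bar> * m" using \<eta> wm assms by (intro add_mono mult_left_mono) auto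
      finally have l: "(norm x)\<^sup>2 * \<bar>tr (H x)\<bar> \<le> (\<bar>c\<bar> + C + 1) * m" by (simp add: algebra_simps)
      have z2: "(\<zeta> (ln (norm x)))\<^sup>2 \<le> 1" using \<zeta>(6,7) by (simp add: power_le_one)
      have z3: "(\<zeta>1 (ln (norm x)))\<^sup>2 \<le> M\<^sup>2" using \<zeta>(8) power2_le_iff_abs_le[OF M] by blast
      have w2: "(w x)\<^sup>2 \<le> m\<^sup>2" using wm power2_le_iff_abs_le[OF m0] by blast
      have "(norm x)\<^sup>2 * ?R x = 2 * (\<zeta> (ln (norm x)))\<^sup>2 * (\<bar>w x\<bar> * ((norm x)\<^sup>2 * \<bar>tr (H x)\<bar>)) + 4 * ((w x)\<^sup>2 * (\<zeta>1 (ln (norm x)))\<^sup>2)"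
        using x0 by (simp add: abs_mult field_simps)
      also have "\<dots> \<le> 2 * 1 * (m * ((\<bar>c\<bar> + C + 1) * m)) + 4 * (m\<^sup>2 * M\<^sup>2)"
      proof (rule add_mono)
        have q: "\<bar>w x\<bar> * ((norm x)\<^sup>2 * \<bar>tr (H x)\<bar>) \<le> m * ((\<bar>c\<bar> + C + 1) * m)"
          by (rule mult_mono[OF wm l m0]) simp
        have "(\<zeta> (ln (norm x)))\<^sup>2 * (\<bar>w x\<bar> * ((norm x)\<^sup>2 * \<bar>tr (H x)\<bar>)) \<le> 1 * (m * ((\<bar>c\<bar> + C + 1) * m))"
          by (rule mult_mono[OF z2 q]) auto
        then show "2 * (\<zeta> (ln (norm x)))\<^sup>2 * (\<bar>w x\<bar> * ((norm x)\<^sup>2 * \<bar>tr (H x)\<bar>)) \<le> 2 * 1 * (m * ((\<bar>c\<bar> + C + 1) * m))"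
          by (simp add: mult.assoc)
        have "(w x)\<^sup>2 * (\<zeta>1 (ln (norm x)))\<^sup>2 \<le> m\<^sup>2 * M\<^sup>2" by (rule mult_mono[OF w2 z3]) auto
        then show "4 * ((w x)\<^sup>2 * (\<zeta>1 (ln (norm x)))\<^sup>2) \<le> 4 * (m\<^sup>2 * M\<^sup>2)" by simp
      qed
      also have "\<dots> = P * m\<^sup>2" by (simp add: P_def power2_eq_square algebra_simps)
      finally have "?R x \<le> P * m\<^sup>2 / (norm x)\<^sup>2" using x0 by (simp add: le_divide_eq mult.commute)
      also have "\<dots> \<le> P * m\<^sup>2 / (exp (a - 1))\<^sup>2"
        using n P x0 by (intro divide_left_mono power_mono) auto
      also have "\<dots> = exp (2 - 2 * a) * (P * m\<^sup>2)"
        by (simp add: exp_double[symmetric] exp_diff exp_minus field_simps flip: exp_add)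
      finally show ?thesis .
    qed
    have "(LINT x|lborel. indicator (annulus a (a + 1)) x * (x \<bullet> G x)\<^sup>2)
        \<le> (LINT x|lborel. exp (2 * (a + 1)) * (indicator K x * ?L x))"
    proof (rule integral_mono)
      show "integrable lborel (\<lambda>x. indicator (annulus a (a + 1)) x * (x \<bullet> G x)\<^sup>2)"
        using C2_on_annulus_integrable(1)[OF C2, of a "a+1" "\<lambda>_. 1"] by simp
      show "integrable lborel (\<lambda>x. exp (2 * (a + 1)) * (indicator K x * ?L x))" using int by simp
      fix x :: 'a
      show "indicator (annulus a (a + 1)) x * (x \<bullet> G x)\<^sup>2 \<le> exp (2 * (a + 1)) * (indicator K x * ?L x)"
      proof (cases "x \<in> annulus a (a + 1)")
        case True
        then have xK: "x \<in> K" using annulus_subset[of "a - 1" a "a + 1" "a + 2"] by (auto simp: K_def)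
        have z: "\<zeta> (ln (norm x)) = 1" using True by (intro \<zeta>(12)) (auto simp: mem_annulus)
        have "(x \<bullet> G x)\<^sup>2 \<le> (norm x * norm (G x))\<^sup>2"
          using Cauchy_Schwarz_ineq2[of x "G x"] power2_le_iff_abs_le by (metis mult_nonneg_nonneg norm_ge_zero)
        also have "\<dots> = (norm x)\<^sup>2 * (G x \<bullet> G x)" by (simp add: power_mult_distrib power2_norm_eq_inner)
        also have "\<dots> \<le> (exp (a + 1))\<^sup>2 * (G x \<bullet> G x)"
          using True by (intro mult_right_mono power_mono) (auto simp: annulus_def)
        also have "(exp (a + 1))\<^sup>2 = exp (2 * (a + 1))" by (rule exp_double[symmetric])
        finally show ?thesis using True xK z by simp
      qed (simp add: indicator_def)
    qed
    also have "\<dots> = exp (2 * (a + 1)) * (LINT x|lborel. indicator K x * ?L x)" by simp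
    also have "\<dots> \<le> exp (2 * (a + 1)) * (LINT x|lborel. indicator K x * ?R x)"
      by (intro mult_left_mono caccioppoli[OF C2 K(1,2)]) (use zero \<zeta>(1) z1 in auto)
    also have "\<dots> \<le> exp (2 * (a + 1)) * (exp (2 - 2 * a) * (P * m\<^sup>2) * V)"
      unfolding V_def using R P a
      by (intro mult_left_mono integral_indicator_le int) (auto simp: K_def intro!: annulus_subset_cball)
    also have "\<dots> = (exp (2 * (a + 1)) * exp (2 - 2 * a)) * P * V * m\<^sup>2" by simp
    also have "exp (2 * (a + 1)) * exp (2 - 2 * a) = exp 4" by (simp flip: exp_add)
    finally show "(LINT x|lborel. indicator (annulus a (a + 1)) x * (x \<bullet> G x)\<^sup>2) \<le> exp 4 * P * V * m\<^sup>2" .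
  qed
qed

text \<open>This is |x|^(-2) exp (- 2 \<tau> \<psi>(t)) at t = ln |x|, the function called
  \<open>\<Lambda>\<close> in \<open>carleman_cutoff\<close>.\<close>

definition weight :: "real \<Rightarrow> real \<Rightarrow> real \<Rightarrow> real" where
  "weight \<delta> \<tau> t = exp (- 2 * \<tau> * (t - exp (\<delta> * t) / \<delta>) - 2 * t)"

lemma weight_pos: "0 < weight \<delta> \<tau> t"
  by (simp add: weight_def)

text \<open>\<psi> increases on t \<le> 0 because \<psi>' = 1 - exp (\<delta> t) is nonnegative
  there. Monotonicity allows the weight to be replaced by its value at an end of a layer.\<close>

lemma weight_antimono:
  assumes "s \<le> t" "t \<le> 0" "0 < \<delta>" "0 \<le> \<tau>"
  shows "weight \<delta> \<tau> t \<le> weight \<delta> \<tau> s"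
proof -
  have "exp (\<delta> * t) - exp (\<delta> * s) = exp (\<delta> * t) * (1 - exp (\<delta> * (s - t)))"
    by (simp add: algebra_simps flip: exp_add)
  also have "\<dots> \<le> 1 * (\<delta> * (t - s))"
  proof (rule mult_mono)
    show "exp (\<delta> * t) \<le> 1" using assms by (simp add: mult_nonneg_nonpos)
    show "1 - exp (\<delta> * (s - t)) \<le> \<delta> * (t - s)"
      using exp_ge_add_one_self[of "\<delta> * (s - t)"] by (simp add: algebra_simps)
    show "0 \<le> 1 - exp (\<delta> * (s - t))" using assms by (simp add: mult_nonneg_nonpos)
  qed simp
  finally have "(exp (\<delta> * t) - exp (\<delta> * s)) / \<delta> \<le> t - s"
    using assms(3) by (simp add: divide_le_eq mult.commute)
  then have "s - exp (\<delta> * s) / \<delta> \<le> t - exp (\<delta> * t) / \<delta>" by (simp add: diff_divide_distrib)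
  then have "\<tau> * (s - exp (\<delta> * s) / \<delta>) \<le> \<tau> * (t - exp (\<delta> * t) / \<delta>)"
    using assms(4) by (rule mult_left_mono)
  then show ?thesis unfolding weight_def using assms(1) by simp
qed

text \<open>\<open>L\<close> stands for |x|^2 \<Delta>w + c w, \<open>d\<close> for x \<bullet>
  \<nabla>w and \<open>s\<close> for |x|^\<delta>. The square is split twice by (a + b)^2 \<le> 2
  a^2 + 2 b^2, whence the factors 4 and 16. The second claim is for the region where the cut-off is
  constant; no first derivative of \<open>w\<close> remains there.\<close>

lemma cutoff_error_pointwise:
  fixes \<xi> \<xi>1 \<xi>2 L d w n s C \<eta> M :: real
  assumes "0 \<le> \<xi>" "\<xi> \<le> 1" "\<bar>\<xi>1\<bar> \<le> M" "\<bar>\<xi>2\<bar> \<le> M" "0 \<le> s" "s \<le> 1" "0 \<le> C"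
    and L: "\<bar>L\<bar> \<le> C * s * \<bar>w\<bar> + \<eta>"
  shows "(\<xi> * L + 2 * \<xi>1 * d + (\<xi>2 + (n - 2) * \<xi>1) * w)\<^sup>2
     \<le> 4 * C\<^sup>2 * (s * (\<xi> * w)\<^sup>2) + 4 * \<eta>\<^sup>2 + (16 * M\<^sup>2 + 4 * (M + \<bar>n - 2\<bar> * M)\<^sup>2) * (d\<^sup>2 + w\<^sup>2)"
    and "\<xi>1 = 0 \<Longrightarrow> \<xi>2 = 0 \<Longrightarrow> (\<xi> * L + 2 * \<xi>1 * d + (\<xi>2 + (n - 2) * \<xi>1) * w)\<^sup>2
     \<le> 4 * C\<^sup>2 * (s * (\<xi> * w)\<^sup>2) + 4 * \<eta>\<^sup>2"
proof -
  have sq: "(a + b)\<^sup>2 \<le> 2 * a\<^sup>2 + 2 * b\<^sup>2" for a b :: real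
    using zero_le_power2[of "a - b"] by (simp add: power2_eq_square algebra_simps)
  have "\<bar>L\<bar>\<^sup>2 \<le> (C * s * \<bar>w\<bar> + \<eta>)\<^sup>2" using L by (intro power_mono) auto
  also have "\<dots> \<le> 2 * (C * s * \<bar>w\<bar>)\<^sup>2 + 2 * \<eta>\<^sup>2" by (rule sq)
  finally have "\<xi>\<^sup>2 * L\<^sup>2 \<le> \<xi>\<^sup>2 * (2 * (C * s * \<bar>w\<bar>)\<^sup>2 + 2 * \<eta>\<^sup>2)" by (intro mult_left_mono) auto
  also have "\<dots> = 2 * C\<^sup>2 * (s\<^sup>2 * (\<xi> * w)\<^sup>2) + \<xi>\<^sup>2 * (2 * \<eta>\<^sup>2)"
    by (simp add: power_mult_distrib algebra_simps)
  also have "\<dots> \<le> 2 * C\<^sup>2 * (s * (\<xi> * w)\<^sup>2) + 1 * (2 * \<eta>\<^sup>2)"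
  proof (intro add_mono mult_left_mono mult_right_mono)
    \<comment> \<open>Giving up one power of \<open>s\<close> turns the potential term into the very
      integrand that the Carleman estimate controls.\<close>
    show "s\<^sup>2 \<le> s" using assms(5,6) by (simp add: power2_eq_square mult_left_le)
    show "\<xi>\<^sup>2 \<le> 1" using assms(1,2) by (simp add: power_le_one)
  qed auto
  finally have p: "(\<xi> * L)\<^sup>2 \<le> 2 * C\<^sup>2 * (s * (\<xi> * w)\<^sup>2) + 2 * \<eta>\<^sup>2" by (simp add: power_mult_distrib)
  moreover have "0 \<le> 2 * C\<^sup>2 * (s * (\<xi> * w)\<^sup>2) + 2 * \<eta>\<^sup>2" using assms(5) by simp
  moreover have "2 * (2 * C\<^sup>2 * (s * (\<xi> * w)\<^sup>2) + 2 * \<eta>\<^sup>2) = 4 * C\<^sup>2 * (s * (\<xi> * w)\<^sup>2) + 4 * \<eta>\<^sup>2" by simp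
  ultimately have "(\<xi> * L)\<^sup>2 \<le> 4 * C\<^sup>2 * (s * (\<xi> * w)\<^sup>2) + 4 * \<eta>\<^sup>2" by linarith
  then show "\<xi>1 = 0 \<Longrightarrow> \<xi>2 = 0 \<Longrightarrow> (\<xi> * L + 2 * \<xi>1 * d + (\<xi>2 + (n - 2) * \<xi>1) * w)\<^sup>2
     \<le> 4 * C\<^sup>2 * (s * (\<xi> * w)\<^sup>2) + 4 * \<eta>\<^sup>2"
    by simp
  have "\<xi>1\<^sup>2 \<le> M\<^sup>2" using power_mono[OF assms(3), of 2] by simp
  then have "4 * (\<xi>1\<^sup>2 * d\<^sup>2) \<le> 4 * (M\<^sup>2 * d\<^sup>2)" by (intro mult_left_mono mult_right_mono) auto
  then have q1: "(2 * \<xi>1 * d)\<^sup>2 \<le> 4 * (M\<^sup>2 * d\<^sup>2)" by (simp add: power_mult_distrib)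
  have "\<bar>\<xi>2 + (n - 2) * \<xi>1\<bar> \<le> \<bar>\<xi>2\<bar> + \<bar>n - 2\<bar> * \<bar>\<xi>1\<bar>"
    using abs_triangle_ineq[of \<xi>2 "(n - 2) * \<xi>1"] by (simp add: abs_mult)
  also have "\<dots> \<le> M + \<bar>n - 2\<bar> * M" using assms by (intro add_mono mult_left_mono) auto
  finally have "(\<xi>2 + (n - 2) * \<xi>1)\<^sup>2 \<le> (M + \<bar>n - 2\<bar> * M)\<^sup>2"
    using power_mono[of "\<bar>\<xi>2 + (n - 2) * \<xi>1\<bar>" "M + \<bar>n - 2\<bar> * M" 2] by simp
  then have q2: "((\<xi>2 + (n - 2) * \<xi>1) * w)\<^sup>2 \<le> (M + \<bar>n - 2\<bar> * M)\<^sup>2 * w\<^sup>2"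
    unfolding power_mult_distrib by (intro mult_right_mono) auto
  have "(\<xi> * L + (2 * \<xi>1 * d + (\<xi>2 + (n - 2) * \<xi>1) * w))\<^sup>2
     \<le> 2 * (\<xi> * L)\<^sup>2 + 2 * (2 * (2 * \<xi>1 * d)\<^sup>2 + 2 * ((\<xi>2 + (n - 2) * \<xi>1) * w)\<^sup>2)"
    by (rule order_trans[OF sq add_left_mono[OF mult_left_mono[OF sq]]]) simp
  also have "\<dots> \<le> 2 * (2 * C\<^sup>2 * (s * (\<xi> * w)\<^sup>2) + 2 * \<eta>\<^sup>2) + 2 * (2 * (4 * (M\<^sup>2 * d\<^sup>2)) + 2 * ((M + \<bar>n - 2\<bar> * M)\<^sup>2 * w\<^sup>2))"
    by (intro add_mono mult_left_mono p q1 q2) auto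
  also have "\<dots> \<le> 4 * C\<^sup>2 * (s * (\<xi> * w)\<^sup>2) + 4 * \<eta>\<^sup>2 + (16 * M\<^sup>2 + 4 * (M + \<bar>n - 2\<bar> * M)\<^sup>2) * (d\<^sup>2 + w\<^sup>2)"
  proof -
    have "0 \<le> M\<^sup>2 * w\<^sup>2" "0 \<le> (M + \<bar>n - 2\<bar> * M)\<^sup>2 * d\<^sup>2" by auto
    then show ?thesis by (simp add: distrib_left distrib_right)
  qed
  finally show "(\<xi> * L + 2 * \<xi>1 * d + (\<xi>2 + (n - 2) * \<xi>1) * w)\<^sup>2
     \<le> 4 * C\<^sup>2 * (s * (\<xi> * w)\<^sup>2) + 4 * \<eta>\<^sup>2 + (16 * M\<^sup>2 + 4 * (M + \<bar>n - 2\<bar> * M)\<^sup>2) * (d\<^sup>2 + w\<^sup>2)"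
    by (simp add: add.assoc)
qed

text \<open>\<open>D\<close> and \<open>\<tau>0\<close> are fixed before \<open>w\<close>, the
  radii, \<open>\<tau>\<close> and \<open>\<eta>\<close>, as the later limits require. The weight
  decreases in t, so each layer is charged with its value at the inner end. For the outer layer that
  end is \<beta> - 1, which is also where the left side is bounded from below; the common factor can
  thus be cancelled later. The bounds on |w| are assumed one unit beyond each layer, on either side,
  to make room for Caccioppoli's inequality.\<close>

lemma carleman_annulus_estimate:
  fixes c C \<delta> :: real
  assumes C: "0 \<le> C" and \<delta>: "0 < \<delta>" "\<delta> \<le> 1"
  obtains D \<tau>0 :: real where "0 \<le> D" "2 \<le> \<tau>0"
    and "\<And>(w::'a::euclidean_space \<Rightarrow> real) G H \<alpha> \<beta> \<gamma> \<tau> \<eta> m1 m2.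
      C2_on (-{0}) w G H \<Longrightarrow> exp (\<delta> * \<beta>) \<le> 1/2 \<Longrightarrow> \<beta> + 1 \<le> 0 \<Longrightarrow> \<alpha> + 1 \<le> \<gamma> \<Longrightarrow> \<gamma> \<le> \<beta> - 1 \<Longrightarrow>
      \<tau>0 \<le> \<tau> \<Longrightarrow> 0 \<le> \<eta> \<Longrightarrow> \<eta> \<le> m1 \<Longrightarrow> \<eta> \<le> m2 \<Longrightarrow>
      (\<And>x. x \<in> annulus (\<alpha> - 1) (\<alpha> + 2) \<Longrightarrow> \<bar>w x\<bar> \<le> m1) \<Longrightarrow>
      (\<And>x. x \<in> annulus (\<beta> - 2) (\<beta> + 1) \<Longrightarrow> \<bar>w x\<bar> \<le> m2) \<Longrightarrow>
      (\<And>x. x \<in> annulus (\<alpha> - 1) (\<beta> + 1) \<Longrightarrow>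
         \<bar>(norm x)\<^sup>2 * tr (H x) + c * w x\<bar> \<le> C * exp (\<delta> * ln (norm x)) * \<bar>w x\<bar> + \<eta>) \<Longrightarrow>
      \<tau>^3 * \<delta> / 4 * (exp (\<delta> * \<gamma>) * weight \<delta> \<tau> (\<beta> - 1) *
          (LINT x|lborel. indicator (annulus \<gamma> (\<beta> - 1)) x * (w x)\<^sup>2))
        \<le> D * (weight \<delta> \<tau> \<alpha> * (\<eta>\<^sup>2 + m1\<^sup>2) + weight \<delta> \<tau> (\<beta> - 1) * m2\<^sup>2)"
proof -
  obtain M :: real where M: "0 \<le> M" and cut: "\<And>a b. \<exists>\<xi> \<xi>1 \<xi>2. is_cutoff M a b \<xi> \<xi>1 \<xi>2"
    using smooth_cutoff by blast
  obtain C' :: real where C': "0 \<le> C'" and rad: "\<And>(w::'a \<Rightarrow> real) G H a m \<eta>.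
      C2_on (-{0}) w G H \<Longrightarrow> a + 2 \<le> 0 \<Longrightarrow> 0 \<le> \<eta> \<Longrightarrow> \<eta> \<le> m \<Longrightarrow>
      (\<And>x. x \<in> annulus (a - 1) (a + 2) \<Longrightarrow> \<bar>w x\<bar> \<le> m) \<Longrightarrow>
      (\<And>x. x \<in> annulus (a - 1) (a + 2) \<Longrightarrow> \<bar>(norm x)\<^sup>2 * tr (H x) + c * w x\<bar> \<le> C * \<bar>w x\<bar> + \<eta>) \<Longrightarrow>
      (LINT x|lborel. indicator (annulus a (a + 1)) x * (x \<bullet> G x)\<^sup>2) \<le> C' * m\<^sup>2"
    using radial_derivative_bound[OF C, of c thesis] by blast
  define n where "n = real DIM('a)"
  define V where "V = measure lborel (cball 0 1 :: 'a set)"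
  define B where "B = 16 * M\<^sup>2 + 4 * (M + \<bar>n - 2\<bar> * M)\<^sup>2"
  define D where "D = 4 * V + B * (C' + V)"
  have V: "0 \<le> V" and B: "0 \<le> B" by (auto simp: V_def B_def)
  show ?thesis
  \<comment> \<open>The threshold 16 C^2 / \<delta> together with \<tau> \<le> \<tau>^3 gives 4 C^2
    \<le> \<tau>^3 \<delta> / 4: the potential consumes half of the Carleman gain \<tau>^3 \<delta>
    / 2.\<close>
  proof (rule that[of D "max 2 (16 * C\<^sup>2 / \<delta>)"])
    show "0 \<le> D" using V B C' by (simp add: D_def)
    show "2 \<le> max 2 (16 * C\<^sup>2 / \<delta>)" by simp
    fix w :: "'a \<Rightarrow> real" and G H \<alpha> \<beta> \<gamma> \<tau> \<eta> m1 m2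
    assume C2: "C2_on (-{0}) w G H" and \<beta>: "exp (\<delta> * \<beta>) \<le> 1/2" "\<beta> + 1 \<le> 0" and \<gamma>: "\<alpha> + 1 \<le> \<gamma>" "\<gamma> \<le> \<beta> - 1"
      and \<tau>: "max 2 (16 * C\<^sup>2 / \<delta>) \<le> \<tau>" and \<eta>: "0 \<le> \<eta>" "\<eta> \<le> m1" "\<eta> \<le> m2"
      and w1: "\<And>x. x \<in> annulus (\<alpha> - 1) (\<alpha> + 2) \<Longrightarrow> \<bar>w x\<bar> \<le> m1"
      and w2: "\<And>x. x \<in> annulus (\<beta> - 2) (\<beta> + 1) \<Longrightarrow> \<bar>w x\<bar> \<le> m2"
      and eq: "\<And>x. x \<in> annulus (\<alpha> - 1) (\<beta> + 1) \<Longrightarrow>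
         \<bar>(norm x)\<^sup>2 * tr (H x) + c * w x\<bar> \<le> C * exp (\<delta> * ln (norm x)) * \<bar>w x\<bar> + \<eta>"
    have \<tau>2: "2 \<le> \<tau>" using \<tau> by simp
    define A where "A = (annulus \<alpha> \<beta> :: 'a set)"
    define T1 where "T1 = (annulus \<alpha> (\<alpha> + 1) :: 'a set)"
    define T2 where "T2 = (annulus (\<beta> - 1) \<beta> :: 'a set)"
    define S where "S = (annulus \<gamma> (\<beta> - 1) :: 'a set)"
    define \<Lambda> where "\<Lambda> x = weight \<delta> \<tau> (ln (norm x))" for x :: 'a
    define s where "s x = exp (\<delta> * ln (norm x))" for x :: 'a
    obtain \<xi> \<xi>1 \<xi>2 where "is_cutoff M \<alpha> \<beta> \<xi> \<xi>1 \<xi>2" using cut by blast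
    note \<xi> = is_cutoffD[OF this]
    define Q where "Q x = \<xi> (ln (norm x)) * ((norm x)\<^sup>2 * tr (H x) + c * w x) + 2 * \<xi>1 (ln (norm x)) * (x \<bullet> G x)
          + (\<xi>2 (ln (norm x)) + (n - 2) * \<xi>1 (ln (norm x))) * w x" for x
    define P where "P x = \<Lambda> x * s x * (\<xi> (ln (norm x)) * w x)\<^sup>2" for x
    define g where "g x = \<Lambda> x * ((x \<bullet> G x)\<^sup>2 + (w x)\<^sup>2)" for x
    have main: "\<tau>^3 * \<delta> / 2 * (LINT x|lborel. indicator A x * P x) \<le> (LINT x|lborel. indicator A x * (\<Lambda> x * (Q x)\<^sup>2))"
      unfolding A_def P_def Q_def \<Lambda>_def s_def weight_def annulus_def n_def
      by (rule carleman_cutoff[OF C2 \<xi>(1,2,5) _ _ \<beta>(1) \<delta> \<tau>2, of \<alpha> c]) (use \<xi>(10,11) in auto)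
    have sub: "T1 \<subseteq> A" "T2 \<subseteq> A" "S \<subseteq> A" "A \<subseteq> annulus (\<alpha> - 1) (\<beta> + 1)" "A \<subseteq> cball 0 1"
      "annulus (\<alpha> - 1) (\<alpha> + 2) \<subseteq> (annulus (\<alpha> - 1) (\<beta> + 1) :: 'a set)"
      "annulus (\<beta> - 2) (\<beta> + 1) \<subseteq> (annulus (\<alpha> - 1) (\<beta> + 1) :: 'a set)"
      unfolding T1_def T2_def S_def A_def using \<gamma> \<beta>(2)
      by (intro annulus_subset annulus_subset_cball; simp)+
    have A0: "A \<subseteq> -{0}" "0 \<notin> A" by (auto simp: A_def)
    have cw: "continuous_on UNIV (weight \<delta> \<tau>)" unfolding weight_def using \<delta> by (auto intro!: continuous_intros)
    have c\<Lambda>: "continuous_on A \<Lambda>" unfolding \<Lambda>_def using cw A0(2) by (rule radial_continuous_on)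
    note cont = c\<Lambda> C2_on_continuous[OF C2, THEN continuous_on_subset, OF A0(1)] radial_continuous_on[OF \<xi>(3) A0(2)]
      radial_continuous_on[OF \<xi>(4) A0(2)] radial_continuous_on[OF \<xi>(5) A0(2)]
    have cA: "continuous_on A P" "continuous_on A (\<lambda>x. \<Lambda> x * (Q x)\<^sup>2)" "continuous_on A g" "continuous_on A (\<lambda>x. (w x)\<^sup>2)"
      unfolding P_def Q_def g_def s_def using A0(2) by (auto intro!: continuous_intros cont)
    have comp: "compact A" "compact T1" "compact T2" "compact S"
      unfolding A_def T1_def T2_def S_def by (rule annulus_compact)+
    note ii = integrable_indicator_compact
    have int: "integrable lborel (\<lambda>x. indicator A x * P x)" "integrable lborel (\<lambda>x. indicator A x * (\<Lambda> x * (Q x)\<^sup>2))"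
      "integrable lborel (\<lambda>x. indicator T1 x * g x)" "integrable lborel (\<lambda>x. indicator T2 x * g x)"
      "integrable lborel (\<lambda>x. indicator S x * (w x)\<^sup>2)" "integrable lborel (\<lambda>x. indicator A x * \<Lambda> x)"
      using cA c\<Lambda> comp sub(1-3) by (auto intro!: ii intro: continuous_on_subset)
    have lnA: "\<alpha> \<le> ln (norm x)" "ln (norm x) \<le> \<beta>" if "x \<in> A" for x
      using that unfolding A_def mem_annulus by auto
    have s01: "0 \<le> s x" "s x \<le> 1" if "x \<in> annulus (\<alpha> - 1) (\<beta> + 1)" for x
    proof -
      have "ln (norm x) \<le> 0" using that \<beta>(2) unfolding mem_annulus by linarith
      then show "s x \<le> 1" using \<delta> unfolding s_def by (simp add: mult_nonneg_nonpos)
    qed (simp add: s_def)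
    have \<Lambda>0: "0 < \<Lambda> x" for x by (simp add: \<Lambda>_def weight_pos)
    \<comment> \<open>Derivatives of the cut-off live in the unit layers \<open>T1\<close> and
      \<open>T2\<close> only; there \<open>g\<close> collects the weighted squares of x \<bullet>
      \<nabla>w and w.\<close>
    have pw: "indicator A x * (\<Lambda> x * (Q x)\<^sup>2) \<le> 4 * C\<^sup>2 * (indicator A x * P x) + 4 * \<eta>\<^sup>2 * (indicator A x * \<Lambda> x)
        + B * (indicator T1 x * g x) + B * (indicator T2 x * g x)" for x
    proof (cases "x \<in> A")
      case True
      have L: "\<bar>(norm x)\<^sup>2 * tr (H x) + c * w x\<bar> \<le> C * s x * \<bar>w x\<bar> + \<eta>"
        using eq sub(4) True unfolding s_def by blast
      have s: "0 \<le> s x" "s x \<le> 1" using s01 sub(4) True by auto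
      note pt = cutoff_error_pointwise[where d="x \<bullet> G x" and n=n,
          OF \<xi>(6-9)[of "ln (norm x)"] s C L]
      have g: "0 \<le> g x" unfolding g_def using \<Lambda>0[of x] by (simp add: less_imp_le)
      show ?thesis
      proof (cases "x \<in> T1 \<union> T2")
        case False
        then have "\<alpha> + 1 \<le> ln (norm x)" "ln (norm x) \<le> \<beta> - 1"
          using True unfolding A_def T1_def T2_def by (auto simp: mem_annulus)
        then have "(Q x)\<^sup>2 \<le> 4 * C\<^sup>2 * (s x * (\<xi> (ln (norm x)) * w x)\<^sup>2) + 4 * \<eta>\<^sup>2"
          unfolding Q_def by (intro pt(2) \<xi>(13,14))
        then have "\<Lambda> x * (Q x)\<^sup>2 \<le> \<Lambda> x * (4 * C\<^sup>2 * (s x * (\<xi> (ln (norm x)) * w x)\<^sup>2) + 4 * \<eta>\<^sup>2)"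
          using \<Lambda>0 by (intro mult_left_mono) (auto simp: less_imp_le)
        also have "\<dots> = 4 * C\<^sup>2 * P x + 4 * \<eta>\<^sup>2 * \<Lambda> x" by (simp add: P_def algebra_simps)
        finally show ?thesis using True False by simp
      next
        case T: True
        have "\<Lambda> x * (Q x)\<^sup>2 \<le> \<Lambda> x * (4 * C\<^sup>2 * (s x * (\<xi> (ln (norm x)) * w x)\<^sup>2) + 4 * \<eta>\<^sup>2 + B * ((x \<bullet> G x)\<^sup>2 + (w x)\<^sup>2))"
          using \<Lambda>0 pt(1) unfolding Q_def B_def by (intro mult_left_mono) (auto simp: less_imp_le)
        also have "\<dots> = 4 * C\<^sup>2 * P x + 4 * \<eta>\<^sup>2 * \<Lambda> x + B * g x" by (simp add: P_def g_def algebra_simps)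
        also have "\<dots> \<le> 4 * C\<^sup>2 * P x + 4 * \<eta>\<^sup>2 * \<Lambda> x + B * (indicator T1 x * g x) + B * (indicator T2 x * g x)"
          using T g B by (auto split: split_indicator)
        finally show ?thesis using True by simp
      qed
    next
      case False
      then have "x \<notin> T1" "x \<notin> T2" using sub by auto
      then show ?thesis using False by simp
    qed
    have "(LINT x|lborel. indicator A x * (\<Lambda> x * (Q x)\<^sup>2)) \<le> (LINT x|lborel. 4 * C\<^sup>2 * (indicator A x * P x)
        + 4 * \<eta>\<^sup>2 * (indicator A x * \<Lambda> x) + B * (indicator T1 x * g x) + B * (indicator T2 x * g x))"
      by (intro integral_mono pw int Bochner_Integration.integrable_add integrable_mult_right)
    also have "\<dots> = 4 * C\<^sup>2 * (LINT x|lborel. indicator A x * P x) + 4 * \<eta>\<^sup>2 * (LINT x|lborel. indicator A x * \<Lambda> x)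
        + B * (LINT x|lborel. indicator T1 x * g x) + B * (LINT x|lborel. indicator T2 x * g x)"
      using int by simp
    finally have up: "(LINT x|lborel. indicator A x * (\<Lambda> x * (Q x)\<^sup>2)) \<le> 4 * C\<^sup>2 * (LINT x|lborel. indicator A x * P x)
        + 4 * \<eta>\<^sup>2 * (LINT x|lborel. indicator A x * \<Lambda> x)
        + B * (LINT x|lborel. indicator T1 x * g x) + B * (LINT x|lborel. indicator T2 x * g x)" .
    have \<Lambda>\<alpha>: "(LINT x|lborel. indicator A x * \<Lambda> x) \<le> weight \<delta> \<tau> \<alpha> * V"
      unfolding V_def
    proof (rule integral_indicator_le[OF int(6)])
      show "\<Lambda> x \<le> weight \<delta> \<tau> \<alpha>" if "x \<in> A" for x
        unfolding \<Lambda>_def using lnA[OF that] \<beta>(2) \<delta> \<tau>2 by (intro weight_antimono) auto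
    qed (use sub weight_pos in \<open>auto intro: less_imp_le\<close>)
    \<comment> \<open>One bound for both layers, used with a = \<alpha> and a = \<beta> - 1.
      \<open>C'\<close> is the share of the derivative and \<open>V\<close> that of \<open>w\<close>
      itself.\<close>
    have bnd: "(LINT x|lborel. indicator (annulus a (a + 1)) x * g x) \<le> weight \<delta> \<tau> a * ((C' + V) * m\<^sup>2)"
      if a: "a + 2 \<le> 0" "annulus (a - 1) (a + 2) \<subseteq> (annulus (\<alpha> - 1) (\<beta> + 1) :: 'a set)" "\<eta> \<le> m" "annulus a (a + 1) \<subseteq> A"
        and wm: "\<And>x. x \<in> annulus (a - 1) (a + 2) \<Longrightarrow> \<bar>w x\<bar> \<le> m" for a m
    proof -
      have m0: "0 \<le> m" using a \<eta> by simp
      have i: "integrable lborel (\<lambda>x. indicator (annulus a (a + 1)) x * (x \<bullet> G x)\<^sup>2)"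
        "integrable lborel (\<lambda>x. indicator (annulus a (a + 1)) x * (w x)\<^sup>2)"
        using C2_on_annulus_integrable[OF C2, of a "a+1" "\<lambda>_. 1"] by simp_all
      have ig: "integrable lborel (\<lambda>x. indicator (annulus a (a + 1)) x * g x)"
        by (intro ii annulus_compact continuous_on_subset[OF cA(3) a(4)])
      have "(LINT x|lborel. indicator (annulus a (a + 1)) x * g x)
        \<le> (LINT x|lborel. weight \<delta> \<tau> a * (indicator (annulus a (a + 1)) x * (x \<bullet> G x)\<^sup>2
             + indicator (annulus a (a + 1)) x * (w x)\<^sup>2))"
      proof (rule integral_mono[OF ig])
        fix x :: 'a
        show "indicator (annulus a (a + 1)) x * g x \<le> weight \<delta> \<tau> a * (indicator (annulus a (a + 1)) x * (x \<bullet> G x)\<^sup>2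
             + indicator (annulus a (a + 1)) x * (w x)\<^sup>2)"
        proof (cases "x \<in> annulus a (a + 1)")
          case True
          then have "a \<le> ln (norm x)" "ln (norm x) \<le> 0" using a(1) unfolding mem_annulus by linarith+
          then have "\<Lambda> x \<le> weight \<delta> \<tau> a" unfolding \<Lambda>_def by (rule weight_antimono) (use \<delta> \<tau>2 in auto)
          then show ?thesis using True unfolding g_def by (simp add: mult_right_mono)
        qed simp
      qed (use i in simp)
      also have "\<dots> = weight \<delta> \<tau> a * ((LINT x|lborel. indicator (annulus a (a + 1)) x * (x \<bullet> G x)\<^sup>2)
          + (LINT x|lborel. indicator (annulus a (a + 1)) x * (w x)\<^sup>2))" using i by simp
      also have "\<dots> \<le> weight \<delta> \<tau> a * (C' * m\<^sup>2 + m\<^sup>2 * V)"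
      proof (intro mult_left_mono add_mono)
        show "(LINT x|lborel. indicator (annulus a (a + 1)) x * (x \<bullet> G x)\<^sup>2) \<le> C' * m\<^sup>2"
        proof (rule rad[OF C2 a(1) \<eta>(1) a(3) wm], assumption)
          fix x :: 'a assume x: "x \<in> annulus (a - 1) (a + 2)"
          then have x': "x \<in> annulus (\<alpha> - 1) (\<beta> + 1)" using a(2) by blast
          have "C * s x * \<bar>w x\<bar> \<le> C * 1 * \<bar>w x\<bar>" using s01[OF x'] C by (intro mult_right_mono mult_left_mono) auto
          then show "\<bar>(norm x)\<^sup>2 * tr (H x) + c * w x\<bar> \<le> C * \<bar>w x\<bar> + \<eta>"
            using eq[OF x'] unfolding s_def by simp
        qed
        show "(LINT x|lborel. indicator (annulus a (a + 1)) x * (w x)\<^sup>2) \<le> m\<^sup>2 * V"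
          unfolding V_def
        proof (rule integral_indicator_le[OF i(2)])
          show "(w x)\<^sup>2 \<le> m\<^sup>2" if "x \<in> annulus a (a + 1)" for x
          proof -
            have "x \<in> annulus (a - 1) (a + 2)" using that annulus_subset[of "a - 1" a "a + 1" "a + 2"] by auto
            from wm[OF this] show ?thesis using power2_le_iff_abs_le[OF m0] by blast
          qed
        qed (use a in \<open>auto intro!: annulus_subset_cball\<close>)
      qed (simp add: weight_pos less_imp_le)
      also have "\<dots> = weight \<delta> \<tau> a * ((C' + V) * m\<^sup>2)" by (simp add: algebra_simps)
      finally show ?thesis .
    qed
    have b1: "(LINT x|lborel. indicator T1 x * g x) \<le> weight \<delta> \<tau> \<alpha> * ((C' + V) * m1\<^sup>2)"
      unfolding T1_def by (rule bnd) (use \<beta> \<gamma> \<eta> sub w1 in \<open>auto simp: T1_def\<close>)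
    have b2: "(LINT x|lborel. indicator T2 x * g x) \<le> weight \<delta> \<tau> (\<beta> - 1) * ((C' + V) * m2\<^sup>2)"
    proof -
      have e: "\<beta> - 1 - 1 = \<beta> - 2" "\<beta> - 1 + 2 = \<beta> + 1" "\<beta> - 1 + 1 = \<beta>" by simp_all
      show ?thesis unfolding T2_def
        by (rule bnd[of "\<beta> - 1" m2, unfolded e]) (use \<beta> \<gamma> \<eta> sub w2 in \<open>auto simp: T2_def\<close>)
    qed
    have "\<tau>^3 * \<delta> / 4 * (LINT x|lborel. indicator A x * P x) \<le> \<tau>^3 * \<delta> / 2 * (LINT x|lborel. indicator A x * P x)
        - 4 * C\<^sup>2 * (LINT x|lborel. indicator A x * P x)"
    proof -
      have "16 * C\<^sup>2 / \<delta> \<le> \<tau>" using \<tau> by simp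
      also have "\<tau> \<le> \<tau>^3" using \<tau>2 by (intro self_le_power) auto
      finally have "4 * C\<^sup>2 \<le> \<tau>^3 * \<delta> / 4" using \<delta> by (simp add: divide_le_eq)
      moreover have "0 \<le> (LINT x|lborel. indicator A x * P x)"
        using s01 sub(4) \<Lambda>0
        by (intro integral_nonneg_AE AE_I2) (auto simp: P_def less_imp_le split: split_indicator)
      ultimately have "4 * C\<^sup>2 * (LINT x|lborel. indicator A x * P x) \<le> \<tau>^3 * \<delta> / 4 * (LINT x|lborel. indicator A x * P x)"
        by (rule mult_right_mono)
      then show ?thesis by (simp add: mult_ac)
    qed
    also have "\<dots> \<le> 4 * \<eta>\<^sup>2 * (LINT x|lborel. indicator A x * \<Lambda> x)
        + B * (LINT x|lborel. indicator T1 x * g x) + B * (LINT x|lborel. indicator T2 x * g x)"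
      using main up by linarith
    also have "\<dots> \<le> 4 * \<eta>\<^sup>2 * (weight \<delta> \<tau> \<alpha> * V) + B * (weight \<delta> \<tau> \<alpha> * ((C' + V) * m1\<^sup>2))
        + B * (weight \<delta> \<tau> (\<beta> - 1) * ((C' + V) * m2\<^sup>2))"
      by (intro add_mono mult_left_mono \<Lambda>\<alpha> b1 b2) (use B in auto)
    also have "\<dots> \<le> D * (weight \<delta> \<tau> \<alpha> * (\<eta>\<^sup>2 + m1\<^sup>2) + weight \<delta> \<tau> (\<beta> - 1) * m2\<^sup>2)"
    proof -
      have "0 \<le> V * (weight \<delta> \<tau> \<alpha> * m1\<^sup>2 + weight \<delta> \<tau> (\<beta> - 1) * m2\<^sup>2)" "0 \<le> B * (C' + V) * (weight \<delta> \<tau> \<alpha> * \<eta>\<^sup>2)"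
        using V B C' by (auto simp: weight_pos less_imp_le intro!: mult_nonneg_nonneg add_nonneg_nonneg)
      then show ?thesis unfolding D_def by (simp add: algebra_simps)
    qed
    finally have fin: "\<tau>^3 * \<delta> / 4 * (LINT x|lborel. indicator A x * P x)
       \<le> D * (weight \<delta> \<tau> \<alpha> * (\<eta>\<^sup>2 + m1\<^sup>2) + weight \<delta> \<tau> (\<beta> - 1) * m2\<^sup>2)" .
    \<comment> \<open>On \<open>S\<close> the cut-off equals 1, |x|^\<delta> is at least exp
      (\<delta> \<gamma>), and the weight is at least its value at the outer end \<beta> -
      1.\<close>
    have "exp (\<delta> * \<gamma>) * weight \<delta> \<tau> (\<beta> - 1) * (LINT x|lborel. indicator S x * (w x)\<^sup>2)
       = (LINT x|lborel. exp (\<delta> * \<gamma>) * weight \<delta> \<tau> (\<beta> - 1) * (indicator S x * (w x)\<^sup>2))" by simp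
    also have "\<dots> \<le> (LINT x|lborel. indicator A x * P x)"
    proof (rule integral_mono)
      show "integrable lborel (\<lambda>x. exp (\<delta> * \<gamma>) * weight \<delta> \<tau> (\<beta> - 1) * (indicator S x * (w x)\<^sup>2))" using int by simp
      fix x
      show "exp (\<delta> * \<gamma>) * weight \<delta> \<tau> (\<beta> - 1) * (indicator S x * (w x)\<^sup>2) \<le> indicator A x * P x"
      proof (cases "x \<in> S")
        case True
        then have xA: "x \<in> A" using sub by auto
        have l: "\<gamma> \<le> ln (norm x)" "ln (norm x) \<le> \<beta> - 1" using True unfolding S_def mem_annulus by auto
        have x1: "\<xi> (ln (norm x)) = 1" using l \<gamma> by (intro \<xi>(12)) auto
        have "exp (\<delta> * \<gamma>) * weight \<delta> \<tau> (\<beta> - 1) \<le> s x * \<Lambda> x"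
        proof (rule mult_mono)
          show "weight \<delta> \<tau> (\<beta> - 1) \<le> \<Lambda> x"
            unfolding \<Lambda>_def by (rule weight_antimono) (use l \<delta> \<tau>2 \<beta> in linarith)+
        qed (use l \<delta> in \<open>auto simp: s_def weight_pos less_imp_le\<close>)
        then have "exp (\<delta> * \<gamma>) * weight \<delta> \<tau> (\<beta> - 1) * (w x)\<^sup>2 \<le> s x * \<Lambda> x * (w x)\<^sup>2"
          by (rule mult_right_mono) simp
        then show ?thesis using True xA x1 by (simp add: P_def mult_ac)
      next
        case False
        then show ?thesis using s01(1) sub(4) \<Lambda>0[of x]
          by (auto simp: P_def less_imp_le split: split_indicator)
      qed
    qed (use int in auto)
    finally have "exp (\<delta> * \<gamma>) * weight \<delta> \<tau> (\<beta> - 1) * (LINT x|lborel. indicator S x * (w x)\<^sup>2)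
       \<le> (LINT x|lborel. indicator A x * P x)" .
    then have "\<tau>^3 * \<delta> / 4 * (exp (\<delta> * \<gamma>) * weight \<delta> \<tau> (\<beta> - 1) * (LINT x|lborel. indicator S x * (w x)\<^sup>2))
      \<le> \<tau>^3 * \<delta> / 4 * (LINT x|lborel. indicator A x * P x)"
      using \<tau>2 \<delta> by (intro mult_left_mono) auto
    with fin show "\<tau>^3 * \<delta> / 4 * (exp (\<delta> * \<gamma>) * weight \<delta> \<tau> (\<beta> - 1) *
          (LINT x|lborel. indicator (annulus \<gamma> (\<beta> - 1)) x * (w x)\<^sup>2))
        \<le> D * (weight \<delta> \<tau> \<alpha> * (\<eta>\<^sup>2 + m1\<^sup>2) + weight \<delta> \<tau> (\<beta> - 1) * m2\<^sup>2)"
      unfolding S_def by linarith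
  qed
qed

section \<open>From the Carleman estimate to vanishing near the centre\<close>

lemma vanishing_order_bound:
  fixes v :: "'a::euclidean_space \<Rightarrow> real"
  assumes "v \<in> O[at 0](\<lambda>x. norm x ^ k)"
  obtains D r where "0 \<le> D" "0 < r" "\<And>x. x \<noteq> 0 \<Longrightarrow> norm x < r \<Longrightarrow> \<bar>v x\<bar> \<le> D * norm x ^ k"
proof -
  obtain D where D: "0 < D" "eventually (\<lambda>x. norm (v x) \<le> D * norm (norm x ^ k)) (at 0)"
    using landau_o.bigE[OF assms] by blast
  then obtain r where "0 < r" "\<And>x. x \<noteq> 0 \<Longrightarrow> dist x 0 < r \<Longrightarrow> norm (v x) \<le> D * norm (norm x ^ k)"
    unfolding eventually_at by auto
  then show ?thesis using D(1) by (intro that[of D r]) auto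
qed

lemma integral_square_eq_0_imp:
  fixes v :: "'a::euclidean_space \<Rightarrow> real"
  assumes "compact K" "continuous_on K v" "open U" "U \<subseteq> K" "x \<in> U"
    and I: "(LINT x|lborel. indicator K x * (v x)\<^sup>2) \<le> 0"
  shows "v x = 0"
proof (rule ccontr)
  assume nz: "v x \<noteq> 0"
  have "isCont v x" using assms(2-5) continuous_on_interior interior_maximal by blast
  then have "eventually (\<lambda>y. dist (v y) (v x) < \<bar>v x\<bar> / 2) (nhds x)"
    using nz tendstoD[of v "v x" "nhds x" "\<bar>v x\<bar> / 2"] by (simp add: continuous_at tendsto_at_iff_tendsto_nhds)
  then obtain d1 where d1: "0 < d1" "\<And>y. dist y x < d1 \<Longrightarrow> dist (v y) (v x) < \<bar>v x\<bar> / 2"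
    unfolding eventually_nhds_metric by blast
  obtain d2 where d2: "0 < d2" "ball x d2 \<subseteq> U" using assms(3,5) open_contains_ball by blast
  define d where "d = min d1 d2"
  have d: "0 < d" "ball x d \<subseteq> K" using d1 d2 assms(4) by (auto simp: d_def)
  have lo: "(\<bar>v x\<bar> / 2)\<^sup>2 \<le> (v y)\<^sup>2" if "y \<in> ball x d" for y
  proof -
    have "dist (v y) (v x) < \<bar>v x\<bar> / 2" using that by (intro d1) (auto simp: d_def dist_commute)
    then have "\<bar>v x\<bar> / 2 \<le> \<bar>v y\<bar>" unfolding dist_real_def by linarith
    then show ?thesis using power_mono[of "\<bar>v x\<bar> / 2" "\<bar>v y\<bar>" 2] by simp
  qed
  have "0 < (\<bar>v x\<bar> / 2)\<^sup>2 * measure lborel (ball x d)"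
    using nz d content_ball_pos[of d x] by simp
  also have "\<dots> = (LINT y|lborel. (\<bar>v x\<bar> / 2)\<^sup>2 * indicator (ball x d) y)" by simp
  also have "\<dots> \<le> (LINT y|lborel. indicator K y * (v y)\<^sup>2)"
  proof (rule integral_mono)
    show "integrable lborel (\<lambda>y. indicator K y * (v y)\<^sup>2)"
      by (intro integrable_indicator_compact assms(1) continuous_on_power assms(2))
    show "integrable lborel (\<lambda>y. (\<bar>v x\<bar> / 2)\<^sup>2 * indicator (ball x d) y)"
      by (intro integrable_mult_right integrable_real_indicator emeasure_bounded_finite) auto
    fix y show "(\<bar>v x\<bar> / 2)\<^sup>2 * indicator (ball x d) y \<le> indicator K y * (v y)\<^sup>2"
      using lo[of y] d(2) by (auto split: split_indicator)
  qed
  finally show False using I by simp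
qed

text \<open>The hypothesis \<open>approx\<close> says that \<open>v\<close> is a generalized solution of
  \<open>| |x|\<^sup>2 \<Delta>v + c v | \<le> C |x|\<^sup>\<delta> |v|\<close>; mollification provides the approximations.\<close>

lemma strong_unique_continuation:
  fixes v :: "'a::euclidean_space \<Rightarrow> real"
  assumes C: "0 \<le> C" and \<delta>: "0 < \<delta>" "\<delta> \<le> 1" and \<beta>: "exp (\<delta> * \<beta>) \<le> 1/2" "\<beta> + 1 \<le> 0"
    and cont: "\<And>a. continuous_on (annulus a (\<beta> + 1)) v"
    and vanish: "\<And>k::nat. v \<in> O[at 0](\<lambda>x. norm x ^ k)"
    and approx: "\<And>a \<eta>. 0 < \<eta> \<Longrightarrow> \<exists>w G H. C2_on (-{0}) w G H \<and> (\<forall>x\<in>annulus a (\<beta> + 1). \<bar>w x - v x\<bar> \<le> \<eta> \<and>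
        \<bar>(norm x)\<^sup>2 * tr (H x) + c * w x\<bar> \<le> C * exp (\<delta> * ln (norm x)) * \<bar>w x\<bar> + \<eta>)"
    and x: "x \<noteq> 0" "norm x < exp (\<beta> - 1)"
  shows "v x = 0"
proof -
  obtain D \<tau>0 :: real where D: "0 \<le> D" and \<tau>0: "2 \<le> \<tau>0"
    and main: "\<And>(w::'a::euclidean_space \<Rightarrow> real) G H \<alpha> \<beta> \<gamma> \<tau> \<eta> m1 m2.
      C2_on (-{0}) w G H \<Longrightarrow> exp (\<delta> * \<beta>) \<le> 1/2 \<Longrightarrow> \<beta> + 1 \<le> 0 \<Longrightarrow> \<alpha> + 1 \<le> \<gamma> \<Longrightarrow> \<gamma> \<le> \<beta> - 1 \<Longrightarrow>
      \<tau>0 \<le> \<tau> \<Longrightarrow> 0 \<le> \<eta> \<Longrightarrow> \<eta> \<le> m1 \<Longrightarrow> \<eta> \<le> m2 \<Longrightarrow>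
      (\<And>x. x \<in> annulus (\<alpha> - 1) (\<alpha> + 2) \<Longrightarrow> \<bar>w x\<bar> \<le> m1) \<Longrightarrow>
      (\<And>x. x \<in> annulus (\<beta> - 2) (\<beta> + 1) \<Longrightarrow> \<bar>w x\<bar> \<le> m2) \<Longrightarrow>
      (\<And>x. x \<in> annulus (\<alpha> - 1) (\<beta> + 1) \<Longrightarrow>
         \<bar>(norm x)\<^sup>2 * tr (H x) + c * w x\<bar> \<le> C * exp (\<delta> * ln (norm x)) * \<bar>w x\<bar> + \<eta>) \<Longrightarrow>
      \<tau>^3 * \<delta> / 4 * (exp (\<delta> * \<gamma>) * weight \<delta> \<tau> (\<beta> - 1) *
          (LINT x|lborel. indicator (annulus \<gamma> (\<beta> - 1)) x * (w x)\<^sup>2))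
        \<le> D * (weight \<delta> \<tau> \<alpha> * (\<eta>\<^sup>2 + m1\<^sup>2) + weight \<delta> \<tau> (\<beta> - 1) * m2\<^sup>2)"
    using carleman_annulus_estimate[OF C \<delta>, of c thesis] by blast
  \<comment> \<open>Any value below ln |x| would do; it puts \<open>x\<close> into the interior of
    the annulus \<open>S\<close>.\<close>
  define \<gamma> where "\<gamma> = ln (norm x) - 1"
  have lx: "ln (norm x) < \<beta> - 1" using x by (metis exp_less_cancel_iff exp_ln zero_less_norm_iff)
  have \<gamma>: "\<gamma> \<le> \<beta> - 1" using lx by (simp add: \<gamma>_def)
  define S where "S = (annulus \<gamma> (\<beta> - 1) :: 'a set)"
  define V where "V = measure lborel (cball 0 1 :: 'a set)"
  define I where "I = (LINT x|lborel. indicator S x * (v x)\<^sup>2)"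
  have cS: "continuous_on S v"
    unfolding S_def by (rule continuous_on_subset[OF cont[of \<gamma>] annulus_subset]) auto
  have iv: "integrable lborel (\<lambda>x. indicator S x * (v x)\<^sup>2)"
    by (intro integrable_indicator_compact continuous_on_power cS) (simp add: S_def annulus_compact)
  have "bounded (v ` annulus (\<beta> - 2) (\<beta> + 1))"
    by (intro compact_imp_bounded compact_continuous_image cont annulus_compact)
  then obtain m0 where m0: "\<And>y. y \<in> annulus (\<beta> - 2) (\<beta> + 1) \<Longrightarrow> \<bar>v y\<bar> \<le> m0"
    unfolding bounded_iff by auto
  \<comment> \<open>The summand 1 leaves room for the approximants, which differ from
    \<open>v\<close> by at most \<eta> \<le> 1, and ensures \<eta> \<le> m2.\<close>
  define m2 where "m2 = \<bar>m0\<bar> + 1"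
  \<comment> \<open>The annulus estimate applies to a smooth approximant \<open>w\<close>. Both
    sides are rewritten in terms of \<open>v\<close>, at the cost of \<open>\<eta>\<close>, so that
    \<open>w\<close>, which depends on \<open>\<eta>\<close>, disappears before the limit.\<close>
  have step1: "\<tau>^3 * \<delta> / 4 * (exp (\<delta> * \<gamma>) * weight \<delta> \<tau> (\<beta> - 1) * (I / 2 - \<eta>\<^sup>2 * V))
      \<le> D * (weight \<delta> \<tau> \<alpha> * (\<eta>\<^sup>2 + (m + \<eta>)\<^sup>2) + weight \<delta> \<tau> (\<beta> - 1) * m2\<^sup>2)"
    if \<tau>: "\<tau>0 \<le> \<tau>" and \<alpha>: "\<alpha> + 1 \<le> \<gamma>" and m: "0 \<le> m" "\<And>y. y \<in> annulus (\<alpha> - 1) (\<alpha> + 2) \<Longrightarrow> \<bar>v y\<bar> \<le> m"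
      and \<eta>: "0 < \<eta>" "\<eta> \<le> 1" for \<tau> \<alpha> m \<eta>
  proof -
    obtain w G H where C2: "C2_on (-{0}) w G H"
      and wv: "\<And>y. y \<in> annulus (\<alpha> - 1) (\<beta> + 1) \<Longrightarrow> \<bar>w y - v y\<bar> \<le> \<eta>"
      and eq: "\<And>y. y \<in> annulus (\<alpha> - 1) (\<beta> + 1) \<Longrightarrow>
        \<bar>(norm y)\<^sup>2 * tr (H y) + c * w y\<bar> \<le> C * exp (\<delta> * ln (norm y)) * \<bar>w y\<bar> + \<eta>"
      using approx[OF \<eta>(1), of "\<alpha> - 1"] by blast
    have sub: "annulus (\<alpha> - 1) (\<alpha> + 2) \<subseteq> (annulus (\<alpha> - 1) (\<beta> + 1) :: 'a set)"
      "annulus (\<beta> - 2) (\<beta> + 1) \<subseteq> (annulus (\<alpha> - 1) (\<beta> + 1) :: 'a set)" "S \<subseteq> annulus (\<alpha> - 1) (\<beta> + 1)"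
      unfolding S_def using \<alpha> \<gamma> by (intro annulus_subset; simp)+
    have est: "\<tau>^3 * \<delta> / 4 * (exp (\<delta> * \<gamma>) * weight \<delta> \<tau> (\<beta> - 1) * (LINT x|lborel. indicator S x * (w x)\<^sup>2))
        \<le> D * (weight \<delta> \<tau> \<alpha> * (\<eta>\<^sup>2 + (m + \<eta>)\<^sup>2) + weight \<delta> \<tau> (\<beta> - 1) * m2\<^sup>2)"
      unfolding S_def
    proof (rule main[OF C2 \<beta> \<alpha> \<gamma> \<tau> _ _ _ _ _ eq])
      show "\<bar>w y\<bar> \<le> m + \<eta>" if "y \<in> annulus (\<alpha> - 1) (\<alpha> + 2)" for y
        using wv[of y] m(2)[OF that] sub(1) that by fastforce
      show "\<bar>w y\<bar> \<le> m2" if y: "y \<in> annulus (\<beta> - 2) (\<beta> + 1)" for y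
      proof -
        have "\<bar>w y - v y\<bar> \<le> \<eta>" using sub(2) y by (intro wv) blast
        then show ?thesis using m0[OF y] \<eta> unfolding m2_def by linarith
      qed
    qed (use \<eta> m in \<open>auto simp: m2_def\<close>)
    have iw: "integrable lborel (\<lambda>x. indicator S x * (w x)\<^sup>2)"
      unfolding S_def using C2_on_annulus_integrable(2)[OF C2, of \<gamma> "\<beta> - 1" "\<lambda>_. 1"] by simp
    have i1: "integrable lborel (\<lambda>x. indicator S x * (1::real))"
      unfolding S_def by (intro integrable_indicator_compact annulus_compact) auto
    have "I / 2 - \<eta>\<^sup>2 * V \<le> I / 2 - \<eta>\<^sup>2 * (LINT x|lborel. indicator S x * 1)"
    proof -
      have "(LINT x|lborel. indicator S x * 1) \<le> 1 * V"
        unfolding V_def by (rule integral_indicator_le[OF i1]) (use \<beta> in \<open>auto simp: S_def intro!: annulus_subset_cball\<close>)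
      then have "\<eta>\<^sup>2 * (LINT x|lborel. indicator S x * 1) \<le> \<eta>\<^sup>2 * V" by (intro mult_left_mono) auto
      then show ?thesis by simp
    qed
    also have "\<dots> = (LINT x|lborel. 1/2 * (indicator S x * (v x)\<^sup>2) - \<eta>\<^sup>2 * (indicator S x * 1))"
      using iv i1 unfolding I_def by (subst Bochner_Integration.integral_diff) auto
    also have "\<dots> \<le> (LINT x|lborel. indicator S x * (w x)\<^sup>2)"
    proof (rule integral_mono)
      fix y
      show "1/2 * (indicator S y * (v y)\<^sup>2) - \<eta>\<^sup>2 * (indicator S y * 1) \<le> indicator S y * (w y)\<^sup>2"
      proof (cases "y \<in> S")
        case True
        then have "\<bar>w y - v y\<bar> \<le> \<eta>" using sub(3) by (intro wv) blast
        then have "(w y - v y)\<^sup>2 \<le> \<eta>\<^sup>2" using power_mono[of "\<bar>w y - v y\<bar>" \<eta> 2] by simp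
        \<comment> \<open>The identity w^2 - v^2/2 + (w - v)^2 = (2 w - v)^2 / 2 gives w^2 \<ge>
          v^2/2 - \<eta>^2.\<close>
        moreover have "0 \<le> (2 * w y - v y)\<^sup>2" by simp
        ultimately have "(v y)\<^sup>2 / 2 - \<eta>\<^sup>2 \<le> (w y)\<^sup>2" by (simp add: power2_eq_square algebra_simps)
        then show ?thesis using True by simp
      qed simp
    qed (use iv i1 iw in auto)
    finally have "exp (\<delta> * \<gamma>) * weight \<delta> \<tau> (\<beta> - 1) * (I / 2 - \<eta>\<^sup>2 * V)
       \<le> exp (\<delta> * \<gamma>) * weight \<delta> \<tau> (\<beta> - 1) * (LINT x|lborel. indicator S x * (w x)\<^sup>2)"
      by (intro mult_left_mono) (auto simp: weight_pos less_imp_le)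
    then have "\<tau>^3 * \<delta> / 4 * (exp (\<delta> * \<gamma>) * weight \<delta> \<tau> (\<beta> - 1) * (I / 2 - \<eta>\<^sup>2 * V))
       \<le> \<tau>^3 * \<delta> / 4 * (exp (\<delta> * \<gamma>) * weight \<delta> \<tau> (\<beta> - 1) * (LINT x|lborel. indicator S x * (w x)\<^sup>2))"
      by (rule mult_left_mono) (use \<tau> \<tau>0 \<delta> in auto)
    with est show ?thesis by linarith
  qed
  \<comment> \<open>\<eta> tends to 0 while \<alpha> and \<tau> stay fixed, so the large weight at
    \<alpha> does no harm to the error.\<close>
  have step2: "\<tau>^3 * \<delta> / 4 * (exp (\<delta> * \<gamma>) * weight \<delta> \<tau> (\<beta> - 1) * (I / 2))
      \<le> D * (weight \<delta> \<tau> \<alpha> * m\<^sup>2 + weight \<delta> \<tau> (\<beta> - 1) * m2\<^sup>2)"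
    if \<tau>: "\<tau>0 \<le> \<tau>" and \<alpha>: "\<alpha> + 1 \<le> \<gamma>" and m: "0 \<le> m" "\<And>y. y \<in> annulus (\<alpha> - 1) (\<alpha> + 2) \<Longrightarrow> \<bar>v y\<bar> \<le> m" for \<tau> \<alpha> m
  proof (rule tendsto_le[of "at_right (0::real)"])
    show "((\<lambda>\<eta>. \<tau>^3 * \<delta> / 4 * (exp (\<delta> * \<gamma>) * weight \<delta> \<tau> (\<beta> - 1) * (I / 2 - \<eta>\<^sup>2 * V)))
      \<longlongrightarrow> \<tau>^3 * \<delta> / 4 * (exp (\<delta> * \<gamma>) * weight \<delta> \<tau> (\<beta> - 1) * (I / 2))) (at_right 0)"
      by (auto intro!: tendsto_eq_intros)
    show "((\<lambda>\<eta>. D * (weight \<delta> \<tau> \<alpha> * (\<eta>\<^sup>2 + (m + \<eta>)\<^sup>2) + weight \<delta> \<tau> (\<beta> - 1) * m2\<^sup>2))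
      \<longlongrightarrow> D * (weight \<delta> \<tau> \<alpha> * m\<^sup>2 + weight \<delta> \<tau> (\<beta> - 1) * m2\<^sup>2)) (at_right 0)"
      by (auto intro!: tendsto_eq_intros)
    show "eventually (\<lambda>\<eta>. \<tau>^3 * \<delta> / 4 * (exp (\<delta> * \<gamma>) * weight \<delta> \<tau> (\<beta> - 1) * (I / 2 - \<eta>\<^sup>2 * V))
       \<le> D * (weight \<delta> \<tau> \<alpha> * (\<eta>\<^sup>2 + (m + \<eta>)\<^sup>2) + weight \<delta> \<tau> (\<beta> - 1) * m2\<^sup>2)) (at_right 0)"
      unfolding eventually_at_right_field using step1[OF \<tau> \<alpha> m]
      by (intro exI[of _ 1]) auto
  qed simp
  have step3: "\<tau>^3 * (\<delta> * exp (\<delta> * \<gamma>) * I / 8) \<le> D * m2\<^sup>2" if \<tau>: "\<tau>0 \<le> \<tau>" for \<tau>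
  proof -
    \<comment> \<open>The order of vanishing must beat the weight, which grows like exp (- (2 \<tau>
      + 2) \<alpha>) as \<alpha> tends to - \<infinity>, while the square of the bound on
      \<open>v\<close> is of order exp (2 k \<alpha>). As \<tau> is still to tend to infinity, every
      finite order will be called upon.\<close>
    obtain k :: nat where k: "\<tau> + 2 \<le> real k" using real_arch_simple by blast
    obtain D1 r where D1: "0 \<le> D1" "0 < r" "\<And>y. y \<noteq> 0 \<Longrightarrow> norm y < r \<Longrightarrow> \<bar>v y\<bar> \<le> D1 * norm y ^ k"
      using vanishing_order_bound[OF vanish[of k]] by blast
    define p where "p = 2 * real k - 2 * \<tau> - 2"
    have p: "0 < p" using k \<tau> \<tau>0 by (simp add: p_def)
    \<comment> \<open>\<open>exp (2 * \<tau> / \<delta>)\<close> bounds the part of the weight due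
      to exp (\<delta> \<alpha>) / \<delta> for \<alpha> \<le> 0; \<open>exp (2 * real k)\<close>
      comes from the outer end \<alpha> + 2 of the annulus on which \<open>v\<close> is
      estimated.\<close>
    define K where "K = exp (2 * \<tau> / \<delta>) * (D1 * exp (2 * real k))\<^sup>2"
    have bound: "weight \<delta> \<tau> \<alpha> * (D1 * exp (real k * (\<alpha> + 2)))\<^sup>2 \<le> K * exp (p * \<alpha>)" if "\<alpha> \<le> 0" for \<alpha>
    proof -
      have "exp (\<delta> * \<alpha>) / \<delta> \<le> 1 / \<delta>" using that \<delta> by (intro divide_right_mono) (auto simp: mult_nonneg_nonpos)
      then have "\<tau> * (exp (\<delta> * \<alpha>) / \<delta>) \<le> \<tau> * (1 / \<delta>)" using \<tau> \<tau>0 by (intro mult_left_mono) auto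
      moreover have "- 2 * \<tau> * (\<alpha> - exp (\<delta> * \<alpha>) / \<delta>) - 2 * \<alpha> = 2 * (\<tau> * (exp (\<delta> * \<alpha>) / \<delta>)) - 2 * \<tau> * \<alpha> - 2 * \<alpha>"
        by (simp add: right_diff_distrib)
      ultimately have "weight \<delta> \<tau> \<alpha> \<le> exp (2 * \<tau> / \<delta> - 2 * \<tau> * \<alpha> - 2 * \<alpha>)"
        unfolding weight_def by simp
      then have "weight \<delta> \<tau> \<alpha> * (D1 * exp (real k * (\<alpha> + 2)))\<^sup>2
         \<le> exp (2 * \<tau> / \<delta> - 2 * \<tau> * \<alpha> - 2 * \<alpha>) * (D1 * exp (real k * (\<alpha> + 2)))\<^sup>2"
        by (rule mult_right_mono) simp
      also have "\<dots> = K * exp (p * \<alpha>)"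
        unfolding K_def p_def power_mult_distrib exp_double[symmetric]
        by (simp add: algebra_simps flip: exp_add)
      finally show ?thesis .
    qed
    have "\<tau>^3 * \<delta> / 4 * (exp (\<delta> * \<gamma>) * weight \<delta> \<tau> (\<beta> - 1) * (I / 2)) \<le> D * (K * 0 + weight \<delta> \<tau> (\<beta> - 1) * m2\<^sup>2)"
    proof (rule tendsto_lowerbound[of _ _ at_bot])
      have "filterlim (\<lambda>\<alpha>. p * \<alpha>) at_bot at_bot"
        using p by (intro filterlim_tendsto_pos_mult_at_bot[OF tendsto_const] filterlim_ident)
      then have "((\<lambda>\<alpha>. exp (p * \<alpha>)) \<longlongrightarrow> 0) at_bot" by (rule filterlim_compose[OF exp_at_bot])
      then show "((\<lambda>\<alpha>. D * (K * exp (p * \<alpha>) + weight \<delta> \<tau> (\<beta> - 1) * m2\<^sup>2))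
          \<longlongrightarrow> D * (K * 0 + weight \<delta> \<tau> (\<beta> - 1) * m2\<^sup>2)) at_bot"
        by (intro tendsto_intros)
      show "eventually (\<lambda>\<alpha>. \<tau>^3 * \<delta> / 4 * (exp (\<delta> * \<gamma>) * weight \<delta> \<tau> (\<beta> - 1) * (I / 2))
          \<le> D * (K * exp (p * \<alpha>) + weight \<delta> \<tau> (\<beta> - 1) * m2\<^sup>2)) at_bot"
        unfolding eventually_at_bot_linorder
      proof (intro exI allI impI)
        fix \<alpha> assume "\<alpha> \<le> min (min 0 (\<gamma> - 1)) (ln r - 3)"
        then have \<alpha>: "\<alpha> \<le> 0" "\<alpha> + 1 \<le> \<gamma>" "\<alpha> + 2 < ln r" by auto
        have "\<bar>v y\<bar> \<le> D1 * exp (real k * (\<alpha> + 2))" if y: "y \<in> annulus (\<alpha> - 1) (\<alpha> + 2)" for y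
        proof -
          have n: "norm y \<le> exp (\<alpha> + 2)" "y \<noteq> 0" using y by (auto simp: annulus_def not_le)
          have "exp (\<alpha> + 2) < exp (ln r)" using \<alpha>(3) by (subst exp_less_cancel_iff)
          then have "norm y < r" using n D1(2) by simp
          then have "\<bar>v y\<bar> \<le> D1 * norm y ^ k" using D1(3) n by blast
          also have "\<dots> \<le> D1 * exp (\<alpha> + 2) ^ k" using n D1 by (intro mult_left_mono power_mono) auto
          finally show ?thesis by (simp add: exp_of_nat_mult)
        qed
        then have "\<tau>^3 * \<delta> / 4 * (exp (\<delta> * \<gamma>) * weight \<delta> \<tau> (\<beta> - 1) * (I / 2))
           \<le> D * (weight \<delta> \<tau> \<alpha> * (D1 * exp (real k * (\<alpha> + 2)))\<^sup>2 + weight \<delta> \<tau> (\<beta> - 1) * m2\<^sup>2)"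
          using step2[OF \<tau> \<alpha>(2), of "D1 * exp (real k * (\<alpha> + 2))"] D1 by simp
        also have "\<dots> \<le> D * (K * exp (p * \<alpha>) + weight \<delta> \<tau> (\<beta> - 1) * m2\<^sup>2)"
          by (intro mult_left_mono add_right_mono bound \<alpha> D)
        finally show "\<tau>^3 * \<delta> / 4 * (exp (\<delta> * \<gamma>) * weight \<delta> \<tau> (\<beta> - 1) * (I / 2))
          \<le> D * (K * exp (p * \<alpha>) + weight \<delta> \<tau> (\<beta> - 1) * m2\<^sup>2)" .
      qed
    qed simp
    \<comment> \<open>The outer weight stands on both sides and cancels. What remains depends on
      \<tau> only through \<tau>^3.\<close>
    then have "weight \<delta> \<tau> (\<beta> - 1) * (\<tau>^3 * (\<delta> * exp (\<delta> * \<gamma>) * I / 8)) \<le> weight \<delta> \<tau> (\<beta> - 1) * (D * m2\<^sup>2)"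
      by (simp add: algebra_simps)
    then show ?thesis using weight_pos[of \<delta> \<tau> "\<beta> - 1"] by simp
  qed
  have "I \<le> 0"
  proof (rule ccontr)
    assume "\<not> I \<le> 0"
    define q where "q = \<delta> * exp (\<delta> * \<gamma>) * I / 8"
    have q: "0 < q" using \<open>\<not> I \<le> 0\<close> \<delta> by (simp add: q_def)
    \<comment> \<open>This is the limit \<tau> to infinity in finite form: any \<tau> beyond D m2^2
      / q contradicts \<open>step3\<close>.\<close>
    define \<tau> where "\<tau> = max \<tau>0 (D * m2\<^sup>2 / q + 1)"
    have "D * m2\<^sup>2 / q < \<tau>" by (simp add: \<tau>_def)
    also have "\<tau> \<le> \<tau>^3" using \<tau>0 by (intro self_le_power) (auto simp: \<tau>_def)
    finally have "D * m2\<^sup>2 < \<tau>^3 * q" using q by (simp add: divide_less_eq)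
    moreover have "\<tau>^3 * q \<le> D * m2\<^sup>2" unfolding q_def by (rule step3) (simp add: \<tau>_def)
    ultimately show False by simp
  qed
  then show ?thesis
    unfolding I_def
  proof (rule integral_square_eq_0_imp[rotated -1])
    show "compact S" unfolding S_def by (rule annulus_compact)
    show "open {y::'a. exp \<gamma> < norm y \<and> norm y < exp (\<beta> - 1)}"
      by (intro open_Collect_conj open_Collect_less continuous_intros)
    have "exp \<gamma> < exp (ln (norm x))" by (subst exp_less_cancel_iff) (simp add: \<gamma>_def)
    then show "x \<in> {y. exp \<gamma> < norm y \<and> norm y < exp (\<beta> - 1)}" using x by simp
  qed (auto simp: cS, auto simp: S_def annulus_def)
qed

section \<open>Mollification\<close>

definition kernel :: "real \<Rightarrow> ('a::euclidean_space \<Rightarrow> 'b::euclidean_space) \<Rightarrow> bool" where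
  "kernel R k \<longleftrightarrow> continuous_on UNIV k \<and> (\<forall>z. R \<le> norm z \<longrightarrow> k z = 0)"

definition convolve :: "('a::euclidean_space \<Rightarrow> real) \<Rightarrow> ('a \<Rightarrow> 'b::euclidean_space) \<Rightarrow> 'a \<Rightarrow> 'b" where
  "convolve q k x = (LINT y|lborel. q y *\<^sub>R k (x - y))"

text \<open>The kernel is uniformly continuous on the ball of radius R + 1. If one of two points at
  distance below 1 lies outside that ball, both have norm at least R and the kernel is zero at
  both.\<close>

lemma kernel_uniformly_continuous:
  fixes k :: "'a::euclidean_space \<Rightarrow> 'b::euclidean_space"
  assumes "kernel R k" "0 < e"
  obtains d where "0 < d" "\<And>x y. dist x y < d \<Longrightarrow> dist (k x) (k y) < e"
proof -
  have "uniformly_continuous_on (cball 0 (R + 1)) k"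
    using assms(1) unfolding kernel_def by (intro compact_uniformly_continuous) (auto intro: continuous_on_subset)
  then obtain d where d: "0 < d" "\<And>x y. x \<in> cball 0 (R + 1) \<Longrightarrow> y \<in> cball 0 (R + 1) \<Longrightarrow> dist y x < d \<Longrightarrow> dist (k y) (k x) < e"
    using assms(2) unfolding uniformly_continuous_on_def by metis
  show ?thesis
  proof (rule that[of "min d 1"])
    fix x y :: 'a assume xy: "dist x y < min d 1"
    then have n: "\<bar>norm x - norm y\<bar> < 1" using norm_triangle_ineq3[of x y] by (simp add: dist_norm)
    show "dist (k x) (k y) < e"
    proof (cases "norm x \<le> R + 1 \<and> norm y \<le> R + 1")
      case True
      then show ?thesis using d(2)[of y x] xy by (simp add: dist_commute)
    next
      case False
      then have "R \<le> norm x" "R \<le> norm y" using n by linarith+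
      then show ?thesis using assms unfolding kernel_def by simp
    qed
  qed (use d in simp)
qed

lemma kernel_bounded:
  fixes k :: "'a::euclidean_space \<Rightarrow> 'b::euclidean_space"
  assumes "kernel R k"
  obtains M where "0 \<le> M" "\<And>z. norm (k z) \<le> M"
proof -
  have "bounded (k ` cball 0 R)"
    using assms unfolding kernel_def
    by (intro compact_imp_bounded compact_continuous_image) (auto intro: continuous_on_subset)
  then obtain M where "\<forall>y\<in>k ` cball 0 R. norm y \<le> M" unfolding bounded_iff by blast
  then have M: "norm (k z) \<le> M" if "norm z \<le> R" for z using that by simp
  have "norm (k z) \<le> max M 0" for z
    using M[of z] assms unfolding kernel_def by (cases "norm z \<le> R") (auto simp: le_max_iff_disj)
  then show ?thesis by (intro that[of "max M 0"]) auto
qed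

lemma convolve_integrable:
  fixes k :: "'a::euclidean_space \<Rightarrow> 'b::euclidean_space"
  assumes "integrable lborel q" "kernel R k"
  shows "integrable lborel (\<lambda>y. q y *\<^sub>R k (x - y))"
proof -
  obtain M where M: "0 \<le> M" "\<And>z. norm (k z) \<le> M" using kernel_bounded[OF assms(2)] by blast
  have "continuous_on UNIV (\<lambda>y. k (x - y))"
    using assms(2) unfolding kernel_def
    by (intro continuous_on_compose2[where g=k and t=UNIV and f="\<lambda>y. x - y"]) (auto intro!: continuous_intros)
  then have km: "(\<lambda>y. k (x - y)) \<in> borel_measurable borel" by (rule borel_measurable_continuous_onI)
  have qm: "q \<in> borel_measurable borel" using borel_measurable_integrable[OF assms(1)] by simp
  show ?thesis
  proof (rule Bochner_Integration.integrable_bound)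
    show "integrable lborel (\<lambda>y. M * q y)" using assms(1) by simp
    show "(\<lambda>y. q y *\<^sub>R k (x - y)) \<in> borel_measurable lborel" using km qm by simp
    show "AE y in lborel. norm (q y *\<^sub>R k (x - y)) \<le> norm (M * q y)"
      using M by (auto intro!: AE_I2 mult_mono simp: abs_mult mult.commute[of M])
  qed
qed

lemma convolve_continuous:
  fixes k :: "'a::euclidean_space \<Rightarrow> 'b::euclidean_space"
  assumes "integrable lborel q" "kernel R k"
  shows "continuous_on UNIV (convolve q k)"
  unfolding continuous_on_iff
proof (intro ballI allI impI)
  fix x :: 'a and e :: real assume e: "0 < e"
  define N where "N = (LINT y|lborel. \<bar>q y\<bar>)"
  have N: "0 \<le> N" by (simp add: N_def)
  obtain d where d: "0 < d" "\<And>x y. dist x y < d \<Longrightarrow> dist (k x) (k y) < e / (N + 1)"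
    using kernel_uniformly_continuous[OF assms(2), of "e / (N + 1)"] e N by (metis add_nonneg_pos divide_pos_pos zero_less_one)
  have "dist (convolve q k x') (convolve q k x) < e" if x': "dist x' x < d" for x'
  proof -
    have "convolve q k x' - convolve q k x = (LINT y|lborel. q y *\<^sub>R (k (x' - y) - k (x - y)))"
      unfolding convolve_def scaleR_diff_right
      by (rule Bochner_Integration.integral_diff[symmetric]) (rule convolve_integrable[OF assms])+
    also have "norm \<dots> \<le> (LINT y|lborel. norm (q y *\<^sub>R (k (x' - y) - k (x - y))))"
      by (rule integral_norm_bound)
    also have "\<dots> \<le> (LINT y|lborel. \<bar>q y\<bar> * (e / (N + 1)))"
    proof (rule integral_mono)
      show "integrable lborel (\<lambda>y. norm (q y *\<^sub>R (k (x' - y) - k (x - y))))"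
        unfolding scaleR_diff_right by (intro integrable_norm Bochner_Integration.integrable_diff convolve_integrable[OF assms])
      show "integrable lborel (\<lambda>y. \<bar>q y\<bar> * (e / (N + 1)))" using assms(1) by simp
      fix y
      have "dist (k (x' - y)) (k (x - y)) < e / (N + 1)" using x' by (intro d) (simp add: dist_norm)
      then show "norm (q y *\<^sub>R (k (x' - y) - k (x - y))) \<le> \<bar>q y\<bar> * (e / (N + 1))"
        unfolding norm_scaleR dist_norm by (intro mult_left_mono) auto
    qed
    also have "\<dots> = N * (e / (N + 1))" using assms(1) by (subst Bochner_Integration.integral_mult_left) (auto simp: N_def)
    also have "\<dots> < e" using e N by (simp add: field_simps)
    finally show ?thesis by (simp add: dist_norm)
  qed
  then show "\<exists>d>0. \<forall>x'\<in>UNIV. dist x' x < d \<longrightarrow> dist (convolve q k x') (convolve q k x) < e"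
    using d(1) by blast
qed

text \<open>Uniform continuity of the partial derivatives of \<open>k\<close> makes its
  linearisation error small uniformly in the base point; integration against the integrable function
  |q| preserves this. The summand 1 in \<open>N + 1\<close> guards against \<open>N\<close> =
  0.\<close>

lemma convolve_has_derivative:
  fixes k :: "'a::euclidean_space \<Rightarrow> 'b::euclidean_space"
  assumes q: "integrable lborel q" and k: "kernel R k"
    and der: "\<And>z. (k has_derivative k' z) (at z)"
    and k': "\<And>h. kernel R (\<lambda>z. k' z h)"
  shows "(convolve q k has_derivative (\<lambda>h. convolve q (\<lambda>z. k' z h) x)) (at x)"
  unfolding has_derivative_at_alt
proof (intro conjI allI impI)
  have lin: "linear (k' z)" for z by (rule has_derivative_linear[OF der])
  have "linear (\<lambda>h. convolve q (\<lambda>z. k' z h) x)"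
  proof (rule linearI)
    show "convolve q (\<lambda>z. k' z (h1 + h2)) x = convolve q (\<lambda>z. k' z h1) x + convolve q (\<lambda>z. k' z h2) x" for h1 h2
      unfolding convolve_def linear_add[OF lin] scaleR_add_right
      by (rule Bochner_Integration.integral_add) (rule convolve_integrable[OF q k'])+
    show "convolve q (\<lambda>z. k' z (r *\<^sub>R h)) x = r *\<^sub>R convolve q (\<lambda>z. k' z h) x" for r h
      unfolding convolve_def linear_scale[OF lin] scaleR_left_commute[of _ r]
      by (rule integral_scaleR_right)
  qed
  then show "bounded_linear (\<lambda>h. convolve q (\<lambda>z. k' z h) x)" by (simp add: linear_conv_bounded_linear)
  fix e :: real assume e: "0 < e"
  define N where "N = (LINT y|lborel. \<bar>q y\<bar>)"
  have N: "0 \<le> N" by (simp add: N_def)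
  define e' where "e' = e / (N + 1)"
  have e': "0 < e'" using e N by (simp add: e'_def)
  have "\<exists>d>0. \<forall>x y. dist x y < d \<longrightarrow> dist (k' x b) (k' y b) < e' / DIM('a)" for b
    using kernel_uniformly_continuous[OF k'[of b], of "e' / DIM('a)"] e' by (metis DIM_positive divide_pos_pos of_nat_0_less_iff)
  then obtain \<delta> where \<delta>: "\<And>b. 0 < \<delta> b" "\<And>b x y. dist x y < \<delta> b \<Longrightarrow> dist (k' x b) (k' y b) < e' / DIM('a)"
    by metis
  define d where "d = Min (\<delta> ` Basis)"
  have d: "0 < d" using \<delta>(1) by (auto simp: d_def Min_gr_iff)
  have on: "onorm (\<lambda>h. k' z' h - k' z h) \<le> e'" if z: "dist z' z < d" for z z'
  proof -
    have bl: "bounded_linear (\<lambda>h. k' z' h - k' z h)"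
      using has_derivative_bounded_linear[OF der] by (intro bounded_linear_sub)
    have "onorm (\<lambda>h. k' z' h - k' z h) \<le> (\<Sum>b\<in>Basis. norm (k' z' b - k' z b))"
      by (rule onorm_componentwise[OF bl])
    also have "\<dots> \<le> (\<Sum>b\<in>(Basis::'a set). e' / DIM('a))"
    proof (rule sum_mono)
      fix b :: 'a assume "b \<in> Basis"
      then have "dist z' z < \<delta> b" using z unfolding d_def by (simp add: Min_gr_iff)
      from \<delta>(2)[OF this] show "norm (k' z' b - k' z b) \<le> e' / DIM('a)" by (simp add: dist_norm)
    qed
    finally show ?thesis by simp
  qed
  have lin_err: "norm (k (z + h) - k z - k' z h) \<le> norm h * e'" if h: "norm h < d" for z h
  proof -
    have "norm (k (z + h) - k z - k' z (z + h - z)) \<le> norm (z + h - z) * e'"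
    proof (rule differentiable_bound_linearization[where S = "ball z d"])
      show "z + t *\<^sub>R (z + h - z) \<in> ball z d" if "t \<in> {0..1}" for t
      proof -
        have "norm (t *\<^sub>R h) \<le> 1 * norm h" using that unfolding norm_scaleR by (intro mult_right_mono) auto
        then show ?thesis using h by (simp add: dist_norm)
      qed
      show "(k has_derivative k' y) (at y within ball z d)" for y using der by (rule has_derivative_at_withinI)
      show "onorm (k' y - k' z) \<le> e'" if "y \<in> ball z d" for y
        using on[of y z] that by (simp add: fun_diff_def dist_commute)
      show "z \<in> ball z d" using d by simp
    qed
    then show ?thesis by simp
  qed
  have "norm (convolve q k y - convolve q k x - convolve q (\<lambda>z. k' z (y - x)) x) \<le> e * norm (y - x)"
    if y: "norm (y - x) < d" for y
  proof -
    have i: "integrable lborel (\<lambda>u. q u *\<^sub>R k (y - u) - q u *\<^sub>R k (x - u) - q u *\<^sub>R k' (x - u) (y - x))"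
      by (intro Bochner_Integration.integrable_diff convolve_integrable[OF q k] convolve_integrable[OF q k'])
    have E: "convolve q k y - convolve q k x - convolve q (\<lambda>z. k' z (y - x)) x
        = (LINT u|lborel. q u *\<^sub>R k (y - u) - q u *\<^sub>R k (x - u) - q u *\<^sub>R k' (x - u) (y - x))"
      unfolding convolve_def
      by (simp add: Bochner_Integration.integral_diff Bochner_Integration.integrable_diff
          convolve_integrable[OF q k] convolve_integrable[OF q k'])
    have "norm (convolve q k y - convolve q k x - convolve q (\<lambda>z. k' z (y - x)) x)
        \<le> (LINT u|lborel. norm (q u *\<^sub>R k (y - u) - q u *\<^sub>R k (x - u) - q u *\<^sub>R k' (x - u) (y - x)))"
      unfolding E by (rule integral_norm_bound)
    also have "\<dots> \<le> (LINT u|lborel. \<bar>q u\<bar> * (norm (y - x) * e'))"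
    proof (rule integral_mono)
      show "integrable lborel (\<lambda>u. norm (q u *\<^sub>R k (y - u) - q u *\<^sub>R k (x - u) - q u *\<^sub>R k' (x - u) (y - x)))"
        by (rule integrable_norm[OF i])
      show "integrable lborel (\<lambda>u. \<bar>q u\<bar> * (norm (y - x) * e'))"
        by (rule Bochner_Integration.integrable_mult_left) (rule integrable_abs[OF q])
      fix u
      have eq: "q u *\<^sub>R k (y - u) - q u *\<^sub>R k (x - u) - q u *\<^sub>R k' (x - u) (y - x)
         = q u *\<^sub>R (k ((x - u) + (y - x)) - k (x - u) - k' (x - u) (y - x))"
        by (simp add: scaleR_diff_right)
      show "norm (q u *\<^sub>R k (y - u) - q u *\<^sub>R k (x - u) - q u *\<^sub>R k' (x - u) (y - x)) \<le> \<bar>q u\<bar> * (norm (y - x) * e')"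
        unfolding eq norm_scaleR by (intro mult_left_mono lin_err[OF y]) simp
    qed
    also have "\<dots> = N * (norm (y - x) * e')" using q by (subst Bochner_Integration.integral_mult_left) (auto simp: N_def)
    also have "\<dots> = (N / (N + 1)) * (e * norm (y - x))" by (simp add: e'_def)
    also have "\<dots> \<le> 1 * (e * norm (y - x))" using N e by (intro mult_right_mono) auto
    finally show ?thesis by simp
  qed
  then show "\<exists>d>0. \<forall>y. norm (y - x) < d \<longrightarrow>
      norm (convolve q k y - convolve q k x - convolve q (\<lambda>z. k' z (y - x)) x) \<le> e * norm (y - x)"
    using d by blast
qed

definition bump_grad :: "real \<Rightarrow> 'a::euclidean_space \<Rightarrow> 'a" where
  "bump_grad e z = (- 2 * bfun 2 (e\<^sup>2 - z \<bullet> z)) *\<^sub>R z"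

text \<open>Both formulas follow from two derivatives of the profile: that of \<open>bfun 0\<close>
  is \<open>bfun 2\<close>, and that of \<open>bfun 2\<close> is \<open>bfun 4\<close> minus twice
  \<open>bfun 3\<close>.\<close>

definition bump_hess :: "real \<Rightarrow> 'a::euclidean_space \<Rightarrow> 'a \<Rightarrow> 'a" where
  "bump_hess e z h = (4 * (bfun 4 (e\<^sup>2 - z \<bullet> z) - 2 * bfun 3 (e\<^sup>2 - z \<bullet> z)) * (z \<bullet> h)) *\<^sub>R z
     - (2 * bfun 2 (e\<^sup>2 - z \<bullet> z)) *\<^sub>R h"

lemma bump_grad_derivative:
  "((\<lambda>z. bfun 0 (e\<^sup>2 - z \<bullet> z)) has_derivative (\<lambda>h. bump_grad e z \<bullet> h)) (at z)"
  using bump_has_derivative[of 0 "e\<^sup>2" 0 z]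
  by (simp add: bump_grad_def mult.commute[of 2] mult.assoc del: add_2_eq_Suc add_2_eq_Suc')

lemma bump_hess_derivative: "(bump_grad e has_derivative bump_hess e z) (at z)"
proof -
  have 1: "((\<lambda>z. bfun 2 (e\<^sup>2 - z \<bullet> z)) has_derivative
      (\<lambda>h. (bfun 4 (e\<^sup>2 - z \<bullet> z) - 2 * bfun 3 (e\<^sup>2 - z \<bullet> z)) * (- 2 * (z \<bullet> h)))) (at z)"
    using bump_has_derivative[of 2 "e\<^sup>2" 0 z] by (simp add: numeral_eq_Suc)
  show ?thesis
    unfolding bump_grad_def[abs_def]
    by (rule has_derivative_eq_rhs, (rule 1 derivative_intros)+)
      (simp add: fun_eq_iff bump_hess_def algebra_simps)
qed

lemma bump_kernels:
  assumes "0 \<le> e"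
  shows "kernel e (\<lambda>z::'a::euclidean_space. bfun 0 (e\<^sup>2 - z \<bullet> z))" "kernel e (bump_grad e :: 'a \<Rightarrow> 'a)"
    "kernel e (\<lambda>z::'a. bump_grad e z \<bullet> h)" "kernel e (\<lambda>z::'a. bump_hess e z h)"
    "kernel e (\<lambda>z::'a. tr (bump_hess e z))"
proof -
  have c: "continuous_on UNIV (\<lambda>z::'a. bfun k (e\<^sup>2 - z \<bullet> z))" for k
    using bump_has_derivative[of k "e\<^sup>2" 0]
    by (auto intro!: continuous_at_imp_continuous_on has_derivative_continuous)
  show "kernel e (\<lambda>z::'a. bfun 0 (e\<^sup>2 - z \<bullet> z))" "kernel e (bump_grad e :: 'a \<Rightarrow> 'a)"
    "kernel e (\<lambda>z::'a. bump_grad e z \<bullet> h)" "kernel e (\<lambda>z::'a. bump_hess e z h)"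
    "kernel e (\<lambda>z::'a. tr (bump_hess e z))"
    unfolding kernel_def bump_grad_def[abs_def] bump_hess_def tr_def
    by (auto intro!: continuous_intros c simp: bump_eq_0[OF assms])
qed

lemma C2_on_convolve_bump:
  fixes q :: "'a::euclidean_space \<Rightarrow> real"
  assumes q: "integrable lborel q" and e: "0 \<le> e"
  shows "C2_on UNIV (convolve q (\<lambda>z. bfun 0 (e\<^sup>2 - z \<bullet> z))) (convolve q (bump_grad e))
      (\<lambda>x h. convolve q (\<lambda>z. bump_hess e z h) x)"
    and "tr (\<lambda>h. convolve q (\<lambda>z. bump_hess e z h) x) = convolve q (\<lambda>z. tr (bump_hess e z)) x"
proof -
  note k = bump_kernels[OF e]
  have inner: "convolve q (\<lambda>z. f z \<bullet> v) x = convolve q f x \<bullet> v" if "kernel e f" for f :: "'a \<Rightarrow> 'a" and v x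
    unfolding convolve_def using integral_inner_left[OF convolve_integrable[OF q that], of x v] by simp
  show "C2_on UNIV (convolve q (\<lambda>z. bfun 0 (e\<^sup>2 - z \<bullet> z))) (convolve q (bump_grad e))
      (\<lambda>x h. convolve q (\<lambda>z. bump_hess e z h) x)"
    unfolding C2_on_def
  proof (intro conjI ballI allI)
    fix x u v :: 'a
    show "(convolve q (\<lambda>z. bfun 0 (e\<^sup>2 - z \<bullet> z)) has_derivative (\<lambda>h. convolve q (bump_grad e) x \<bullet> h)) (at x)"
      using convolve_has_derivative[OF q k(1) bump_grad_derivative k(3), of x] by (simp add: inner[OF k(2)])
    show "(convolve q (bump_grad e) has_derivative (\<lambda>h. convolve q (\<lambda>z. bump_hess e z h) x)) (at x)"
      by (rule convolve_has_derivative[OF q k(2) bump_hess_derivative k(4)])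
    have "convolve q (\<lambda>z. bump_hess e z u) x \<bullet> v = convolve q (\<lambda>z. bump_hess e z u \<bullet> v) x"
      by (simp add: inner[OF k(4)])
    also have "(\<lambda>z. bump_hess e z u \<bullet> v) = (\<lambda>z. bump_hess e z v \<bullet> u)"
      by (simp add: fun_eq_iff bump_hess_def inner_diff_left inner_commute[of u v])
    also have "convolve q \<dots> x = u \<bullet> convolve q (\<lambda>z. bump_hess e z v) x"
      unfolding inner[OF k(4)] by (rule inner_commute)
    finally show "convolve q (\<lambda>z. bump_hess e z u) x \<bullet> v = u \<bullet> convolve q (\<lambda>z. bump_hess e z v) x" .
    show "continuous_on UNIV (\<lambda>x. convolve q (\<lambda>z. bump_hess e z u) x)"
      using convolve_continuous[OF q k(4)] .
  qed
  have "tr (\<lambda>h. convolve q (\<lambda>z. bump_hess e z h) x) = (\<Sum>b\<in>Basis. convolve q (\<lambda>z. bump_hess e z b \<bullet> b) x)"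
    unfolding tr_def by (simp add: inner[OF k(4)])
  also have "\<dots> = convolve q (\<lambda>z. tr (bump_hess e z)) x"
    unfolding convolve_def tr_def scaleR_sum_right
    by (rule Bochner_Integration.integral_sum[symmetric])
      (use integrable_inner_left[OF convolve_integrable[OF q k(4)]] in simp)
  finally show "tr (\<lambda>h. convolve q (\<lambda>z. bump_hess e z h) x) = convolve q (\<lambda>z. tr (bump_hess e z)) x" .
qed

definition lap :: "('a::euclidean_space \<Rightarrow> real) \<Rightarrow> 'a \<Rightarrow> real" where
  "lap \<phi> y = (\<Sum>b\<in>Basis. frechet_derivative (\<lambda>z. frechet_derivative \<phi> (at z) b) (at y) b)"

text \<open>A mollifier without normalisation; its mass is divided out where it is used.\<close>

definition bump :: "real \<Rightarrow> 'a::euclidean_space \<Rightarrow> real" where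
  "bump e z = bfun 0 (e\<^sup>2 - z \<bullet> z)"

lemma bump_commute: "bump e (x - y) = bump e (y - x)"
  by (simp add: bump_def inner_diff_left inner_diff_right inner_commute add.commute)

lemma kernel_eq_0:
  assumes "kernel e k" "y \<notin> cball x e"
  shows "k (x - y) = 0" "k (y - x) = 0"
  using assms by (simp_all add: kernel_def dist_norm norm_minus_commute)

lemma kernel_bump: "0 \<le> e \<Longrightarrow> kernel e (bump e)"
  using bump_kernels(1) unfolding bump_def[abs_def] .

lemma bump_nonneg: "0 \<le> bump e z"
  by (simp add: bump_def bfun_nonneg)

lemma lap_bump: "lap (\<lambda>y. bump e (y - x)) y = tr (bump_hess e (y - x))"
proof -
  have sh: "((\<lambda>y. y - x) has_derivative (\<lambda>h. h)) (at z)" for z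
    by (auto intro!: derivative_eq_intros)
  have "frechet_derivative (\<lambda>y. bump e (y - x)) (at z) = (\<lambda>h. bump_grad e (z - x) \<bullet> h)" for z
    using has_derivative_compose[OF sh bump_grad_derivative]
    unfolding bump_def by (rule frechet_derivative_at[symmetric])
  moreover have "frechet_derivative (\<lambda>z. bump_grad e (z - x) \<bullet> b) (at y) = (\<lambda>h. bump_hess e (y - x) h \<bullet> b)" for b
    using has_derivative_inner_left[OF has_derivative_compose[OF sh bump_hess_derivative]]
    by (rule frechet_derivative_at[symmetric])
  ultimately show ?thesis by (simp add: lap_def tr_def)
qed

lemma tr_bump_hess_commute: "tr (bump_hess e (x - y)) = tr (bump_hess e (y - x))"
proof -
  have "bump_hess e (- z) = bump_hess e z" for z :: 'a
    by (simp add: bump_hess_def fun_eq_iff)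
  from this[of "y - x"] show ?thesis by simp
qed

text \<open>The type argument is needed because the mass depends on the dimension of the space,
  which \<open>e\<close> does not determine.\<close>

definition bump_mass :: "'a::euclidean_space itself \<Rightarrow> real \<Rightarrow> real" where
  "bump_mass _ e = (LINT z|lborel. bump e (z::'a))"

lemma bump_integrable:
  assumes "0 \<le> e"
  shows "integrable lborel (bump e :: 'a::euclidean_space \<Rightarrow> real)"
proof -
  have "integrable lborel (\<lambda>z. indicator (cball (0::'a) e) z * bump e z)"
    using kernel_bump[OF assms] unfolding kernel_def
    by (intro integrable_indicator_compact) (auto intro: continuous_on_subset)
  also have "(\<lambda>z. indicator (cball (0::'a) e) z * bump e z) = bump e"
    using kernel_eq_0(2)[OF kernel_bump[OF assms], of _ 0] by (auto simp: fun_eq_iff split: split_indicator)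
  finally show ?thesis .
qed

lemma bump_mass_pos:
  assumes "0 < e"
  shows "0 < bump_mass TYPE('a::euclidean_space) e"
proof -
  define m where "m = exp (- 1 / (3 / 4 * e\<^sup>2))"
  have lo: "m \<le> bump e z" if "z \<in> ball (0::'a) (e / 2)" for z
  proof -
    have "(norm z)\<^sup>2 \<le> (e / 2)\<^sup>2" using that by (intro power_mono) auto
    then have *: "3 / 4 * e\<^sup>2 \<le> e\<^sup>2 - z \<bullet> z" by (simp add: power2_norm_eq_inner[symmetric] power_divide)
    have p: "0 < 3 / 4 * e\<^sup>2" using assms by simp
    have "1 / (e\<^sup>2 - z \<bullet> z) \<le> 1 / (3 / 4 * e\<^sup>2)" using * p by (intro divide_left_mono mult_pos_pos) linarith+
    moreover have "0 < e\<^sup>2 - z \<bullet> z" using * p by linarith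
    ultimately show ?thesis unfolding bump_def bfun_def m_def by simp
  qed
  have "0 < m * measure lborel (ball (0::'a) (e / 2))"
    using assms content_ball_pos[of "e / 2" "0::'a"] by (simp add: m_def)
  also have "\<dots> = (LINT z|lborel. m * indicator (ball (0::'a) (e / 2)) z)" by simp
  also have "\<dots> \<le> (LINT z|lborel. bump e (z::'a))"
  proof (rule integral_mono)
    show "integrable lborel (\<lambda>z. m * indicator (ball (0::'a) (e / 2)) z)"
      by (intro integrable_mult_right integrable_real_indicator emeasure_bounded_finite) auto
    show "m * indicator (ball (0::'a) (e / 2)) z \<le> bump e z" for z
      using lo[of z] bump_nonneg[of e z] by (auto split: split_indicator)
  qed (use assms in \<open>simp add: bump_integrable\<close>)
  finally show ?thesis by (simp add: bump_mass_def)
qed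

lemma integrable_kernel_product:
  fixes p :: "'a::euclidean_space \<Rightarrow> real"
  assumes "kernel e k" "cball x e \<subseteq> U" "continuous_on (cball x e) p"
  shows "integrable lborel (\<lambda>y. indicator U y * (p y * k (y - x)))"
proof -
  have "integrable lborel (\<lambda>y. indicator (cball x e) y * (p y * k (y - x)))"
    using assms unfolding kernel_def
    by (intro integrable_indicator_compact continuous_on_mult compact_cball
        continuous_on_compose2[where g=k and t=UNIV and f="\<lambda>y. y - x"]) (auto intro!: continuous_intros)
  also have "(\<lambda>y. indicator (cball x e) y * (p y * k (y - x))) = (\<lambda>y. indicator U y * (p y * k (y - x)))"
  proof
    fix y
    have "k (y - x) = 0" if "y \<notin> cball x e"
      by (rule kernel_eq_0(2)[OF assms(1) that])
    then show "indicator (cball x e) y * (p y * k (y - x)) = indicator U y * (p y * k (y - x))"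
      using assms(2) by (cases "y \<in> cball x e") auto
  qed
  finally show ?thesis .
qed

text \<open>\<open>U\<close> only has to contain the ball, as the bump vanishes outside it. The
  integrals are kept over \<open>U\<close> because the weak inequality is stated there.\<close>

lemma bump_average:
  fixes p :: "'a::euclidean_space \<Rightarrow> real"
  assumes "0 < e" "cball x e \<subseteq> U" "continuous_on (cball x e) p"
    and osc: "\<And>y. y \<in> cball x e \<Longrightarrow> \<bar>p y - p x\<bar> \<le> \<eta>"
  shows "\<bar>(LINT y|lborel. indicator U y * (p y * bump e (y - x))) - p x * bump_mass TYPE('a) e\<bar>
     \<le> \<eta> * bump_mass TYPE('a) e"
proof -
  have e0: "0 \<le> e" using assms by simp
  have i: "integrable lborel (\<lambda>y. indicator U y * (p y * bump e (y - x)))"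
    by (rule integrable_kernel_product[OF kernel_bump[OF e0] assms(2,3)])
  have ib: "integrable lborel (\<lambda>y. bump e (y - x))"
    using lborel_integrable_translate[OF bump_integrable[OF e0], of "- x"] by simp
  have mass: "(LINT y|lborel. bump e (y - x)) = bump_mass TYPE('a) e"
    using lborel_integral_translate[of "bump e" "- x"] borel_measurable_integrable[OF bump_integrable[OF e0]]
    by (simp add: bump_mass_def)
  have eq: "(LINT y|lborel. indicator U y * (p y * bump e (y - x))) - p x * bump_mass TYPE('a) e
     = (LINT y|lborel. indicator U y * (p y * bump e (y - x)) - p x * bump e (y - x))"
    unfolding mass[symmetric] using i ib by simp
  have "\<bar>(LINT y|lborel. indicator U y * (p y * bump e (y - x)) - p x * bump e (y - x))\<bar>
     \<le> (LINT y|lborel. \<bar>indicator U y * (p y * bump e (y - x)) - p x * bump e (y - x)\<bar>)"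
    by (rule integral_abs_bound)
  also have "\<dots> \<le> (LINT y|lborel. \<eta> * bump e (y - x))"
  proof (rule integral_mono)
    show "integrable lborel (\<lambda>y. \<bar>indicator U y * (p y * bump e (y - x)) - p x * bump e (y - x)\<bar>)"
      using i ib by simp
    show "integrable lborel (\<lambda>y. \<eta> * bump e (y - x))" using ib by simp
    fix y
    show "\<bar>indicator U y * (p y * bump e (y - x)) - p x * bump e (y - x)\<bar> \<le> \<eta> * bump e (y - x)"
    proof (cases "y \<in> cball x e")
      case True
      then have "indicator U y * (p y * bump e (y - x)) - p x * bump e (y - x) = (p y - p x) * bump e (y - x)"
        using assms(2) by (auto simp: left_diff_distrib)
      then show ?thesis using osc[OF True] bump_nonneg[of e "y - x"] by (simp add: abs_mult mult_right_mono)
    next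
      case False
      then have "bump e (y - x) = 0"
        by (rule kernel_eq_0(2)[OF kernel_bump[OF e0]])
      then show ?thesis by simp
    qed
  qed
  also have "\<dots> = \<eta> * bump_mass TYPE('a) e" by (simp add: mass)
  finally show ?thesis unfolding eq .
qed

text \<open>A weak inequality tested with a bump centred at x is a pointwise inequality at x for the
  mollified function, up to the oscillation of the data over the support. Test functions have to be
  nonnegative: the right side bounds an absolute value pointwise and keeps its meaning only against
  nonnegative weights.\<close>

lemma mollification:
  fixes v b B :: "'a::euclidean_space \<Rightarrow> real"
  assumes U: "open U" and cont: "continuous_on U v" "continuous_on U b" "continuous_on U B"
    and K: "compact K" "K \<subseteq> U" and \<eta>: "0 < \<eta>"
    and weak: "\<And>\<phi>. \<phi> \<in> test_functions U \<Longrightarrow> (\<And>x. 0 \<le> \<phi> x) \<Longrightarrow>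
      \<bar>LINT x|lborel. indicator U x * (v x * lap \<phi> x + b x * \<phi> x)\<bar>
        \<le> (LINT x|lborel. indicator U x * (B x * \<phi> x))"
  shows "\<exists>w G H. C2_on UNIV w G H \<and> (\<forall>x\<in>K. \<bar>w x - v x\<bar> \<le> \<eta> \<and> \<bar>tr (H x) + b x\<bar> \<le> B x + \<eta>)"
proof -
  obtain r where r: "0 < r" "(\<Union>x\<in>K. cball x r) \<subseteq> U"
    using compact_subset_open_imp_cball_epsilon_subset[OF K(1) U K(2)] by blast
  \<comment> \<open>A compact neighbourhood of \<open>K\<close> inside \<open>U\<close>. Uniform
    continuity of all data on it fixes one mollification radius \<open>e\<close> for all points of
    \<open>K\<close>.\<close>
  define L where "L = {x + y |x y. x \<in> K \<and> y \<in> cball 0 r}"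
  have L: "compact L" unfolding L_def by (intro compact_sums K compact_cball)
  have cL: "cball x e \<subseteq> L" if "x \<in> K" "e \<le> r" for x e
  proof
    fix y assume "y \<in> cball x e"
    then have "y = x + (y - x)" "y - x \<in> cball 0 r" using that by (auto simp: dist_norm norm_minus_commute)
    then show "y \<in> L" using that(1) unfolding L_def by blast
  qed
  have LU: "L \<subseteq> U"
  proof
    fix z assume "z \<in> L"
    then obtain x y where "z = x + y" "x \<in> K" "y \<in> cball 0 r" unfolding L_def by blast
    then have "z \<in> cball x r" by (simp add: dist_norm)
    then show "z \<in> U" using r(2) \<open>x \<in> K\<close> by blast
  qed
  have osc: "\<exists>d>0. \<forall>x\<in>L. \<forall>y\<in>L. dist y x < d \<longrightarrow> \<bar>p y - p x\<bar> \<le> \<eta> / 2" if "continuous_on U p" for p :: "'a \<Rightarrow> real"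
  proof -
    have "uniformly_continuous_on L p"
      by (intro compact_uniformly_continuous L continuous_on_subset[OF that LU])
    then obtain d where "0 < d" "\<And>x y. x \<in> L \<Longrightarrow> y \<in> L \<Longrightarrow> dist y x < d \<Longrightarrow> dist (p y) (p x) < \<eta> / 2"
      using \<eta> unfolding uniformly_continuous_on_def by (metis half_gt_zero)
    then show ?thesis by (intro exI[of _ d]) (auto simp: dist_real_def intro: less_imp_le)
  qed
  obtain d1 where d1: "0 < d1" "\<forall>x\<in>L. \<forall>y\<in>L. dist y x < d1 \<longrightarrow> \<bar>v y - v x\<bar> \<le> \<eta> / 2"
    using osc[OF cont(1)] by blast
  obtain d2 where d2: "0 < d2" "\<forall>x\<in>L. \<forall>y\<in>L. dist y x < d2 \<longrightarrow> \<bar>b y - b x\<bar> \<le> \<eta> / 2"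
    using osc[OF cont(2)] by blast
  obtain d3 where d3: "0 < d3" "\<forall>x\<in>L. \<forall>y\<in>L. dist y x < d3 \<longrightarrow> \<bar>B y - B x\<bar> \<le> \<eta> / 2"
    using osc[OF cont(3)] by blast
  note d = d1 d2 d3
  define e where "e = min r (min d1 (min d2 d3)) / 2"
  have e: "0 < e" "0 \<le> e" "e \<le> r" "e < d1" "e < d2" "e < d3" using r d by (auto simp: e_def)
  define Z where "Z = bump_mass TYPE('a) e"
  have Z: "0 < Z" unfolding Z_def by (rule bump_mass_pos[OF e(1)])
  \<comment> \<open>\<open>v\<close> is cut off to \<open>L\<close> so that the convolution is twice
    differentiable on the whole space. For points of \<open>K\<close> the cut-off is invisible
    because e \<le> r. Division by \<open>Z\<close> normalises the bump.\<close>
  define q where "q y = indicator L y * v y / Z" for y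
  have q: "integrable lborel q"
    unfolding q_def using integrable_indicator_compact[OF L continuous_on_subset[OF cont(1) LU]] by simp
  note C2 = C2_on_convolve_bump[OF q e(2)]
  have q_conv: "Z * convolve q k x = (LINT y|lborel. indicator U y * (v y * k (x - y)))"
    if x: "x \<in> K" and k: "kernel e k" for x and k :: "'a \<Rightarrow> real"
  proof -
    have "Z * convolve q k x = (LINT y|lborel. Z * (q y * k (x - y)))"
      unfolding convolve_def by simp
    also have "\<dots> = (LINT y|lborel. indicator U y * (v y * k (x - y)))"
    proof (intro Bochner_Integration.integral_cong refl)
      fix y
      have "k (x - y) = 0" if "y \<notin> cball x e"
        by (rule kernel_eq_0(1)[OF k that])
      then show "Z * (q y * k (x - y)) = indicator U y * (v y * k (x - y))"
      proof (cases "y \<in> cball x e")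
        case True
        then have "y \<in> L" "y \<in> U" using cL[OF x e(3)] LU by blast+
        then show ?thesis using Z by (simp add: q_def)
      qed simp
    qed
    finally show ?thesis .
  qed
  have "\<bar>convolve q (\<lambda>z. bfun 0 (e\<^sup>2 - z \<bullet> z)) x - v x\<bar> \<le> \<eta>
      \<and> \<bar>tr (\<lambda>h. convolve q (\<lambda>z. bump_hess e z h) x) + b x\<bar> \<le> B x + \<eta>" if x: "x \<in> K" for x
  proof -
    \<comment> \<open>The bump is a function of y here. Being even, it makes the integral of v lap
      \<phi> equal to \<open>Z\<close> times the Laplacian of the convolution at x.\<close>
    define \<phi> where "\<phi> y = bump e (y - x)" for y
    have cU: "cball x e \<subseteq> U" using cL[OF x e(3)] LU by blast
    have xL: "x \<in> L" using cL[OF x e(3)] e by (auto simp: subset_iff)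
    have near: "y \<in> L" "dist y x < d1" "dist y x < d2" "dist y x < d3" if "y \<in> cball x e" for y
      using cL[OF x e(3)] that e by (auto simp: dist_commute)
    have cc: "continuous_on (cball x e) v" "continuous_on (cball x e) b" "continuous_on (cball x e) B"
      using cont cU by (auto intro: continuous_on_subset)
    have av: "\<bar>(LINT y|lborel. indicator U y * (v y * \<phi> y)) - v x * Z\<bar> \<le> \<eta> / 2 * Z"
      "\<bar>(LINT y|lborel. indicator U y * (b y * \<phi> y)) - b x * Z\<bar> \<le> \<eta> / 2 * Z"
      "\<bar>(LINT y|lborel. indicator U y * (B y * \<phi> y)) - B x * Z\<bar> \<le> \<eta> / 2 * Z"
    proof -
      have "\<bar>v y - v x\<bar> \<le> \<eta> / 2" "\<bar>b y - b x\<bar> \<le> \<eta> / 2" "\<bar>B y - B x\<bar> \<le> \<eta> / 2" if "y \<in> cball x e" for y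
        using near[OF that] xL d1(2) d2(2) d3(2) by blast+
      then show "\<bar>(LINT y|lborel. indicator U y * (v y * \<phi> y)) - v x * Z\<bar> \<le> \<eta> / 2 * Z"
        "\<bar>(LINT y|lborel. indicator U y * (b y * \<phi> y)) - b x * Z\<bar> \<le> \<eta> / 2 * Z"
        "\<bar>(LINT y|lborel. indicator U y * (B y * \<phi> y)) - B x * Z\<bar> \<le> \<eta> / 2 * Z"
        unfolding \<phi>_def Z_def using bump_average[OF e(1) cU] cc by blast+
    qed
    have \<phi>: "\<phi> \<in> test_functions U" unfolding \<phi>_def bump_def by (rule test_function_bump[OF cU e(2)])
    have \<phi>0: "0 \<le> \<phi> y" for y by (simp add: \<phi>_def bump_nonneg)
    have int: "integrable lborel (\<lambda>y. indicator U y * (v y * lap \<phi> y))" "integrable lborel (\<lambda>y. indicator U y * (b y * \<phi> y))"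
      unfolding \<phi>_def lap_bump
      by (intro integrable_kernel_product[OF _ cU] kernel_bump bump_kernels(5) e cc)+
    have aZ: "\<bar>a\<bar> * Z = \<bar>a * Z\<bar>" for a using Z by (simp add: abs_mult)
    have "Z * convolve q (\<lambda>z. bfun 0 (e\<^sup>2 - z \<bullet> z)) x = (LINT y|lborel. indicator U y * (v y * \<phi> y))"
      using q_conv[OF x bump_kernels(1)[OF e(2)]] bump_commute[of e x] unfolding \<phi>_def bump_def by simp
    then have "\<bar>convolve q (\<lambda>z. bfun 0 (e\<^sup>2 - z \<bullet> z)) x - v x\<bar> * Z \<le> \<eta> / 2 * Z"
      using av(1) unfolding aZ left_diff_distrib by (simp only: mult.commute[of Z])
    then have 1: "\<bar>convolve q (\<lambda>z. bfun 0 (e\<^sup>2 - z \<bullet> z)) x - v x\<bar> \<le> \<eta> / 2" using Z by simp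
    have tr: "Z * tr (\<lambda>h. convolve q (\<lambda>z. bump_hess e z h) x) = (LINT y|lborel. indicator U y * (v y * lap \<phi> y))"
      unfolding C2(2) q_conv[OF x bump_kernels(5)[OF e(2)]] \<phi>_def lap_bump tr_bump_hess_commute[of e x] ..
    have "\<bar>(LINT y|lborel. indicator U y * (v y * lap \<phi> y)) + (LINT y|lborel. indicator U y * (b y * \<phi> y))\<bar>
       \<le> (LINT y|lborel. indicator U y * (B y * \<phi> y))"
      using weak[OF \<phi> \<phi>0] int by (simp add: distrib_left)
    then have "\<bar>Z * tr (\<lambda>h. convolve q (\<lambda>z. bump_hess e z h) x) + b x * Z\<bar> \<le> B x * Z + \<eta> * Z"
    proof -
      \<comment> \<open>Replacing \<open>b\<close> and \<open>B\<close> by their values at x costs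
        \<eta>/2 each, relative to the mass \<open>Z\<close>.\<close>
      have ar: "\<bar>p + z\<bar> \<le> P + 2 * h" if "\<bar>p + y\<bar> \<le> Y" "\<bar>y - z\<bar> \<le> h" "\<bar>Y - P\<bar> \<le> h" for p y z Y P h :: real
        using that by linarith
      show "\<bar>(LINT y|lborel. indicator U y * (v y * lap \<phi> y)) + (LINT y|lborel. indicator U y * (b y * \<phi> y))\<bar>
         \<le> (LINT y|lborel. indicator U y * (B y * \<phi> y)) \<Longrightarrow> ?thesis"
        unfolding tr using ar[OF _ av(2,3)] by simp
    qed
    then have "\<bar>tr (\<lambda>h. convolve q (\<lambda>z. bump_hess e z h) x) + b x\<bar> * Z \<le> (B x + \<eta>) * Z"
      unfolding aZ distrib_right by (simp only: mult.commute[of Z])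
    then show ?thesis using 1 \<eta> Z by simp
  qed
  with C2(1) show ?thesis by blast
qed

section \<open>Solutions of the equation\<close>

lemma grad_inner_Basis: "b \<in> Basis \<Longrightarrow> grad \<phi> x \<bullet> b = frechet_derivative \<phi> (at x) b"
  by (simp add: grad_def inner_sum_left inner_Basis if_distrib cong: if_cong)

lemma test_functionD:
  assumes "\<phi> \<in> test_functions U"
  shows "Ck_on k UNIV \<phi>" "continuous_on UNIV \<phi>" "compact (closure {x. \<phi> x \<noteq> 0})"
    "closure {x. \<phi> x \<noteq> 0} \<subseteq> U" "x \<notin> closure {x. \<phi> x \<noteq> 0} \<Longrightarrow> \<phi> x = 0"
proof -
  show "Ck_on k UNIV \<phi>" "compact (closure {x. \<phi> x \<noteq> 0})" "closure {x. \<phi> x \<noteq> 0} \<subseteq> U"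
    using assms by (simp_all add: test_functions_def smooth_on_def)
  have "Ck_on 0 UNIV \<phi>" using assms by (simp only: test_functions_def smooth_on_def mem_Collect_eq)
  then show "continuous_on UNIV \<phi>" by simp
  show "\<phi> x = 0" if "x \<notin> closure {x. \<phi> x \<noteq> 0}"
    using that closure_subset[of "{x. \<phi> x \<noteq> 0}"] by auto
qed

lemma test_function_partial:
  fixes \<phi> :: "'a::euclidean_space \<Rightarrow> real"
  assumes \<phi>: "\<phi> \<in> test_functions U" and b: "b \<in> Basis"
  shows "(\<lambda>x. frechet_derivative \<phi> (at x) b) \<in> test_functions U"
    and "x \<notin> closure {x. \<phi> x \<noteq> 0} \<Longrightarrow> frechet_derivative \<phi> (at x) b = 0"
proof -
  let ?K = "closure {x. \<phi> x \<noteq> 0}"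
  show z: "frechet_derivative \<phi> (at x) b = 0" if "x \<notin> ?K" for x
  proof -
    have "(\<phi> has_derivative (\<lambda>h. 0)) (at x)"
    proof (rule has_derivative_transform_within_open[of "\<lambda>x. 0" _ _ _ "- ?K"])
      show "0 = \<phi> y" if "y \<in> - ?K" for y using that test_functionD(5)[OF \<phi>, of y] by simp
    qed (use that in \<open>auto simp: open_Compl\<close>)
    from frechet_derivative_at[OF this, symmetric] show ?thesis by simp
  qed
  have sub: "closure {x. frechet_derivative \<phi> (at x) b \<noteq> 0} \<subseteq> ?K"
    by (rule closure_minimal) (use z in auto)
  have "compact (closure {x. frechet_derivative \<phi> (at x) b \<noteq> 0})"
    using compact_Int_closed[OF test_functionD(3)[OF \<phi>] closed_closure, of "{x. frechet_derivative \<phi> (at x) b \<noteq> 0}"]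
      sub by (simp add: Int_absorb1)
  moreover have "Ck_on k UNIV (\<lambda>x. frechet_derivative \<phi> (at x) b)" for k
    using test_functionD(1)[OF \<phi>, of "Suc k"] b by simp
  ultimately show "(\<lambda>x. frechet_derivative \<phi> (at x) b) \<in> test_functions U"
    using sub test_functionD(4)[OF \<phi>] unfolding test_functions_def smooth_on_def by blast
qed

lemma integrable_compact_support:
  fixes q :: "'a::euclidean_space \<Rightarrow> real"
  assumes "compact K" "K \<subseteq> U" "continuous_on U q" "\<And>x. x \<notin> K \<Longrightarrow> q x = 0"
  shows "integrable lborel (\<lambda>x. indicator U x * q x)"
proof -
  have "integrable lborel (\<lambda>x. indicator K x * q x)"
    by (rule integrable_indicator_compact[OF assms(1)]) (use assms in \<open>blast intro: continuous_on_subset\<close>)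
  also have "(\<lambda>x. indicator K x * q x) = (\<lambda>x. indicator U x * q x)"
    using assms(2,4) by (fastforce simp: fun_eq_iff split: split_indicator)
  finally show ?thesis .
qed

text \<open>Integrals over \<Omega> and over \<Omega> - {0} get one common form, which applies
  because the integrands carry a test function supported away from the origin.\<close>

lemma integral_lebesgue_on:
  fixes q :: "'a::euclidean_space \<Rightarrow> real"
  assumes "S \<in> sets lebesgue" "U \<subseteq> S" "\<And>x. x \<notin> U \<Longrightarrow> q x = 0"
  shows "(LINT x|lebesgue_on S. q x) = (LINT x|lebesgue. indicator U x * q x)"
proof -
  have "(LINT x|lebesgue_on S. q x) = (LINT x|lebesgue. indicator S x *\<^sub>R q x)"
    using assms(1) by (intro integral_restrict_space) simp
  also have "\<dots> = (LINT x|lebesgue. indicator U x * q x)"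
    using assms(2,3) by (intro Bochner_Integration.integral_cong) (auto split: split_indicator)
  finally show ?thesis .
qed

lemma L2_loc_mult_integrable:
  fixes g :: "'a::euclidean_space \<Rightarrow> 'a"
  assumes U: "open U" and g: "L2_loc U g" and K: "compact K" "K \<subseteq> U"
    and \<psi>: "continuous_on UNIV \<psi>" "\<And>x. x \<notin> K \<Longrightarrow> \<psi> x = 0"
  shows "integrable lebesgue (\<lambda>x. indicator U x * ((g x \<bullet> b) * \<psi> x))"
proof -
  have "bounded (\<psi> ` K)"
    using \<psi>(1) K(1) by (intro compact_imp_bounded compact_continuous_image) (auto intro: continuous_on_subset)
  then obtain M where "\<forall>y\<in>\<psi> ` K. norm y \<le> M" unfolding bounded_iff by blast
  then have M: "\<bar>\<psi> x\<bar> \<le> \<bar>M\<bar>" if "x \<in> K" for x using that by fastforce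
  have gm: "g \<in> borel_measurable (lebesgue_on U)" and gi: "integrable (lebesgue_on K) (\<lambda>x. (norm (g x))\<^sup>2)"
    using g K unfolding L2_loc_def by auto
  have "U \<in> sets lebesgue" "K \<in> sets lebesgue" using U K(1) by (auto simp: compact_imp_closed)
  have "(\<lambda>x. indicator U x *\<^sub>R g x) \<in> borel_measurable lebesgue"
    using gm borel_measurable_restrict_space_iff[of U lebesgue g] \<open>U \<in> sets lebesgue\<close> by simp
  moreover have "\<psi> \<in> borel_measurable lebesgue"
    using borel_measurable_continuous_onI[OF \<psi>(1)] by (intro measurable_completion) simp
  ultimately have "(\<lambda>x. (indicator U x *\<^sub>R g x) \<bullet> b * \<psi> x) \<in> borel_measurable lebesgue"
    by (intro borel_measurable_times borel_measurable_inner) auto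
  then have meas: "(\<lambda>x. indicator U x * ((g x \<bullet> b) * \<psi> x)) \<in> borel_measurable lebesgue" by (simp add: mult.assoc)
  have i1: "integrable lebesgue (\<lambda>x. indicator K x * (norm (g x))\<^sup>2)"
    using gi integrable_restrict_space[of K lebesgue "\<lambda>x. (norm (g x))\<^sup>2"] \<open>K \<in> sets lebesgue\<close> by simp
  have "integrable lborel (indicat_real K)"
    using integrable_indicator_compact[OF K(1), of "\<lambda>_. 1"] by simp
  then have i2: "integrable lebesgue (indicat_real K)"
    using integrable_completion[of "indicat_real K" lborel] borel_measurable_integrable by blast
  show ?thesis
  proof (rule Bochner_Integration.integrable_bound[OF _ meas])
    show "integrable lebesgue (\<lambda>x. (indicator K x * (norm (g x))\<^sup>2 + indicator K x) * (norm b * \<bar>M\<bar>))"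
      using i1 i2 by (intro integrable_mult_left Bochner_Integration.integrable_add) auto
    show "AE x in lebesgue. norm (indicator U x * ((g x \<bullet> b) * \<psi> x))
        \<le> norm ((indicator K x * (norm (g x))\<^sup>2 + indicator K x) * (norm b * \<bar>M\<bar>))"
    proof (rule AE_I2)
      fix x
      show "norm (indicator U x * ((g x \<bullet> b) * \<psi> x))
        \<le> norm ((indicator K x * (norm (g x))\<^sup>2 + indicator K x) * (norm b * \<bar>M\<bar>))"
      proof (cases "x \<in> K")
        case True
        have "\<bar>g x \<bullet> b\<bar> \<le> norm (g x) * norm b" by (rule Cauchy_Schwarz_ineq2)
        also have "norm (g x) \<le> (norm (g x))\<^sup>2 + 1"
          using zero_le_power2[of "norm (g x) - 1/2"] by (simp add: power2_eq_square algebra_simps)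
        finally have "\<bar>g x \<bullet> b\<bar> \<le> ((norm (g x))\<^sup>2 + 1) * norm b" by (simp add: mult_right_mono)
        then have "\<bar>g x \<bullet> b\<bar> * \<bar>\<psi> x\<bar> \<le> (((norm (g x))\<^sup>2 + 1) * norm b) * \<bar>M\<bar>"
          using M[OF True] by (intro mult_mono) auto
        then show ?thesis using True K(2) by (auto simp: abs_mult mult.assoc)
      qed (simp add: \<psi>(2))
    qed
  qed
qed

text \<open>\<open>b\<close> is the part of the zero-order term that is kept, \<open>B\<close>
  bounds the remainder almost everywhere. Leaving the split open lets the lemma serve twice: with
  the Hardy term as \<open>b\<close> at the origin, and with \<open>b\<close> = 0 elsewhere.\<close>

lemma weak_formulation:
  fixes u v h :: "'a::euclidean_space \<Rightarrow> real" and f b B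
  defines "\<mu> \<equiv> ((real DIM('a) - 2) / 2)\<^sup>2"
  assumes \<Omega>: "open \<Omega>" and sol: "H_solution \<Omega> h f u" and rep: "pointwise_representative \<Omega> u v"
    and h: "h \<in> borel_measurable (lebesgue_on (\<Omega> - {0}))"
    and f: "continuous_on (\<Omega> \<times> UNIV) (\<lambda>(x, s). f x s)"
    and b: "continuous_on (\<Omega> - {0}) b" and B: "continuous_on (\<Omega> - {0}) B"
    and bound: "AE x in lebesgue. x \<in> \<Omega> - {0} \<longrightarrow>
      \<bar>\<mu> * v x / (norm x)\<^sup>2 + h x * v x + f x (v x) - b x\<bar> \<le> B x"
    and \<phi>: "\<phi> \<in> test_functions (\<Omega> - {0})" "\<And>x. 0 \<le> \<phi> x"
  shows "\<bar>LINT x|lborel. indicator (\<Omega> - {0}) x * (v x * lap \<phi> x + b x * \<phi> x)\<bar>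
        \<le> (LINT x|lborel. indicator (\<Omega> - {0}) x * (B x * \<phi> x))"
proof -
  define U where "U = \<Omega> - {0}"
  define K where "K = closure {x. \<phi> x \<noteq> 0}"
  have U: "open U" unfolding U_def using \<Omega> by auto
  have K: "compact K" "K \<subseteq> U" unfolding K_def U_def by (rule test_functionD[OF \<phi>(1)])+
  have \<phi>K: "\<phi> x = 0" if "x \<notin> K" for x using that unfolding K_def by (rule test_functionD(5)[OF \<phi>(1)])
  have sets: "\<Omega> \<in> sets lebesgue" "U \<in> sets lebesgue" using \<Omega> U by auto
  have UO: "U \<subseteq> \<Omega>" by (auto simp: U_def)
  have vc: "continuous_on U v" and vu: "AE x in lebesgue. x \<in> \<Omega> \<longrightarrow> v x = u x"
    using rep AE_restrict_space_iff[of \<Omega> lebesgue "\<lambda>x. v x = u x"] sets(1)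
    unfolding pointwise_representative_def U_def by auto
  obtain g where g: "L2_loc U g" "weak_gradient U u g"
    and eq: "(LINT x|lebesgue_on \<Omega>. g x \<bullet> grad \<phi> x)
          - \<mu> * (LINT x|lebesgue_on \<Omega>. u x * \<phi> x / (norm x)\<^sup>2)
          = (LINT x|lebesgue_on \<Omega>. (h x * u x + f x (u x)) * \<phi> x)"
    using sol \<phi>(1) unfolding H_solution_def U_def \<mu>_def by blast
  have leb: "integrable lebesgue q \<and> (LINT x|lebesgue. q x) = (LINT x|lborel. q x)"
    if "integrable lborel q" for q :: "'a \<Rightarrow> real"
    using that borel_measurable_integrable[OF that] by (simp add: integrable_completion integral_completion)
  define D where "D b x = frechet_derivative \<phi> (at x) b" for b x
  define DD where "DD b x = frechet_derivative (D b) (at x) b" for b x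
  have D: "D b \<in> test_functions U" "x \<notin> K \<Longrightarrow> D b x = 0" if "b \<in> Basis" for b x
    using test_function_partial[OF \<phi>(1) that] unfolding D_def U_def K_def by auto
  have D0: "x \<notin> K \<Longrightarrow> DD b x = 0" if "b \<in> Basis" for b x
  proof -
    assume "x \<notin> K"
    moreover have "closure {x. D b x \<noteq> 0} \<subseteq> K"
      by (rule closure_minimal) (use D(2)[OF that] in \<open>auto simp: K_def\<close>)
    ultimately show "DD b x = 0" unfolding DD_def using test_function_partial(2)[OF D(1)[OF that] that, of x] by blast
  qed
  have Dc: "continuous_on UNIV (D b)" "continuous_on UNIV (DD b)" if "b \<in> Basis" for b
    using test_functionD(2)[OF D(1)[OF that]] test_functionD(2)[OF test_function_partial(1)[OF D(1)[OF that] that]]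
    unfolding DD_def by auto
  have lap: "lap \<phi> x = (\<Sum>b\<in>Basis. DD b x)" for x by (simp add: lap_def DD_def D_def[abs_def])
  have ig: "integrable lebesgue (\<lambda>x. indicator U x * ((g x \<bullet> b) * D b x))" if "b \<in> Basis" for b
    by (rule L2_loc_mult_integrable[OF U g(1) K Dc(1)[OF that] D(2)[OF that]])
  have iv: "integrable lborel (\<lambda>x. indicator U x * (v x * DD b x))" if "b \<in> Basis" for b
    by (rule integrable_compact_support[OF K])
      (use vc Dc(2)[OF that] D0[OF that] in \<open>auto intro!: continuous_on_mult intro: continuous_on_subset\<close>)
  \<comment> \<open>The weak gradient is tested with the partial derivative of \<phi>, itself a test
    function. This moves both derivatives onto \<phi>, and \<open>u\<close> may then be replaced by
    its continuous representative.\<close>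
  have parts: "(LINT x|lebesgue. indicator U x * ((g x \<bullet> b) * D b x)) = - (LINT x|lborel. indicator U x * (v x * DD b x))"
    if "b \<in> Basis" for b
  proof -
    have "(LINT x|lborel. indicator U x * (v x * DD b x)) = (LINT x|lebesgue. indicator U x * (v x * DD b x))"
      using leb[OF iv[OF that]] by simp
    also have "\<dots> = (LINT x|lebesgue. indicator U x * (u x * DD b x))"
    proof (rule integral_cong_AE)
      show 1: "(\<lambda>x. indicator U x * (v x * DD b x)) \<in> borel_measurable lebesgue"
        using leb[OF iv[OF that]] by (blast intro: borel_measurable_integrable)
      show 2: "AE x in lebesgue. indicator U x * (v x * DD b x) = indicator U x * (u x * DD b x)"
        using vu by eventually_elim (use UO in \<open>auto split: split_indicator\<close>)
      show "(\<lambda>x. indicator U x * (u x * DD b x)) \<in> borel_measurable lebesgue"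
        by (rule borel_measurable_AE[OF 1 2])
    qed
    also have "\<dots> = (LINT x|lebesgue_on U. u x * (grad (D b) x \<bullet> b))"
      using D0[OF that] K(2) by (subst integral_lebesgue_on[OF sets(2), of U])
        (auto simp: grad_inner_Basis[OF that] DD_def)
    also have "\<dots> = - (LINT x|lebesgue_on U. (g x \<bullet> b) * D b x)"
      using g(2) D(1)[OF that] that unfolding weak_gradient_def by blast
    also have "(LINT x|lebesgue_on U. (g x \<bullet> b) * D b x) = (LINT x|lebesgue. indicator U x * ((g x \<bullet> b) * D b x))"
      using D(2)[OF that] K(2) by (intro integral_lebesgue_on[OF sets(2)]) auto
    finally show ?thesis by simp
  qed
  have "(LINT x|lebesgue_on \<Omega>. g x \<bullet> grad \<phi> x) = (LINT x|lebesgue. indicator U x * (g x \<bullet> grad \<phi> x))"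
  proof (rule integral_lebesgue_on[OF sets(1) UO])
    fix x assume "x \<notin> U"
    then have "x \<notin> K" using K(2) by blast
    then have "grad \<phi> x = 0" using D(2) by (simp add: grad_def D_def)
    then show "g x \<bullet> grad \<phi> x = 0" by simp
  qed
  also have "\<dots> = (LINT x|lebesgue. (\<Sum>b\<in>Basis. indicator U x * ((g x \<bullet> b) * D b x)))"
    by (simp add: grad_def D_def inner_sum_right sum_distrib_left mult_ac)
  also have "\<dots> = (\<Sum>b\<in>Basis. LINT x|lebesgue. indicator U x * ((g x \<bullet> b) * D b x))"
    by (rule Bochner_Integration.integral_sum[OF ig])
  also have "\<dots> = - (\<Sum>b\<in>Basis. LINT x|lborel. indicator U x * (v x * DD b x))"
    by (simp add: parts sum_negf)
  also have "(\<Sum>b\<in>Basis. LINT x|lborel. indicator U x * (v x * DD b x)) = (LINT x|lborel. (\<Sum>b\<in>Basis. indicator U x * (v x * DD b x)))"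
    by (rule Bochner_Integration.integral_sum[OF iv, symmetric])
  also have "\<dots> = (LINT x|lborel. indicator U x * (v x * lap \<phi> x))"
    by (simp add: lap sum_distrib_left)
  finally have eq1: "(LINT x|lebesgue_on \<Omega>. g x \<bullet> grad \<phi> x) = - (LINT x|lborel. indicator U x * (v x * lap \<phi> x))" .
  have ilap: "integrable lborel (\<lambda>x. indicator U x * (v x * lap \<phi> x))"
    using Bochner_Integration.integrable_sum[OF iv, of Basis] by (simp add: lap sum_distrib_left)
  have \<phi>c: "continuous_on UNIV \<phi>" by (rule test_functionD(2)[OF \<phi>(1)])
  have ct: "integrable lborel (\<lambda>x. indicator U x * (p x * \<phi> x))" if "continuous_on U p" for p
    by (rule integrable_compact_support[OF K])
      (use that \<phi>c \<phi>K in \<open>auto intro!: continuous_on_mult intro: continuous_on_subset\<close>)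
  define P where "P x = \<mu> * v x / (norm x)\<^sup>2" for x
  define T where "T x = P x + h x * v x + f x (v x)" for x
  have Pc: "continuous_on U P" unfolding P_def using vc by (auto intro!: continuous_intros simp: U_def)
  have "continuous_on U (\<lambda>x. (\<lambda>(x, s). f x s) (x, v x))"
    by (rule continuous_on_compose2[OF f]) (use vc UO in \<open>auto intro!: continuous_intros\<close>)
  then have fc: "continuous_on U (\<lambda>x. f x (v x))" by simp
  have "(\<lambda>x. indicator U x *\<^sub>R h x) \<in> borel_measurable lebesgue"
    using h borel_measurable_restrict_space_iff[of U lebesgue h] sets(2) unfolding U_def by simp
  moreover have "(\<lambda>x. indicator U x * (v x * \<phi> x)) \<in> borel_measurable lebesgue"
    using leb[OF ct[OF vc]] by (blast intro: borel_measurable_integrable)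
  ultimately have "(\<lambda>x. (indicator U x *\<^sub>R h x) * (indicator U x * (v x * \<phi> x))) \<in> borel_measurable lebesgue"
    by (rule borel_measurable_times)
  also have "(\<lambda>x. (indicator U x *\<^sub>R h x) * (indicator U x * (v x * \<phi> x))) = (\<lambda>x. indicator U x * (h x * v x * \<phi> x))"
    by (auto simp: fun_eq_iff split: split_indicator)
  finally have hm: "(\<lambda>x. indicator U x * (h x * v x * \<phi> x)) \<in> borel_measurable lebesgue" .
  have iP: "integrable lebesgue (\<lambda>x. indicator U x * (P x * \<phi> x))" and if': "integrable lebesgue (\<lambda>x. indicator U x * (f x (v x) * \<phi> x))"
    and ib: "integrable lebesgue (\<lambda>x. indicator U x * (b x * \<phi> x))" and iB: "integrable lebesgue (\<lambda>x. indicator U x * (B x * \<phi> x))"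
    using leb[OF ct[OF Pc]] leb[OF ct[OF fc]] leb[OF ct[OF b[folded U_def]]] leb[OF ct[OF B[folded U_def]]] by auto
  have "(\<lambda>x. indicator U x * (P x * \<phi> x) + indicator U x * (h x * v x * \<phi> x) + indicator U x * (f x (v x) * \<phi> x)) \<in> borel_measurable lebesgue"
    by (intro borel_measurable_add borel_measurable_integrable[OF iP] borel_measurable_integrable[OF if'] hm)
  then have Tm: "(\<lambda>x. indicator U x * (T x * \<phi> x)) \<in> borel_measurable lebesgue"
    by (simp add: T_def algebra_simps)
  have bd: "AE x in lebesgue. \<bar>indicator U x * (T x * \<phi> x) - indicator U x * (b x * \<phi> x)\<bar> \<le> indicator U x * (B x * \<phi> x)"
    using bound
  proof eventually_elim
    case (elim x)
    show ?case
    proof (cases "x \<in> U")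
      case True
      then have "\<bar>T x - b x\<bar> \<le> B x" using elim unfolding T_def P_def U_def by blast
      then have "\<bar>T x - b x\<bar> * \<phi> x \<le> B x * \<phi> x" by (rule mult_right_mono[OF _ \<phi>(2)])
      then show ?thesis using True \<phi>(2)[of x] by (simp add: left_diff_distrib[symmetric] abs_mult)
    qed simp
  qed
  \<comment> \<open>Integrability of the full zero-order term, with only measurability of
    \<open>h\<close> at hand, is obtained from its almost-everywhere distance to the continuous
    \<open>b\<close>.\<close>
  have iT: "integrable lebesgue (\<lambda>x. indicator U x * (T x * \<phi> x))"
  proof (rule Bochner_Integration.integrable_bound[OF _ Tm])
    show "integrable lebesgue (\<lambda>x. indicator U x * (B x * \<phi> x) + \<bar>indicator U x * (b x * \<phi> x)\<bar>)"
      using ib iB by (intro Bochner_Integration.integrable_add integrable_abs)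
    show "AE x in lebesgue. norm (indicator U x * (T x * \<phi> x)) \<le> norm (indicator U x * (B x * \<phi> x) + \<bar>indicator U x * (b x * \<phi> x)\<bar>)"
    proof -
      have "\<bar>p\<bar> \<le> \<bar>r + \<bar>q\<bar>\<bar>" if "\<bar>p - q\<bar> \<le> r" for p q r :: real using that by linarith
      with bd show ?thesis unfolding real_norm_def by (rule eventually_mono)
    qed
  qed
  have e1: "\<mu> * (LINT x|lebesgue_on \<Omega>. u x * \<phi> x / (norm x)\<^sup>2) = (LINT x|lebesgue. indicator U x * (P x * \<phi> x))"
  proof -
    have "\<mu> * (LINT x|lebesgue_on \<Omega>. u x * \<phi> x / (norm x)\<^sup>2) = (LINT x|lebesgue_on \<Omega>. \<mu> * (u x * \<phi> x / (norm x)\<^sup>2))"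
      by (rule integral_mult_right_zero[symmetric])
    also have "\<dots> = (LINT x|lebesgue. indicator U x * (\<mu> * (u x * \<phi> x / (norm x)\<^sup>2)))"
      using \<phi>K K(2) by (intro integral_lebesgue_on[OF sets(1) UO]) auto
    also have "\<dots> = (LINT x|lebesgue. indicator U x * (P x * \<phi> x))"
    proof (rule integral_cong_AE)
      show 1: "(\<lambda>x. indicator U x * (P x * \<phi> x)) \<in> borel_measurable lebesgue" by (rule borel_measurable_integrable[OF iP])
      show 2: "AE x in lebesgue. indicator U x * (\<mu> * (u x * \<phi> x / (norm x)\<^sup>2)) = indicator U x * (P x * \<phi> x)"
        using vu by eventually_elim (use UO in \<open>auto simp: P_def split: split_indicator\<close>)
      have "AE x in lebesgue. indicator U x * (P x * \<phi> x) = indicator U x * (\<mu> * (u x * \<phi> x / (norm x)\<^sup>2))"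
        using 2 by eventually_elim simp
      then show "(\<lambda>x. indicator U x * (\<mu> * (u x * \<phi> x / (norm x)\<^sup>2))) \<in> borel_measurable lebesgue"
        by (rule borel_measurable_AE[OF 1])
    qed
    finally show ?thesis .
  qed
  have e2: "(LINT x|lebesgue_on \<Omega>. (h x * u x + f x (u x)) * \<phi> x)
     = (LINT x|lebesgue. indicator U x * (T x * \<phi> x) - indicator U x * (P x * \<phi> x))"
  proof -
    have "(LINT x|lebesgue_on \<Omega>. (h x * u x + f x (u x)) * \<phi> x) = (LINT x|lebesgue. indicator U x * ((h x * u x + f x (u x)) * \<phi> x))"
      using \<phi>K K(2) by (intro integral_lebesgue_on[OF sets(1) UO]) auto
    also have "\<dots> = (LINT x|lebesgue. indicator U x * (T x * \<phi> x) - indicator U x * (P x * \<phi> x))"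
    proof (rule integral_cong_AE)
      show 1: "(\<lambda>x. indicator U x * (T x * \<phi> x) - indicator U x * (P x * \<phi> x)) \<in> borel_measurable lebesgue"
        by (intro borel_measurable_diff Tm borel_measurable_integrable[OF iP])
      show 2: "AE x in lebesgue. indicator U x * ((h x * u x + f x (u x)) * \<phi> x) = indicator U x * (T x * \<phi> x) - indicator U x * (P x * \<phi> x)"
        using vu by eventually_elim (use UO in \<open>auto simp: T_def algebra_simps split: split_indicator\<close>)
      have "AE x in lebesgue. indicator U x * (T x * \<phi> x) - indicator U x * (P x * \<phi> x) = indicator U x * ((h x * u x + f x (u x)) * \<phi> x)"
        using 2 by eventually_elim simp
      then show "(\<lambda>x. indicator U x * ((h x * u x + f x (u x)) * \<phi> x)) \<in> borel_measurable lebesgue"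
        by (rule borel_measurable_AE[OF 1])
    qed
    finally show ?thesis .
  qed
  have key: "(LINT x|lborel. indicator U x * (v x * lap \<phi> x)) = - (LINT x|lebesgue. indicator U x * (T x * \<phi> x))"
    using eq unfolding eq1 e1 e2 using iT iP by simp
  have "(LINT x|lborel. indicator U x * (v x * lap \<phi> x + b x * \<phi> x))
     = (LINT x|lborel. indicator U x * (v x * lap \<phi> x)) + (LINT x|lborel. indicator U x * (b x * \<phi> x))"
    using ilap ct[OF b[folded U_def]] by (simp add: distrib_left)
  also have "\<dots> = - (LINT x|lebesgue. indicator U x * (T x * \<phi> x) - indicator U x * (b x * \<phi> x))"
    using key leb[OF ct[OF b[folded U_def]]] iT ib by simp
  finally have E: "(LINT x|lborel. indicator U x * (v x * lap \<phi> x + b x * \<phi> x))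
     = - (LINT x|lebesgue. indicator U x * (T x * \<phi> x) - indicator U x * (b x * \<phi> x))" .
  have "\<bar>LINT x|lborel. indicator U x * (v x * lap \<phi> x + b x * \<phi> x)\<bar> \<le> (LINT x|lebesgue. \<bar>indicator U x * (T x * \<phi> x) - indicator U x * (b x * \<phi> x)\<bar>)"
    unfolding E abs_minus_cancel by (rule integral_abs_bound)
  also have "\<dots> \<le> (LINT x|lebesgue. indicator U x * (B x * \<phi> x))"
    by (rule integral_mono_AE[OF _ iB bd]) (use iT ib in simp)
  also have "\<dots> = (LINT x|lborel. indicator U x * (B x * \<phi> x))"
    using leb[OF ct[OF B[folded U_def]]] by simp
  finally show ?thesis unfolding U_def .
qed

text \<open>Division by |s|. At s = 0 the bound says f 0 = 0, which follows by continuity from the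
  bound nearby. It turns the nonlinearity into a potential times the solution.\<close>

lemma nonlinearity_bound:
  fixes f :: "real \<Rightarrow> real"
  assumes cont: "continuous_on UNIV f" and p: "2 < p" and C: "0 < C"
    and bound: "\<And>s. \<bar>f s * s\<bar> \<le> C * (\<bar>s\<bar>\<^sup>2 + \<bar>s\<bar> powr p)"
  shows "\<bar>f s\<bar> \<le> C * (1 + \<bar>s\<bar> powr (p - 2)) * \<bar>s\<bar>"
proof -
  have nz: "\<bar>f s\<bar> \<le> C * (1 + \<bar>s\<bar> powr (p - 2)) * \<bar>s\<bar>" if "s \<noteq> 0" for s
  proof -
    have "\<bar>s\<bar> powr p = \<bar>s\<bar> powr (p - 2) * \<bar>s\<bar> powr 2"
      using powr_add[of "\<bar>s\<bar>" "p - 2" 2] by (simp only: diff_add_cancel)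
    then have "\<bar>s\<bar> powr p = \<bar>s\<bar> powr (p - 2) * \<bar>s\<bar>\<^sup>2" using that by (simp add: powr_numeral)
    then have "\<bar>f s\<bar> * \<bar>s\<bar> \<le> (C * (1 + \<bar>s\<bar> powr (p - 2)) * \<bar>s\<bar>) * \<bar>s\<bar>"
    proof -
      have "C * (t\<^sup>2 + a * t\<^sup>2) = (C * (1 + a) * t) * t" for t a by (simp add: algebra_simps power2_eq_square)
      then show "\<bar>s\<bar> powr p = \<bar>s\<bar> powr (p - 2) * \<bar>s\<bar>\<^sup>2 \<Longrightarrow> ?thesis"
        using bound[of s] unfolding abs_mult by metis
    qed
    then show ?thesis using that by simp
  qed
  show ?thesis
  proof (cases "s = 0")
    case True
    have lim: "(f \<longlongrightarrow> f 0) (at 0)" using cont by (simp add: continuous_on_eq_continuous_at isCont_def)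
    have "((\<lambda>s. C * (1 + \<bar>s\<bar> powr (p - 2)) * \<bar>s\<bar>) \<longlongrightarrow> C * (1 + \<bar>0\<bar> powr (p - 2)) * \<bar>0\<bar>) (at (0::real))"
      using p by (intro tendsto_intros tendsto_powr') auto
    then have "((\<lambda>s. C * (1 + \<bar>s\<bar> powr (p - 2)) * \<bar>s\<bar>) \<longlongrightarrow> 0) (at (0::real))" by simp
    then have "(f \<longlongrightarrow> 0) (at 0)"
      by (rule Lim_null_comparison[rotated]) (use nz in \<open>auto simp: eventually_at_filter\<close>)
    with lim have "f 0 = 0" by (rule LIM_unique)
    then show ?thesis using True by simp
  qed (rule nz)
qed

section \<open>Unique continuation on the domain\<close>

lemma C2_on_subset: "C2_on S w G H \<Longrightarrow> T \<subseteq> S \<Longrightarrow> C2_on T w G H"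
  unfolding C2_on_def by (blast intro: continuous_on_subset)

lemma C2_on_translate:
  assumes "C2_on UNIV w G H"
  shows "C2_on UNIV (\<lambda>x. w (y + x)) (\<lambda>x. G (y + x)) (\<lambda>x. H (y + x))"
proof -
  note w = C2_onD[OF assms]
  have sh: "((+) y has_derivative (\<lambda>h. h)) (at x)" for x by (auto intro!: derivative_eq_intros)
  have "((\<lambda>x. w (y + x)) has_derivative (\<lambda>h. G (y + x) \<bullet> h)) (at x)" for x
    by (rule has_derivative_compose[OF sh w(1)]) simp
  moreover have "((\<lambda>x. G (y + x)) has_derivative H (y + x)) (at x)" for x
    by (rule has_derivative_compose[OF sh w(2)]) simp
  moreover have "continuous_on UNIV (\<lambda>x. H (y + x) h)" for h
    by (rule continuous_on_compose2[OF w(4)]) (auto intro!: continuous_intros)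
  ultimately show ?thesis unfolding C2_on_def using w(3) by blast
qed

text \<open>Mollification provides the approximants that strong unique continuation asks for, here
  around a centre \<open>y\<close>. The choice \<beta> = ln R - 1 makes the outermost annulus end at
  R; vanishing is obtained up to exp (\<beta> - 1), that is R exp (-2). \<open>C\<close> does not
  influence this radius.\<close>

lemma weak_strong_unique_continuation:
  fixes v b B :: "'a::euclidean_space \<Rightarrow> real"
  assumes U: "open U" and cont: "continuous_on U v" "continuous_on U b" "continuous_on U B"
    and weak: "\<And>\<phi>. \<phi> \<in> test_functions U \<Longrightarrow> (\<And>x. 0 \<le> \<phi> x) \<Longrightarrow>
      \<bar>LINT x|lborel. indicator U x * (v x * lap \<phi> x + b x * \<phi> x)\<bar>
        \<le> (LINT x|lborel. indicator U x * (B x * \<phi> x))"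
    and C: "0 \<le> C" and \<delta>: "0 < \<delta>" "\<delta> \<le> 1" and R: "0 < R" "R \<le> 1" "exp (\<delta> * (ln R - 1)) \<le> 1/2"
    and sub: "\<And>x. x \<noteq> 0 \<Longrightarrow> norm x \<le> R \<Longrightarrow> y + x \<in> U"
    and b: "\<And>x. x \<noteq> 0 \<Longrightarrow> norm x \<le> R \<Longrightarrow> (norm x)\<^sup>2 * b (y + x) = c * v (y + x)"
    and B: "\<And>x. x \<noteq> 0 \<Longrightarrow> norm x \<le> R \<Longrightarrow> (norm x)\<^sup>2 * B (y + x) \<le> C * exp (\<delta> * ln (norm x)) * \<bar>v (y + x)\<bar>"
    and vanish: "\<And>k::nat. (\<lambda>x. v (y + x)) \<in> O[at 0](\<lambda>x. norm x ^ k)"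
    and x: "x \<noteq> 0" "norm x < R * exp (- 2)"
  shows "v (y + x) = 0"
proof (rule strong_unique_continuation[where v = "\<lambda>x. v (y + x)" and \<beta> = "ln R - 1" and c = c, OF C \<delta> R(3)])
  have e: "ln R - 1 + 1 = ln R" by simp
  have ann: "z \<noteq> 0" "norm z \<le> R" if "z \<in> annulus a (ln R)" for z :: 'a and a
    using that R(1) by (auto simp: annulus_def not_le)
  show "ln R - 1 + 1 \<le> 0" using R by simp
  show "continuous_on (annulus a (ln R - 1 + 1)) (\<lambda>x. v (y + x))" for a
    unfolding e by (rule continuous_on_compose2[OF cont(1)]) (use sub ann in \<open>auto intro!: continuous_intros\<close>)
  show "(\<lambda>x. v (y + x)) \<in> O[at 0](\<lambda>x. norm x ^ k)" for k by (rule vanish)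
  show "x \<noteq> 0" by (rule x)
  have "R * exp (- 2) = exp (ln R - 1 - 1)" using R(1) by (simp add: exp_diff exp_minus field_simps flip: exp_add)
  then show "norm x < exp (ln R - 1 - 1)" using x(2) by simp
  fix a \<eta> :: real assume \<eta>: "0 < \<eta>"
  \<comment> \<open>The three summands of the denominator pay for the mollification error in the
    equation, for replacing \<open>v\<close> by \<open>w\<close> behind \<open>c\<close>, and for
    the same replacement behind \<open>C\<close>.\<close>
  define \<eta>' where "\<eta>' = \<eta> / (1 + \<bar>c\<bar> + C)"
  have pos: "0 < 1 + \<bar>c\<bar> + C" using C by linarith
  have \<eta>': "0 < \<eta>'" "(1 + \<bar>c\<bar> + C) * \<eta>' = \<eta>" using \<eta> pos by (simp_all add: \<eta>'_def)
  have le: "\<eta>' \<le> \<eta>"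
  proof -
    have "0 \<le> (\<bar>c\<bar> + C) * \<eta>'" using C \<eta>'(1) by simp
    then show ?thesis using \<eta>'(2) by (simp add: algebra_simps)
  qed
  define K where "K = (+) y ` annulus a (ln R)"
  have K: "compact K" "K \<subseteq> U"
    unfolding K_def using sub ann
    by (auto intro!: compact_continuous_image annulus_compact continuous_intros)
  obtain w G H where w: "C2_on UNIV w G H" "\<And>x. x \<in> K \<Longrightarrow> \<bar>w x - v x\<bar> \<le> \<eta>'"
      "\<And>x. x \<in> K \<Longrightarrow> \<bar>tr (H x) + b x\<bar> \<le> B x + \<eta>'"
    using mollification[OF U cont K \<eta>'(1) weak] by blast
  show "\<exists>w G H. C2_on (- {0}) w G H \<and> (\<forall>x\<in>annulus a (ln R - 1 + 1). \<bar>w x - v (y + x)\<bar> \<le> \<eta> \<and>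
        \<bar>(norm x)\<^sup>2 * tr (H x) + c * w x\<bar> \<le> C * exp (\<delta> * ln (norm x)) * \<bar>w x\<bar> + \<eta>)"
    unfolding e
  proof (intro exI conjI ballI)
    show "C2_on (- {0}) (\<lambda>x. w (y + x)) (\<lambda>x. G (y + x)) (\<lambda>x. H (y + x))"
      by (rule C2_on_subset[OF C2_on_translate[OF w(1)]]) simp
    fix x :: 'a assume x: "x \<in> annulus a (ln R)"
    then have xK: "y + x \<in> K" unfolding K_def by blast
    have n: "x \<noteq> 0" "norm x \<le> R" using ann[OF x] by auto
    show "\<bar>w (y + x) - v (y + x)\<bar> \<le> \<eta>" using w(2)[OF xK] le by linarith
    define s where "s = exp (\<delta> * ln (norm x))"
    have s: "0 \<le> s" "s \<le> 1" using n R \<delta> by (auto simp: s_def mult_nonneg_nonpos)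
    have r1: "(norm x)\<^sup>2 \<le> 1" using n R by (intro power_le_one) auto
    have "(norm x)\<^sup>2 * tr (H (y + x)) + c * w (y + x)
       = (norm x)\<^sup>2 * (tr (H (y + x)) + b (y + x)) + c * (w (y + x) - v (y + x))"
      using b[OF n] by (simp add: algebra_simps)
    also have "\<bar>\<dots>\<bar> \<le> (norm x)\<^sup>2 * \<bar>tr (H (y + x)) + b (y + x)\<bar> + \<bar>c\<bar> * \<bar>w (y + x) - v (y + x)\<bar>"
      using abs_triangle_ineq[of "(norm x)\<^sup>2 * (tr (H (y + x)) + b (y + x))" "c * (w (y + x) - v (y + x))"]
      by (simp add: abs_mult)
    also have "\<dots> \<le> (norm x)\<^sup>2 * (B (y + x) + \<eta>') + \<bar>c\<bar> * \<eta>'"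
      by (intro add_mono mult_left_mono w xK) auto
    also have "\<dots> \<le> C * s * \<bar>v (y + x)\<bar> + 1 * \<eta>' + \<bar>c\<bar> * \<eta>'"
      unfolding distrib_left s_def using B[OF n] r1 \<eta>'(1) by (intro add_mono mult_right_mono) auto
    also have "\<dots> \<le> C * s * (\<bar>w (y + x)\<bar> + \<eta>') + 1 * \<eta>' + \<bar>c\<bar> * \<eta>'"
      using w(2)[OF xK] C s by (intro add_mono mult_left_mono) auto
    also have "\<dots> \<le> C * s * \<bar>w (y + x)\<bar> + \<eta>"
    proof -
      have "C * s * \<eta>' \<le> C * 1 * \<eta>'" using C s \<eta>'(1) by (intro mult_right_mono mult_left_mono) auto
      then show ?thesis using \<eta>'(2) by (simp add: algebra_simps)
    qed
    finally show "\<bar>(norm x)\<^sup>2 * tr (H (y + x)) + c * w (y + x)\<bar>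
       \<le> C * exp (\<delta> * ln (norm x)) * \<bar>w (y + x)\<bar> + \<eta>" unfolding s_def .
  qed
qed

lemma unique_continuation:
  fixes h u v :: "'a::euclidean_space \<Rightarrow> real" and f
  assumes dim: "2 \<le> DIM('a)"
    and \<Omega>: "open \<Omega>" "connected \<Omega>" "0 \<in> \<Omega>"
    and H: "assumption_H \<Omega> h" and F: "assumption_F \<Omega> f"
    and sol: "H_solution \<Omega> h f u" and rep: "pointwise_representative \<Omega> u v"
    and vanish: "\<And>k::nat. v \<in> O[at 0](\<lambda>x. norm x ^ k)"
    and x: "x \<in> \<Omega> - {0}"
  shows "v x = 0"
proof -
  define U where "U = \<Omega> - {0}"
  define \<mu> where "\<mu> = ((real DIM('a) - 2) / 2)\<^sup>2"
  have U: "open U" using \<Omega> by (auto simp: U_def)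
  have sets: "\<Omega> \<in> sets lebesgue" "U \<in> sets lebesgue" using \<Omega> U by auto
  have vc: "continuous_on U v" using rep by (simp add: pointwise_representative_def U_def)
  obtain Ch \<epsilon> where h: "0 < Ch" "0 < \<epsilon>" "\<epsilon> < 2" "AE x in lebesgue_on U. \<bar>h x\<bar> \<le> Ch * norm x powr (- 2 + \<epsilon>)"
    and hm: "h \<in> borel_measurable (lebesgue_on U)"
    using H unfolding assumption_H_def Linf_loc_def U_def by blast
  obtain Cf p where f: "0 < Cf" "2 < p"
    "AE x in lebesgue_on \<Omega>. \<forall>s. \<bar>f x s * s\<bar> + \<bar>deriv (f x) s * s\<^sup>2\<bar> + \<bar>grad (\<lambda>y. primitive f y s) x \<bullet> x\<bar>
             \<le> Cf * (\<bar>s\<bar>\<^sup>2 + \<bar>s\<bar> powr p)"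
    and fc: "continuous_on (\<Omega> \<times> UNIV) (\<lambda>(x, s). f x s)"
    using F unfolding assumption_F_def by blast
  \<comment> \<open>Potential with |h v + f(x, v)| \<le> q |v| almost everywhere. The solution
    enters it through |v|^(p - 2), which is harmless wherever \<open>v\<close> is bounded.\<close>
  define q where "q x = Ch * norm x powr (- 2 + \<epsilon>) + Cf * (1 + \<bar>v x\<bar> powr (p - 2))" for x
  have qc: "continuous_on U q"
    unfolding q_def using vc f(2)
    by (auto intro!: continuous_intros continuous_on_powr' simp: U_def)
  have q0: "0 \<le> q x" for x using h f by (simp add: q_def)
  have "AE x in lebesgue. x \<in> U \<longrightarrow> \<bar>h x\<bar> \<le> Ch * norm x powr (- 2 + \<epsilon>)"
    using h(4) AE_restrict_space_iff[of U lebesgue "\<lambda>x. \<bar>h x\<bar> \<le> Ch * norm x powr (- 2 + \<epsilon>)"] sets by simp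
  moreover have "AE x in lebesgue. x \<in> \<Omega> \<longrightarrow> (\<forall>s. \<bar>f x s * s\<bar> + \<bar>deriv (f x) s * s\<^sup>2\<bar> + \<bar>grad (\<lambda>y. primitive f y s) x \<bullet> x\<bar>
             \<le> Cf * (\<bar>s\<bar>\<^sup>2 + \<bar>s\<bar> powr p))"
    using f(3) sets(1) by (subst (asm) AE_restrict_space_iff) auto
  ultimately have pot: "AE x in lebesgue. x \<in> U \<longrightarrow> \<bar>h x * v x + f x (v x)\<bar> \<le> q x * \<bar>v x\<bar>"
  proof eventually_elim
    case (elim x)
    show ?case
    proof
      assume xU: "x \<in> U"
      then have xO: "x \<in> \<Omega>" by (simp add: U_def)
      have "continuous_on UNIV (\<lambda>s. (\<lambda>(x, s). f x s) (x, s))"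
        by (rule continuous_on_compose2[OF fc]) (use xO in \<open>auto intro!: continuous_intros\<close>)
      then have c: "continuous_on UNIV (f x)" by simp
      have "\<bar>f x s * s\<bar> \<le> Cf * (\<bar>s\<bar>\<^sup>2 + \<bar>s\<bar> powr p)" for s
        using elim(2) xO by (meson abs_ge_zero add_increasing2 order_trans le_add_same_cancel1)
      then have "\<bar>f x (v x)\<bar> \<le> Cf * (1 + \<bar>v x\<bar> powr (p - 2)) * \<bar>v x\<bar>"
        by (rule nonlinearity_bound[OF c f(2,1)])
      moreover have "\<bar>h x * v x\<bar> \<le> Ch * norm x powr (- 2 + \<epsilon>) * \<bar>v x\<bar>"
        using elim(1) xU unfolding abs_mult by (intro mult_right_mono) auto
      ultimately show "\<bar>h x * v x + f x (v x)\<bar> \<le> q x * \<bar>v x\<bar>"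
        unfolding q_def distrib_right using abs_triangle_ineq[of "h x * v x" "f x (v x)"] by linarith
    qed
  qed
  have \<mu>c: "continuous_on U (\<lambda>x. \<mu> * v x / (norm x)\<^sup>2)"
    using vc by (auto intro!: continuous_intros simp: U_def)
  have weak1: "\<bar>LINT x|lborel. indicator U x * (v x * lap \<phi> x + (\<mu> * v x / (norm x)\<^sup>2) * \<phi> x)\<bar>
        \<le> (LINT x|lborel. indicator U x * ((q x * \<bar>v x\<bar>) * \<phi> x))"
    if "\<phi> \<in> test_functions U" "\<And>x. 0 \<le> \<phi> x" for \<phi>
  proof (rule weak_formulation[OF \<Omega>(1) sol rep hm[unfolded U_def] fc, folded U_def, OF \<mu>c])
    show "continuous_on U (\<lambda>x. q x * \<bar>v x\<bar>)" using vc qc by (auto intro!: continuous_intros)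
    show "AE x in lebesgue. x \<in> U \<longrightarrow> \<bar>((real DIM('a) - 2) / 2)\<^sup>2 * v x / (norm x)\<^sup>2 + h x * v x + f x (v x)
        - \<mu> * v x / (norm x)\<^sup>2\<bar> \<le> q x * \<bar>v x\<bar>"
      using pot by eventually_elim (simp add: \<mu>_def)
  qed (use that in auto)
  \<comment> \<open>At the origin the Hardy term is no perturbation, since |x|^2 times its
    coefficient does not decay; it is kept there as \<open>c\<close>. Away from the origin its
    coefficient is locally bounded and joins the potential.\<close>
  define Q where "Q x = \<mu> / (norm x)\<^sup>2 + q x" for x
  have Qc: "continuous_on U Q"
    unfolding Q_def using qc by (auto intro!: continuous_intros simp: U_def)
  have weak2: "\<bar>LINT x|lborel. indicator U x * (v x * lap \<phi> x + 0 * \<phi> x)\<bar>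
        \<le> (LINT x|lborel. indicator U x * ((Q x * \<bar>v x\<bar>) * \<phi> x))"
    if "\<phi> \<in> test_functions U" "\<And>x. 0 \<le> \<phi> x" for \<phi>
  proof (rule weak_formulation[OF \<Omega>(1) sol rep hm[unfolded U_def] fc, folded U_def, of "\<lambda>x. 0"])
    show "continuous_on U (\<lambda>x. Q x * \<bar>v x\<bar>)" using vc Qc by (auto intro!: continuous_intros)
    show "AE x in lebesgue. x \<in> U \<longrightarrow> \<bar>((real DIM('a) - 2) / 2)\<^sup>2 * v x / (norm x)\<^sup>2 + h x * v x + f x (v x)
        - 0\<bar> \<le> Q x * \<bar>v x\<bar>"
      using pot
    proof eventually_elim
      case (elim x)
      have "\<bar>\<mu> * v x / (norm x)\<^sup>2\<bar> = \<mu> / (norm x)\<^sup>2 * \<bar>v x\<bar>" by (simp add: abs_mult \<mu>_def)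
      then show ?case
        using elim abs_triangle_ineq[of "\<mu> * v x / (norm x)\<^sup>2" "h x * v x + f x (v x)"]
        unfolding Q_def distrib_right by (auto simp: \<mu>_def[symmetric] add.assoc)
    qed
  qed (use that in auto)
  \<comment> \<open>Open by construction; the rest of the proof makes it nonempty and relatively
    closed in \<open>U\<close>.\<close>
  define Z where "Z = {x \<in> U. \<exists>r>0. \<forall>z\<in>ball x r. v z = 0}"
  have near0: "\<exists>\<rho>>0. \<forall>x. x \<noteq> 0 \<longrightarrow> norm x < \<rho> \<longrightarrow> v x = 0"
  proof -
    obtain r0 where r0: "0 < r0" "cball 0 r0 \<subseteq> \<Omega>" using \<Omega> open_contains_cball by blast
    \<comment> \<open>Order zero of the vanishing hypothesis is boundedness of \<open>v\<close> near
      the origin, which controls |v|^(p - 2).\<close>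
    obtain D r where D: "0 \<le> D" "0 < r" "\<And>x. x \<noteq> 0 \<Longrightarrow> norm x < r \<Longrightarrow> \<bar>v x\<bar> \<le> D * norm x ^ 0"
      using vanishing_order_bound[OF vanish[of 0]] by blast
    \<comment> \<open>The Carleman estimate is available for \<delta> \<le> 1. Lowering the exponent
      is allowed because |x| \<le> 1.\<close>
    define \<delta> where "\<delta> = min 1 \<epsilon>"
    have \<delta>: "0 < \<delta>" "\<delta> \<le> 1" "\<delta> \<le> \<epsilon>" using h by (auto simp: \<delta>_def)
    \<comment> \<open>The last entry is exactly the condition exp (\<delta> (ln R - 1)) \<le> 1/2;
      the entry r / 2 keeps R below r, where |v| \<le> D.\<close>
    define R where "R = min (min 1 r0) (min (r / 2) (exp (1 - ln 2 / \<delta>)))"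
    have R: "0 < R" "R \<le> 1" "R \<le> r0" "R < r" "R \<le> exp (1 - ln 2 / \<delta>)"
      using r0 D(2) by (auto simp: R_def)
    define C where "C = Ch + Cf * (1 + D powr (p - 2))"
    have C: "0 \<le> C" using h f by (simp add: C_def)
    have "ln R \<le> 1 - ln 2 / \<delta>" using R(1,5) by (metis ln_exp ln_le_cancel_iff exp_gt_zero)
    then have "\<delta> * (ln R - 1) \<le> \<delta> * (- (ln 2 / \<delta>))" using \<delta> by (intro mult_left_mono) auto
    then have "\<delta> * (ln R - 1) \<le> - ln 2" using \<delta> by simp
    then have "exp (\<delta> * (ln R - 1)) \<le> exp (- ln 2)" by (subst exp_le_cancel_iff)
    then have R2: "exp (\<delta> * (ln R - 1)) \<le> 1/2" by (simp add: exp_minus)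
    have "v (0 + x) = 0" if "x \<noteq> 0" "norm x < R * exp (- 2)" for x
    proof (rule weak_strong_unique_continuation[OF U vc \<mu>c _ weak1 C \<delta>(1,2) R(1,2) R2, of 0 \<mu>])
      show "continuous_on U (\<lambda>x. q x * \<bar>v x\<bar>)" using vc qc by (auto intro!: continuous_intros)
      show "0 + x \<in> U" if "x \<noteq> 0" "norm x \<le> R" for x using that R r0(2) by (auto simp: U_def)
      show "(norm x)\<^sup>2 * (\<mu> * v (0 + x) / (norm (0 + x))\<^sup>2) = \<mu> * v (0 + x)" if "x \<noteq> 0" for x using that by simp
      show "(norm x)\<^sup>2 * (q (0 + x) * \<bar>v (0 + x)\<bar>) \<le> C * exp (\<delta> * ln (norm x)) * \<bar>v (0 + x)\<bar>"
        if x: "x \<noteq> 0" "norm x \<le> R" for x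
      proof -
        define t where "t = ln (norm x)"
        have t: "t \<le> 0" using x R by (simp add: t_def)
        have r: "(norm x)\<^sup>2 = exp (2 * t)" using x by (simp add: t_def exp_double)
        have e1: "(norm x)\<^sup>2 * norm x powr (- 2 + \<epsilon>) \<le> exp (\<delta> * t)"
          unfolding r using x \<delta>(3) t
          by (simp add: powr_def t_def[symmetric] algebra_simps mult_right_mono_neg flip: exp_add)
        have e2: "(norm x)\<^sup>2 \<le> exp (\<delta> * t)"
          unfolding r using mult_right_mono_neg[of \<delta> 2 t] \<delta> t by simp
        have vD: "\<bar>v x\<bar> powr (p - 2) \<le> D powr (p - 2)" using D(3)[of x] x R f by (intro powr_mono2) auto
        have "(norm x)\<^sup>2 * q x = Ch * ((norm x)\<^sup>2 * norm x powr (- 2 + \<epsilon>)) + Cf * ((1 + \<bar>v x\<bar> powr (p - 2)) * (norm x)\<^sup>2)"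
          by (simp add: q_def algebra_simps)
        also have "\<dots> \<le> Ch * exp (\<delta> * t) + Cf * ((1 + D powr (p - 2)) * exp (\<delta> * t))"
          using e1 e2 vD h f by (intro add_mono mult_left_mono mult_mono) auto
        also have "\<dots> = C * exp (\<delta> * t)" by (simp add: C_def algebra_simps)
        finally have "(norm x)\<^sup>2 * q x * \<bar>v x\<bar> \<le> C * exp (\<delta> * t) * \<bar>v x\<bar>" by (rule mult_right_mono) simp
        then show ?thesis by (simp add: t_def mult.assoc)
      qed
      show "(\<lambda>x. v (0 + x)) \<in> O[at 0](\<lambda>x. norm x ^ k)" for k using vanish by simp
    qed (use that in auto)
    then show ?thesis using R(1) by (intro exI[of _ "R * exp (- 2)"]) auto
  qed
  then obtain \<rho> where \<rho>: "0 < \<rho>" "\<And>x. x \<noteq> 0 \<Longrightarrow> norm x < \<rho> \<Longrightarrow> v x = 0" by blast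
  have Zne: "Z \<noteq> {}"
  proof -
    obtain r0 where r0: "0 < r0" "cball 0 r0 \<subseteq> \<Omega>" using \<Omega> open_contains_cball by blast
    obtain e :: 'a where e: "norm e = 1" using vector_choose_size[of 1] by auto
    define m where "m = min r0 (\<rho> / 2)"
    have m: "0 < m" "m \<le> r0" "m < \<rho>" using r0 \<rho> by (auto simp: m_def)
    define y where "y = m *\<^sub>R e"
    have ny: "norm y = m" using m e by (simp add: y_def)
    have yU: "y \<in> U" using ny m r0(2) by (auto simp: U_def)
    define W where "W = {z::'a. z \<noteq> 0 \<and> norm z < \<rho>}"
    have "W = ball 0 \<rho> - {0}" by (auto simp: W_def)
    then have "open W" by (simp add: open_delete)
    moreover have "y \<in> W" using ny m by (auto simp: W_def)
    ultimately obtain r where "0 < r" "ball y r \<subseteq> W" using open_contains_ball by blast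
    then have "y \<in> Z" unfolding Z_def using yU \<rho>(2) by (auto simp: W_def subset_iff)
    then show ?thesis by blast
  qed
  have Zop: "open Z"
    unfolding open_contains_ball
  proof
    fix y assume "y \<in> Z"
    then obtain r where r: "0 < r" "\<forall>z\<in>ball y r. v z = 0" and yU: "y \<in> U" unfolding Z_def by blast
    obtain r' where r': "0 < r'" "ball y r' \<subseteq> U" using U yU open_contains_ball by blast
    have "z \<in> Z" if "z \<in> ball y (min r r')" for z
    proof -
      have zr: "z \<in> ball y r" "z \<in> U" using that r'(2) by auto
      obtain d where "0 < d" "ball z d \<subseteq> ball y r" using openE[OF open_ball zr(1)] by blast
      then show ?thesis unfolding Z_def using zr(2) r(2) by blast
    qed
    then show "\<exists>e>0. ball y e \<subseteq> Z" using r(1) r'(1) by (intro exI[of _ "min r r'"]) auto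
  qed
  have clopen: "\<exists>\<rho>>0. \<forall>y\<in>Z. dist y z < \<rho> \<longrightarrow> z \<in> Z" if zU: "z \<in> U" for z
  proof -
    obtain r0 where r0: "0 < r0" "ball z r0 \<subseteq> U" using U zU open_contains_ball by blast
    define R where "R = min 1 (r0 / 2)"
    have R: "0 < R" "R \<le> 1" "2 * R \<le> r0" using r0 by (auto simp: R_def)
    \<comment> \<open>The radius is fixed by \<open>z\<close> before \<open>y\<close> is chosen. The
      bound \<open>M\<close> below depends on \<open>y\<close>, but it affects only the constant of
      the estimate and not this radius.\<close>
    define \<rho> where "\<rho> = R * exp (- 2)"
    have \<rho>: "0 < \<rho>" "\<rho> \<le> R" using R by (auto simp: \<rho>_def mult_le_cancel_left1)
    have "z \<in> Z" if y: "y \<in> Z" and d: "dist y z < \<rho>" for y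
    proof -
      have yU: "cball y R \<subseteq> U"
      proof
        fix x assume "x \<in> cball y R"
        then have "dist z x < r0" using dist_triangle[of z x y] d \<rho> R by (simp add: dist_commute)
        then show "x \<in> U" using r0 by auto
      qed
      obtain r where r: "0 < r" "\<And>x. dist y x < r \<Longrightarrow> v x = 0" using y unfolding Z_def by auto
      have "bounded (Q ` cball y R)"
        by (intro compact_imp_bounded compact_continuous_image continuous_on_subset[OF Qc yU] compact_cball)
      then obtain M where M0: "\<forall>a\<in>Q ` cball y R. norm a \<le> M" unfolding bounded_iff by blast
      have M: "Q x \<le> \<bar>M\<bar>" if "x \<in> cball y R" for x
      proof -
        have "norm (Q x) \<le> M" using M0 that by blast
        then show ?thesis unfolding real_norm_def by linarith
      qed
      have R2: "exp (1 * (ln R - 1)) \<le> 1/2"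
      proof -
        have "exp (1 * (ln R - 1)) = R / exp 1" using R(1) by (simp add: exp_diff)
        also have "\<dots> \<le> 1 / 2" using R exp_ge_add_one_self[of 1] by (intro frac_le) auto
        finally show ?thesis .
      qed
      \<comment> \<open>Unique continuation centred at \<open>y\<close>, with c = 0 and \<delta> =
        1: since |x| \<le> 1, |x|^2 Q \<le> |M| |x|. Vanishing of infinite order at \<open>y\<close>
        is trivial, as \<open>v\<close> is zero near \<open>y\<close>.\<close>
      have step: "v (y + x) = 0" if "x \<noteq> 0" "norm x < R * exp (- 2)" for x
      proof (rule weak_strong_unique_continuation[OF U vc _ _ weak2 _ _ _ R(1,2) R2, of "\<bar>M\<bar>" y 0])
        show "continuous_on U (\<lambda>x. Q x * \<bar>v x\<bar>)" using vc Qc by (auto intro!: continuous_intros)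
        show "y + x \<in> U" if "norm x \<le> R" for x using that yU by (auto simp: subset_iff dist_norm)
        show "(norm x)\<^sup>2 * (Q (y + x) * \<bar>v (y + x)\<bar>) \<le> \<bar>M\<bar> * exp (1 * ln (norm x)) * \<bar>v (y + x)\<bar>"
          if x: "x \<noteq> 0" "norm x \<le> R" for x
        proof -
          have "(norm x)\<^sup>2 * Q (y + x) \<le> (norm x)\<^sup>2 * \<bar>M\<bar>" using M[of "y + x"] x by (intro mult_left_mono) (auto simp: dist_norm)
          also have "\<dots> \<le> norm x * \<bar>M\<bar>" using x R by (intro mult_right_mono) (auto simp: power2_eq_square mult_left_le)
          also have "\<dots> = \<bar>M\<bar> * exp (1 * ln (norm x))" using x by simp
          finally have "(norm x)\<^sup>2 * Q (y + x) * \<bar>v (y + x)\<bar> \<le> \<bar>M\<bar> * exp (1 * ln (norm x)) * \<bar>v (y + x)\<bar>"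
            by (rule mult_right_mono) simp
          then show ?thesis by (simp add: mult.assoc)
        qed
        show "(\<lambda>x. v (y + x)) \<in> O[at 0](\<lambda>x. norm x ^ k)" for k
        proof (rule bigoI[of _ 1])
          show "eventually (\<lambda>x. norm (v (y + x)) \<le> 1 * norm (norm x ^ k)) (at 0)"
            unfolding eventually_at using r by (intro exI[of _ r]) (auto simp: dist_norm)
        qed
      qed (use that in auto)
      have v0: "v x = 0" if "dist y x < \<rho>" for x
      proof (cases "x = y")
        case False
        then show ?thesis using step[of "x - y"] that by (simp add: \<rho>_def dist_norm norm_minus_commute)
      qed (use r in simp)
      have "z \<in> ball y \<rho>" using d by simp
      then obtain d' where "0 < d'" "ball z d' \<subseteq> ball y \<rho>" using open_contains_ball open_ball by blast
      then show ?thesis unfolding Z_def using zU v0 by (auto simp: subset_iff)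
    qed
    then show ?thesis using \<rho>(1) by blast
  qed
  have "open (U - Z)"
    unfolding open_contains_ball
  proof
    fix z assume z: "z \<in> U - Z"
    then obtain r where r: "0 < r" "\<forall>y\<in>Z. dist y z < r \<longrightarrow> z \<in> Z" using clopen by blast
    obtain r' where r': "0 < r'" "ball z r' \<subseteq> U" using U z open_contains_ball by blast
    have "ball z (min r r') \<subseteq> U - Z" using r(2) r'(2) z by (auto simp: dist_commute)
    then show "\<exists>e>0. ball z e \<subseteq> U - Z" using r(1) r'(1) by (intro exI[of _ "min r r'"]) auto
  qed
  \<comment> \<open>Removing a point keeps an open connected set connected in dimension at least
    2.\<close>
  moreover have "connected U" unfolding U_def by (rule connected_open_delete[OF \<Omega>(1,2) dim])
  moreover have "Z \<subseteq> U" by (auto simp: Z_def)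
  ultimately have "U - Z = {}"
    using Zop Zne connectedD[of U Z "U - Z"] by blast
  then have "x \<in> Z" using x by (auto simp: U_def)
  then show ?thesis unfolding Z_def by auto
qed

theorem corollary2p4:
  fixes \<Omega> :: "(real ^ 'n) set"
    and h :: "real ^ 'n \<Rightarrow> real"
    and f :: "real ^ 'n \<Rightarrow> real \<Rightarrow> real"
    and u v :: "real ^ 'n \<Rightarrow> real"
  assumes "CARD('n) \<ge> 3"
    and "open \<Omega>" and "connected \<Omega>" and "0 \<in> \<Omega>"
    and "assumption_H \<Omega> h"
    and "assumption_F \<Omega> f"
    and "H_solution \<Omega> h f u"
    and "pointwise_representative \<Omega> u v"
    and "\<And>k::nat. v \<in> O[at 0](\<lambda>x. norm x ^ k)"
  shows "(\<forall>x\<in>\<Omega> - {0}. v x = 0) \<and> (AE x in lebesgue_on \<Omega>. u x = 0)"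
proof
  have "2 \<le> DIM(real ^ 'n)" using assms(1) by simp
  then show v0: "\<forall>x\<in>\<Omega> - {0}. v x = 0"
    using unique_continuation[OF _ assms(2-9)] by blast
  have "AE x in lebesgue. x \<in> \<Omega> \<longrightarrow> v x = u x"
    using assms(2,8) AE_restrict_space_iff[of \<Omega> lebesgue "\<lambda>x. v x = u x"]
    unfolding pointwise_representative_def by simp
  \<comment> \<open>The pointwise statement excludes the origin, which is a null set.\<close>
  moreover have "AE x in lebesgue. x \<noteq> (0 :: real ^ 'n)"
    by (rule AE_completion) (rule AE_lborel_singleton)
  ultimately have "AE x in lebesgue. x \<in> \<Omega> \<longrightarrow> u x = 0"
    by eventually_elim (use v0 in auto)
  then show "AE x in lebesgue_on \<Omega>. u x = 0"
    using assms(2) AE_restrict_space_iff[of \<Omega> lebesgue "\<lambda>x. u x = 0"] by simp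
qed

end
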